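(* Fix $k\in\{1,2,3,4\}$ and choose $x,t>0$. Let $g\in\mathbb{R}^{n_1\times\cdots\times n_d}$ be arbitrary. Let $S$ be an arbitrary subset, of size $s:=|S|$, of $\times_{i\in[d]}[k+1+(k+2)k:\,n_i-k+1-(k+2)k]$. For a large enough constant $C>0$ that only depends on $k$, choose $$\lambda\ge C\,d\,\sqrt{\sum_{i=1}^d\left(\frac{d_{i,\max}(S)}{n_i}\right)^{2k-1}}\ \lambda_0(t).$$ Then, with probability at least $1-e^{-x}-e^{-t}$, it holds that $$\frac{\|(\hat f-f^0)_{\mathcal N_k^\perp}\|_2^2}{n}\le\frac{\|g-f^0_{\mathcal N_k^\perp}\|_2^2}{n}+4\lambda\|(D^kg)_{-S}\|_1+\frac{2\sigma^2}{n}\left(\sqrt{x}+\sqrt{ks}\right)^2$$ $$+\ \mathcal O\!\left(\lambda^2\Big(\sum_{i=1}^d\log(e\,d_{i,\max}(S))\Big)\sum_{m=1}^s\sum_{z\in\{-,+\}^d}\left(\frac{n}{d_m^z}\right)^{2k-1}\right).$$ In particular, the constraint on $C$ is $$C\ge\frac{k^{\frac{2k-1}{2}}}{a_0}\quad\text{with}\quad a_0=\begin{cases}1,&k=1,\\ 8\sqrt2/7\approx1.62,&k=2,\\ 144\sqrt3/76\approx3.28,&k=3,\\ 10.10,&k=4,\end{cases}$$ as $\min_{i\in[d]}\min_{m\in[s]}\min\{d_{i,m}^-,d_{i,m}^+\}\to\infty$.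
   Context: Notation: $[i:j]=\{i,\dots,j\}$, $[j]=[1:j]$. For a tensor $a$, $\|a\|_2$ is the Frobenius norm and $\|a\|_1$ the sum of absolute values of the entries; $a_{-S}$ denotes the entries of $a$ with index not in $S$. Model: $Y=f^0+\epsilon$ with $Y,f^0,\epsilon\in\mathbb{R}^{n_1\times\cdots\times n_d}$, $n=n_1\cdots n_d$, where $\epsilon$ has i.i.d. $\mathcal N(0,\sigma^2)$ entries, $\sigma\in(0,\infty)$ known. Difference operator: the $k$-th order difference along coordinate $i$ is $(D_i^kf)(j_1,\dots,j_d)=n_i^{k-1}\sum_{l=0}^k(-1)^l\binom kl f(j_1,\dots,j_i-l,\dots,j_d)$ for $j_i\in[k+1:n_i]$. The total difference operator is $D^k=\prod_{i=1}^dD_i^k$; its output is indexed by $\times_{i\in[d]}[k+1:n_i]$. $\mathrm{TV}_k(f)=\|D^kf\|_1$. $\mathcal N_k=\{f:D^kf=0\}$, $\mathcal N_k^\perp$ is its orthogonal complement, and $f_{\mathcal N_k^\perp}$ is the orthogonal projection of $f$ onto $\mathcal N_k^\perp$. Estimator: $\hat f_{\mathcal N_k^\perp}:=\arg\min_{\mathrm f\in\mathbb{R}^{n_1\times\cdots\times n_d}}\{\|(Y-\mathrm f)_{\mathcal N_k^\perp}\|_2^2/n+2\lambda\,\mathrm{TV}_k(\mathrm f)\}$, where the objective depends on $\mathrm f$ only through its projection onto $\mathcal N_k^\perp$ and the minimizer is taken in $\mathcal N_k^\perp$. $(\hat f-f^0)_{\mathcal N_k^\perp}$ means $\hat f_{\mathcal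 N_k^\perp}-f^0_{\mathcal N_k^\perp}$. $\lambda_0(t):=\sigma\sqrt{(2\log(2n)+2t)/n}$. Tessellation: write $S=\{t_1,\dots,t_s\}$, $t_m=(t_{1,m},\dots,t_{d,m})$. With $S$ is associated a hyperrectangular tessellation $\{R_m\}_{m=1}^s$ of $\times_{i\in[d]}[k+1:n_i]$, i.e. a family of hyperrectangles $R_m=\times_{i}[t_{i,m}^-:t_{i,m}^+]\subseteq\times_i[k+1:n_i]$ whose union is $\times_i[k+1:n_i]$, such that distinct $R_m,R_{m'}$ possibly share boundary points but not interior points, and such that for every $m$ the points of $\times_{i}[t_{i,m}:t_{i,m}+k-1]$ are interior points of $R_m$. The choice of the tessellation is arbitrary, subject to the standing requirement $\min\{d_{i,m}^-,d_{i,m}^+\}\ge(k+2)k$ for all $i\in[d]$, $m\in[s]$, where $$d_{i,m}^-=t_{i,m}-t_{i,m}^-,\qquad d_{i,m}^+=t_{i,m}^+-t_{i,m}-k+1.$$ Put $d_m^{z}=d_{1,m}^{z_1}\cdots d_{d,m}^{z_d}$ for $z=(z_1,\dots,z_d)\in\{-,+\}^d$, and $d_{i,\max}(S)=\max_{m\in[s]}\max\{d_{i,m}^-,d_{i,m}^+\}$. The $\mathcal O(\cdot)$ neglects constants, which may depend on $k$ and $d$. *)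

theory Defs
  imports "HOL-Probability.Probability"
begin

text \<open>
  The number of coordinates \<open>d\<close> and the side lengths \<open>n 1, \<dots>, n d\<close> are values, not types, since the
  constants in the theorem have to be uniform in them.  A multi-index is an element of a dependent
  product over \<open>{1..d}\<close>, and a tensor is a real function on multi-indices that vanishes off the grid.
\<close>

type_synonym mindex = "nat \<Rightarrow> nat"
type_synonym tensor = "mindex \<Rightarrow> real"

definition hyperrect :: "nat \<Rightarrow> mindex \<Rightarrow> mindex \<Rightarrow> mindex set" where
  "hyperrect d a b = PiE {1..d} (\<lambda>i. {a i..b i})"

definition hyperrect_interior :: "nat \<Rightarrow> mindex \<Rightarrow> mindex \<Rightarrow> mindex set" where
  "hyperrect_interior d a b = PiE {1..d} (\<lambda>i. {a i<..<b i})"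

definition grid :: "nat \<Rightarrow> (nat \<Rightarrow> nat) \<Rightarrow> mindex set" where
  "grid d n = hyperrect d (\<lambda>i. 1) n"

definition diff_grid :: "nat \<Rightarrow> (nat \<Rightarrow> nat) \<Rightarrow> nat \<Rightarrow> mindex set" where
  "diff_grid d n k = hyperrect d (\<lambda>i. k + 1) n"

definition num_entries :: "nat \<Rightarrow> (nat \<Rightarrow> nat) \<Rightarrow> nat" where
  "num_entries d n = (\<Prod>i=1..d. n i)"

definition tensors :: "nat \<Rightarrow> (nat \<Rightarrow> nat) \<Rightarrow> tensor set" where
  "tensors d n = {f. \<forall>j. j \<notin> grid d n \<longrightarrow> f j = 0}"

definition tinner :: "nat \<Rightarrow> (nat \<Rightarrow> nat) \<Rightarrow> tensor \<Rightarrow> tensor \<Rightarrow> real" where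
  "tinner d n f h = (\<Sum>j\<in>grid d n. f j * h j)"

definition frob_norm :: "nat \<Rightarrow> (nat \<Rightarrow> nat) \<Rightarrow> tensor \<Rightarrow> real" where
  "frob_norm d n f = L2_set f (grid d n)"

definition partial_diff :: "(nat \<Rightarrow> nat) \<Rightarrow> nat \<Rightarrow> nat \<Rightarrow> tensor \<Rightarrow> tensor" where
  "partial_diff n k i f = (\<lambda>j.
     if j i \<in> {k + 1..n i}
     then real (n i) ^ (k - 1) * (\<Sum>l=0..k. (-1) ^ l * real (k choose l) * f (j(i := j i - l)))
     else 0)"

definition total_diff :: "nat \<Rightarrow> (nat \<Rightarrow> nat) \<Rightarrow> nat \<Rightarrow> tensor \<Rightarrow> tensor" where
  "total_diff d n k f = fold (partial_diff n k) [1..<d + 1] f"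

definition TV :: "nat \<Rightarrow> (nat \<Rightarrow> nat) \<Rightarrow> nat \<Rightarrow> tensor \<Rightarrow> real" where
  "TV d n k f = (\<Sum>j\<in>diff_grid d n k. \<bar>total_diff d n k f j\<bar>)"

definition null_space :: "nat \<Rightarrow> (nat \<Rightarrow> nat) \<Rightarrow> nat \<Rightarrow> tensor set" where
  "null_space d n k = {f \<in> tensors d n. \<forall>j\<in>diff_grid d n k. total_diff d n k f j = 0}"

definition null_perp :: "nat \<Rightarrow> (nat \<Rightarrow> nat) \<Rightarrow> nat \<Rightarrow> tensor set" where
  "null_perp d n k = {h \<in> tensors d n. \<forall>f\<in>null_space d n k. tinner d n f h = 0}"

definition orth_proj :: "nat \<Rightarrow> (nat \<Rightarrow> nat) \<Rightarrow> tensor set \<Rightarrow> tensor \<Rightarrow> tensor" where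
  "orth_proj d n V f = (THE h. h \<in> V \<and> (\<forall>v\<in>V. tinner d n (\<lambda>j. f j - h j) v = 0))"

abbreviation proj_perp :: "nat \<Rightarrow> (nat \<Rightarrow> nat) \<Rightarrow> nat \<Rightarrow> tensor \<Rightarrow> tensor" where
  "proj_perp d n k \<equiv> orth_proj d n (null_perp d n k)"

definition objective :: "nat \<Rightarrow> (nat \<Rightarrow> nat) \<Rightarrow> nat \<Rightarrow> real \<Rightarrow> tensor \<Rightarrow> tensor \<Rightarrow> real" where
  "objective d n k lam Y f =
     (frob_norm d n (proj_perp d n k (\<lambda>j. Y j - f j)))\<^sup>2 / real (num_entries d n)
       + 2 * lam * TV d n k f"

text \<open>
  The objective is constant along the null space; the estimator is its minimizer in the orthogonal
  complement, where it is unique.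
\<close>

definition estimator :: "nat \<Rightarrow> (nat \<Rightarrow> nat) \<Rightarrow> nat \<Rightarrow> real \<Rightarrow> tensor \<Rightarrow> tensor" where
  "estimator d n k lam Y = arg_min_on (objective d n k lam Y) (null_perp d n k)"

text \<open>
  The joint law of i.i.d. centred Gaussian entries with standard deviation \<open>\<sigma>\<close>.  Using this law in
  place of an arbitrary underlying probability space keeps the constants of the theorem from
  depending on a type variable for the sample space.
\<close>

definition noise_law :: "nat \<Rightarrow> (nat \<Rightarrow> nat) \<Rightarrow> real \<Rightarrow> tensor measure" where
  "noise_law d n \<sigma> = PiM (grid d n) (\<lambda>_. density lborel (normal_density 0 \<sigma>))"

definition observation :: "nat \<Rightarrow> (nat \<Rightarrow> nat) \<Rightarrow> tensor \<Rightarrow> tensor \<Rightarrow> tensor" where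
  "observation d n f0 \<epsilon> = (\<lambda>j. if j \<in> grid d n then f0 j + \<epsilon> j else 0)"

definition lambda0 :: "nat \<Rightarrow> (nat \<Rightarrow> nat) \<Rightarrow> real \<Rightarrow> real \<Rightarrow> real" where
  "lambda0 d n \<sigma> t = \<sigma> * sqrt ((2 * ln (2 * real (num_entries d n)) + 2 * t) / real (num_entries d n))"

text \<open>
  The hyperrectangles are indexed by the elements \<open>p\<close> of the set \<open>S\<close> themselves: the one belonging
  to \<open>p\<close> has lower corner \<open>lo p\<close> and upper corner \<open>hi p\<close>.  That a common point of two of them is never
  an interior point is required with respect to both; on the integer grid this is stronger than
  disjointness of the two interiors, and equivalent to disjointness of the interiors of the
  corresponding real hyperrectangles.
\<close>

definition is_tessellation ::
  "nat \<Rightarrow> (nat \<Rightarrow> nat) \<Rightarrow> nat \<Rightarrow> mindex set \<Rightarrow> (mindex \<Rightarrow> mindex) \<Rightarrow> (mindex \<Rightarrow> mindex) \<Rightarrow> bool" where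
  "is_tessellation d n k S lo hi \<longleftrightarrow>
     (\<Union>p\<in>S. hyperrect d (lo p) (hi p)) = diff_grid d n k \<and>
     (\<forall>p\<in>S. \<forall>q\<in>S. p \<noteq> q \<longrightarrow> hyperrect_interior d (lo p) (hi p) \<inter> hyperrect d (lo q) (hi q) = {}) \<and>
     (\<forall>p\<in>S. hyperrect d p (\<lambda>i. p i + k - 1) \<subseteq> hyperrect_interior d (lo p) (hi p))"

datatype side = Minus | Plus

text \<open>
  In a tessellation \<open>lo p i < p i\<close> and \<open>p i + k - 1 < hi p i\<close>, so neither subtraction truncates.
\<close>

fun side_dist ::
  "nat \<Rightarrow> (mindex \<Rightarrow> mindex) \<Rightarrow> (mindex \<Rightarrow> mindex) \<Rightarrow> mindex \<Rightarrow> nat \<Rightarrow> side \<Rightarrow> nat" where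
  "side_dist k lo hi p i Minus = p i - lo p i"
| "side_dist k lo hi p i Plus = hi p i + 1 - (p i + k)"

definition d_max ::
  "nat \<Rightarrow> mindex set \<Rightarrow> (mindex \<Rightarrow> mindex) \<Rightarrow> (mindex \<Rightarrow> mindex) \<Rightarrow> nat \<Rightarrow> nat" where
  "d_max k S lo hi i =
     Max ((\<lambda>p. max (side_dist k lo hi p i Minus) (side_dist k lo hi p i Plus)) ` S)"

definition d_min ::
  "nat \<Rightarrow> nat \<Rightarrow> mindex set \<Rightarrow> (mindex \<Rightarrow> mindex) \<Rightarrow> (mindex \<Rightarrow> mindex) \<Rightarrow> nat" where
  "d_min d k S lo hi =
     Min ((\<lambda>(i, p). min (side_dist k lo hi p i Minus) (side_dist k lo hi p i Plus)) ` ({1..d} \<times> S))"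

definition side_volume ::
  "nat \<Rightarrow> nat \<Rightarrow> (mindex \<Rightarrow> mindex) \<Rightarrow> (mindex \<Rightarrow> mindex) \<Rightarrow> mindex \<Rightarrow> (nat \<Rightarrow> side) \<Rightarrow> nat" where
  "side_volume d k lo hi p z = (\<Prod>i=1..d. side_dist k lo hi p i (z i))"

definition a0 :: "nat \<Rightarrow> real" where
  "a0 k = (if k = 1 then 1
           else if k = 2 then 8 * sqrt 2 / 7
           else if k = 3 then 144 * sqrt 3 / 76
           else 10.10)"

end

theory Submission
  imports Defs
begin

text \<open>
  Let \<open>\<psi> j\<close> be the tensor in the orthogonal complement of the null space whose differences are the
  unit vector at \<open>j\<close>.  The projection of the noise onto the span of the \<open>\<psi> j\<close> with \<open>j\<close> in an active
  set is paid for by the number of active points, and the remaining noise meets the difference at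
  \<open>j\<close> with a weight bounded by the distance of \<open>\<psi> j\<close> to this span.  A truncated polynomial anchored
  at a nearby active point bounds that distance by the power \<open>k - 1/2\<close> of the distance of \<open>j\<close> to the
  active set.  The signs of the differences on \<open>S\<close> are interpolated by bumps around the points of
  \<open>S\<close> that leave room for these weights; by duality only the norm of the adjoint difference operator
  on the bumps enters the bound.

  The last term of the bound dominates \<open>card S * lambda0\<^sup>2\<close> up to a constant.  So the active set may
  contain a bounded number of additional points in each cell, which makes the noise weights as small
  as needed and gives the result for every positive lower bound on \<open>C\<close>.  For the same reason the
  projected noise can be controlled by a union bound over at most \<open>n\<close> directions instead of a
  chi-square tail, and the probability bound does not depend on \<open>x\<close>.
\<close>

section \<open>Orthogonal projections in finite dimension\<close>

text \<open>The exponents force the construction. Cutting the polynomial of \<psi> j at distances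
  \<open>e c\<close> from \<open>j\<close> leaves an error whose squared norm is of order N times
  the sum of (e c / n c)^(2k-1), so a bump of width M c around a point of S must fall below 1 at
  least like (e c / M c)^(k-1/2). A single k-fold box average falls only like (e c / M c)^k, too
  slowly near the centre; this is why bumps of all widths up to M are mixed. The k-th differences of
  the mixture decay like the inverse root of the distance, their squares sum to a harmonic series,
  and that is the logarithm in the bound. N times the squared norm of the adjoint differences of a
  bump is of order prod (n c / M c)^(2k-1), the volume term of the corner with the shorter sides
  when M c is a fixed fraction 1/m of these sides. A large m makes the bumps narrow compared with D
  and gains a factor of order sqrt m over the noise; m is chosen from k, d and the threshold for C,
  and enters only the constant K. Widths are integers: a short cell gets width 1, where the bump is
  a point mass.\<close>

definition inner_on :: "'a set \<Rightarrow> ('a \<Rightarrow> real) \<Rightarrow> ('a \<Rightarrow> real) \<Rightarrow> real" where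
  "inner_on G f h = (\<Sum>j\<in>G. f j * h j)"

definition supported_on :: "'a set \<Rightarrow> ('a \<Rightarrow> real) set" where
  "supported_on G = {f. \<forall>j. j \<notin> G \<longrightarrow> f j = 0}"

lemma inner_on_commute: "inner_on G f h = inner_on G h f"
  by (simp add: inner_on_def mult.commute)

lemma inner_on_add_left: "inner_on G (\<lambda>j. f j + g j) h = inner_on G f h + inner_on G g h"
  by (simp add: inner_on_def algebra_simps sum.distrib)

lemma inner_on_diff_left: "inner_on G (\<lambda>j. f j - g j) h = inner_on G f h - inner_on G g h"
  by (simp add: inner_on_def algebra_simps sum_subtractf)

lemma inner_on_scale_left: "inner_on G (\<lambda>j. c * f j) h = c * inner_on G f h"
  by (simp add: inner_on_def sum_distrib_left mult_ac)

lemma inner_on_sum_left: "inner_on G (\<lambda>j. \<Sum>b\<in>B. c b * F b j) h = (\<Sum>b\<in>B. c b * inner_on G (F b) h)"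
  unfolding inner_on_def sum_distrib_right sum_distrib_left
  by (subst sum.swap) (simp add: mult_ac)

lemma inner_on_add_right: "inner_on G h (\<lambda>j. f j + g j) = inner_on G h f + inner_on G h g"
  by (simp add: inner_on_def algebra_simps sum.distrib)

lemma inner_on_diff_right: "inner_on G h (\<lambda>j. f j - g j) = inner_on G h f - inner_on G h g"
  by (simp add: inner_on_def algebra_simps sum_subtractf)

lemma inner_on_scale_right: "inner_on G h (\<lambda>j. c * f j) = c * inner_on G h f"
  by (simp add: inner_on_def sum_distrib_left mult_ac)

lemma inner_on_sum_right: "inner_on G h (\<lambda>j. \<Sum>b\<in>B. c b * F b j) = (\<Sum>b\<in>B. c b * inner_on G h (F b))"
  using inner_on_sum_left[of G c F B h] by (simp add: inner_on_commute)

lemmas inner_on_linear = inner_on_add_left inner_on_diff_left inner_on_scale_left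
  inner_on_add_right inner_on_diff_right inner_on_scale_right

lemma inner_on_cong: "(\<And>j. j \<in> G \<Longrightarrow> f j = f' j) \<Longrightarrow> (\<And>j. j \<in> G \<Longrightarrow> h j = h' j) \<Longrightarrow> inner_on G f h = inner_on G f' h'"
  by (simp add: inner_on_def)

lemma inner_on_ge_0: "0 \<le> inner_on G f f"
  by (simp add: inner_on_def sum_nonneg)

lemma inner_on_eq_0:
  assumes "finite G" "f \<in> supported_on G" "inner_on G f f = 0"
  shows "f = (\<lambda>_. 0)"
proof
  fix j
  have "\<forall>j\<in>G. f j * f j = 0"
    using assms(1,3) unfolding inner_on_def by (subst (asm) sum_nonneg_eq_0_iff) auto
  then show "f j = 0" using assms(2) by (cases "j \<in> G") (auto simp: supported_on_def)
qed

lemma inner_on_Cauchy_Schwarz: "(inner_on G f h)\<^sup>2 \<le> inner_on G f f * inner_on G h h"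
  unfolding inner_on_def using Cauchy_Schwarz_ineq_sum[of f h G] by (simp add: power2_eq_square)

lemma inner_on_le: "inner_on G f h \<le> sqrt (inner_on G f f) * sqrt (inner_on G h h)"
  using inner_on_Cauchy_Schwarz[of G f h] by (simp add: real_le_rsqrt flip: real_sqrt_mult)

lemma supported_on_closed:
  "f \<in> supported_on G \<Longrightarrow> h \<in> supported_on G \<Longrightarrow> (\<lambda>j. f j + h j) \<in> supported_on G"
  "f \<in> supported_on G \<Longrightarrow> h \<in> supported_on G \<Longrightarrow> (\<lambda>j. f j - h j) \<in> supported_on G"
  "f \<in> supported_on G \<Longrightarrow> (\<lambda>j. c * f j) \<in> supported_on G"
  "(\<And>b. b \<in> B \<Longrightarrow> F b \<in> supported_on G) \<Longrightarrow> (\<lambda>j. \<Sum>b\<in>B. a b * F b j) \<in> supported_on G"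
  by (auto simp: supported_on_def)

definition orthonormal :: "'a set \<Rightarrow> ('a \<Rightarrow> real) set \<Rightarrow> bool" where
  "orthonormal G B \<longleftrightarrow> finite B \<and> B \<subseteq> supported_on G \<and>
     (\<forall>b\<in>B. \<forall>c\<in>B. inner_on G b c = (if b = c then 1 else 0))"

text \<open>An orthonormal set stands for the subspace that it spans, and
  \<open>proj_on G B v = v\<close> expresses membership. Only values on \<open>G\<close> are read,
  so the projection also applies to noise vectors, which are \<open>undefined\<close> off the
  grid.\<close>

definition proj_on :: "'a set \<Rightarrow> ('a \<Rightarrow> real) set \<Rightarrow> ('a \<Rightarrow> real) \<Rightarrow> 'a \<Rightarrow> real" where
  "proj_on G B f = (\<lambda>j. \<Sum>b\<in>B. inner_on G f b * b j)"

lemma proj_on_supported: "orthonormal G B \<Longrightarrow> proj_on G B f \<in> supported_on G"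
  unfolding proj_on_def orthonormal_def
  using supported_on_closed(4)[of B "\<lambda>b. b" G] by blast

lemma inner_on_proj_basis:
  assumes "orthonormal G B" "b \<in> B"
  shows "inner_on G (proj_on G B f) b = inner_on G f b"
proof -
  have "inner_on G (proj_on G B f) b = (\<Sum>c\<in>B. inner_on G f c * (if c = b then 1 else 0))"
    unfolding proj_on_def inner_on_sum_left using assms
    by (intro sum.cong) (auto simp: orthonormal_def)
  also have "\<dots> = (\<Sum>c\<in>B. if c = b then inner_on G f c else 0)" by (intro sum.cong) auto
  finally show ?thesis using assms by (simp add: orthonormal_def)
qed

lemma inner_on_proj_proj:
  assumes "orthonormal G B"
  shows "inner_on G (proj_on G B f) (proj_on G B h) = (\<Sum>b\<in>B. inner_on G f b * inner_on G h b)"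
proof -
  have "inner_on G (proj_on G B f) (proj_on G B h) = (\<Sum>b\<in>B. inner_on G h b * inner_on G (proj_on G B f) b)"
    by (subst (2) proj_on_def) (rule inner_on_sum_right)
  then show ?thesis using assms by (simp add: inner_on_proj_basis mult.commute)
qed

lemma inner_on_proj_left: "inner_on G (proj_on G B f) h = (\<Sum>b\<in>B. inner_on G f b * inner_on G h b)"
  unfolding proj_on_def inner_on_sum_left by (simp add: inner_on_commute)

lemma inner_on_proj_swap: "inner_on G (proj_on G B f) h = inner_on G f (proj_on G B h)"
  by (metis (no_types, lifting) inner_on_proj_left inner_on_commute mult.commute sum.cong)

lemma proj_on_idem: "orthonormal G B \<Longrightarrow> proj_on G B (proj_on G B f) = proj_on G B f"
  by (subst (1 3) proj_on_def) (simp add: inner_on_proj_basis)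

lemma proj_on_linear:
  "proj_on G B (\<lambda>j. f j + h j) = (\<lambda>j. proj_on G B f j + proj_on G B h j)"
  "proj_on G B (\<lambda>j. f j - h j) = (\<lambda>j. proj_on G B f j - proj_on G B h j)"
  "proj_on G B (\<lambda>j. c * f j) = (\<lambda>j. c * proj_on G B f j)"
  by (simp_all add: proj_on_def inner_on_linear algebra_simps sum.distrib sum_subtractf sum_distrib_left)

lemma proj_on_sum: "proj_on G B (\<lambda>j. \<Sum>a\<in>A. c a * F a j) = (\<lambda>j. \<Sum>a\<in>A. c a * proj_on G B (F a) j)"
  unfolding proj_on_def inner_on_sum_left sum_distrib_right sum_distrib_left
  by (subst sum.swap) (simp add: mult_ac)

lemma proj_on_self:
  assumes "orthonormal G B" "b \<in> B"
  shows "proj_on G B b = b"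
proof
  fix j
  have "proj_on G B b j = (\<Sum>c\<in>B. (if b = c then 1 else 0) * c j)"
    unfolding proj_on_def using assms by (intro sum.cong) (auto simp: orthonormal_def)
  also have "\<dots> = (\<Sum>c\<in>B. if b = c then c j else 0)" by (intro sum.cong) auto
  finally show "proj_on G B b j = b j" using assms by (simp add: orthonormal_def)
qed

lemma proj_on_cong: "(\<And>j. j \<in> G \<Longrightarrow> f j = h j) \<Longrightarrow> proj_on G B f = proj_on G B h"
  unfolding proj_on_def by (simp cong: inner_on_cong)

lemma norm_proj_on_le:
  assumes "orthonormal G B"
  shows "inner_on G (proj_on G B f) (proj_on G B f) \<le> inner_on G f f"
proof -
  let ?p = "proj_on G B f"
  have "inner_on G ?p ?p = inner_on G f ?p"
    using inner_on_proj_swap[of G B f ?p] proj_on_idem[OF assms] by simp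
  then have "inner_on G (\<lambda>j. f j - ?p j) (\<lambda>j. f j - ?p j) = inner_on G f f - inner_on G ?p ?p"
    by (simp add: inner_on_linear inner_on_commute[of G ?p f])
  then show ?thesis using inner_on_ge_0[of G "\<lambda>j. f j - ?p j"] by simp
qed

text \<open>The residual of \<open>f\<close> is orthogonal to the span, so Pythagoras applies. This
  turns any explicit element \<open>v\<close> of the span into an upper bound for the distance to
  it.\<close>

lemma norm_residual_le:
  assumes "orthonormal G B" "proj_on G B v = v"
  shows "inner_on G (\<lambda>j. f j - proj_on G B f j) (\<lambda>j. f j - proj_on G B f j)
    \<le> inner_on G (\<lambda>j. f j - v j) (\<lambda>j. f j - v j)"
proof -
  let ?p = "proj_on G B f"
  let ?u = "\<lambda>j. ?p j - v j" and ?r = "\<lambda>j. f j - ?p j"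
  have "proj_on G B ?u = ?u" using assms by (simp add: proj_on_linear proj_on_idem)
  then have "inner_on G ?r ?u = inner_on G (proj_on G B ?r) ?u"
    using inner_on_proj_swap[of G B ?r ?u] by simp
  also have "proj_on G B ?r = (\<lambda>_. 0)" using assms by (simp add: proj_on_linear proj_on_idem)
  finally have ru: "inner_on G ?r ?u = 0" by (simp add: inner_on_def)
  have "inner_on G (\<lambda>j. f j - v j) (\<lambda>j. f j - v j) = inner_on G (\<lambda>j. ?r j + ?u j) (\<lambda>j. ?r j + ?u j)"
    by simp
  also have "\<dots> = inner_on G ?r ?r + inner_on G ?u ?u + 2 * inner_on G ?r ?u"
    unfolding inner_on_add_left inner_on_add_right using inner_on_commute[of G ?r ?u] by linarith
  finally show ?thesis using ru inner_on_ge_0[of G ?u] by linarith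
qed

text \<open>The last two conclusions together say that \<open>B\<close> and the vectors
  \<open>a i\<close> have the same span, without a notion of linear span: nothing is lost, and
  whatever is orthogonal to all \<open>a i\<close> is orthogonal to \<open>B\<close>.\<close>

lemma gram_schmidt:
  assumes "finite G" "finite I" "\<And>i. i \<in> I \<Longrightarrow> a i \<in> supported_on G"
  obtains B where "orthonormal G B" "card B \<le> card I" "\<And>i. i \<in> I \<Longrightarrow> proj_on G B (a i) = a i"
    "\<And>b v. b \<in> B \<Longrightarrow> (\<And>i. i \<in> I \<Longrightarrow> inner_on G (a i) v = 0) \<Longrightarrow> inner_on G b v = 0"
proof -
  have "\<exists>B. orthonormal G B \<and> card B \<le> card I \<and> (\<forall>i\<in>I. proj_on G B (a i) = a i) \<and>
    (\<forall>b\<in>B. \<forall>v. (\<forall>i\<in>I. inner_on G (a i) v = 0) \<longrightarrow> inner_on G b v = 0)"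
    using assms(2,3)
  proof (induction I rule: finite_induct)
    case empty
    show ?case by (intro exI[of _ "{}"]) (auto simp: orthonormal_def)
  next
    case (insert i I)
    then obtain B where B: "orthonormal G B" "card B \<le> card I" "\<And>i. i \<in> I \<Longrightarrow> proj_on G B (a i) = a i"
      "\<And>b v. b \<in> B \<Longrightarrow> (\<And>i. i \<in> I \<Longrightarrow> inner_on G (a i) v = 0) \<Longrightarrow> inner_on G b v = 0"
      by (metis insertCI)
    define r where "r = (\<lambda>j. a i j - proj_on G B (a i) j)"
    define N where "N = inner_on G r r"
    have rs: "r \<in> supported_on G"
      unfolding r_def using insert.prems proj_on_supported[OF B(1)] by (intro supported_on_closed) auto
    show ?case
    \<comment> \<open>A vector that already lies in the span adds no basis element, hence only an
      inequality between the cardinalities.\<close>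
    proof (cases "N = 0")
      case True
      then have "r = (\<lambda>_. 0)" using inner_on_eq_0[OF assms(1) rs] by (simp add: N_def)
      then have "proj_on G B (a i) = a i" by (auto simp: r_def fun_eq_iff)
      then show ?thesis using B insert.hyps by (intro exI[of _ B]) auto
    next
      case False
      then have N: "N > 0" using inner_on_ge_0[of G r] by (simp add: N_def)
      define u where "u = (\<lambda>j. (1 / sqrt N) * r j)"
      have us: "u \<in> supported_on G" unfolding u_def using rs by (rule supported_on_closed)
      have uu: "inner_on G u u = 1"
        unfolding u_def inner_on_scale_left inner_on_scale_right using N by (simp add: N_def[symmetric])
      have rb: "inner_on G r b = 0" if "b \<in> B" for b
        unfolding r_def inner_on_diff_left using inner_on_proj_basis[OF B(1) that] by simp
      have ub: "inner_on G u b = 0" "inner_on G b u = 0" if "b \<in> B" for b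
        using rb[OF that] inner_on_commute[of G b u] unfolding u_def inner_on_scale_left by simp_all
      have uB: "u \<notin> B" using ub(1)[of u] uu by auto
      have fB: "finite B" using B(1) by (simp add: orthonormal_def)
      have on: "orthonormal G (insert u B)"
        using B(1) us uu ub uB unfolding orthonormal_def by auto
      have pr: "proj_on G (insert u B) f = (\<lambda>j. inner_on G f u * u j + proj_on G B f j)" for f
        using uB fB by (simp add: proj_on_def)
      have "inner_on G (proj_on G B (a i)) u = 0"
        unfolding inner_on_proj_left using ub by (intro sum.neutral) (auto simp: inner_on_commute)
      then have "inner_on G (a i) u = inner_on G r u"
        by (simp add: r_def inner_on_diff_left)
      also have "\<dots> = sqrt N" unfolding u_def inner_on_scale_right N_def[symmetric]
        using N by (simp add: real_div_sqrt)
      finally have iu: "inner_on G (a i) u = sqrt N" .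
      have pi: "proj_on G (insert u B) (a i) = a i"
        unfolding pr iu using N by (auto simp: u_def r_def)
      have pI: "proj_on G (insert u B) (a l) = a l" if "l \<in> I" for l
      proof -
        have "inner_on G (a l) u = inner_on G (proj_on G B (a l)) u" using B(3)[OF that] by simp
        also have "\<dots> = 0"
          unfolding inner_on_proj_left using ub by (intro sum.neutral) (auto simp: inner_on_commute)
        finally show ?thesis unfolding pr using B(3)[OF that] by simp
      qed
      have perp: "inner_on G b v = 0"
        if "b \<in> insert u B" "\<And>l. l \<in> insert i I \<Longrightarrow> inner_on G (a l) v = 0" for b v
      proof -
        have *: "inner_on G c v = 0" if "c \<in> B" for c using B(4)[OF that] that(1) \<open>\<And>l. l \<in> insert i I \<Longrightarrow> inner_on G (a l) v = 0\<close> by auto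
        have "inner_on G (proj_on G B (a i)) v = 0"
          unfolding inner_on_proj_left using * by (intro sum.neutral) (auto simp: inner_on_commute)
        then have "inner_on G u v = 0"
          using that(2)[of i] unfolding u_def r_def inner_on_scale_left inner_on_diff_left by simp
        then show ?thesis using * that(1) by auto
      qed
      have "card (insert u B) \<le> card (insert i I)"
        using B(2) uB fB insert.hyps by simp
      then show ?thesis using on pi pI perp by (intro exI[of _ "insert u B"]) blast
    qed
  qed
  then show ?thesis using that by metis
qed

section \<open>Gaussian vectors\<close>

text \<open>Completing the square turns the tilted density into a multiple of the normal density
  with mean \<open>l * \<sigma>\<^sup>2\<close>, whose integral is 1.\<close>

lemma nn_integral_exp_normal:
  assumes "0 < \<sigma>"
  shows "(\<integral>\<^sup>+ x. ennreal (exp (l * x)) \<partial>density lborel (\<lambda>x. ennreal (normal_density 0 \<sigma> x)))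
    = ennreal (exp (l\<^sup>2 * \<sigma>\<^sup>2 / 2))"
proof -
  have *: "normal_density 0 \<sigma> x * exp (l * x) = exp (l\<^sup>2 * \<sigma>\<^sup>2 / 2) * normal_density (l * \<sigma>\<^sup>2) \<sigma> x" for x
  proof -
    have "- (x - 0)\<^sup>2 / (2 * \<sigma>\<^sup>2) + l * x = l\<^sup>2 * \<sigma>\<^sup>2 / 2 + - (x - l * \<sigma>\<^sup>2)\<^sup>2 / (2 * \<sigma>\<^sup>2)"
      using assms by (simp add: field_simps power2_eq_square)
    then have "exp (- (x - 0)\<^sup>2 / (2 * \<sigma>\<^sup>2)) * exp (l * x)
        = exp (l\<^sup>2 * \<sigma>\<^sup>2 / 2) * exp (- (x - l * \<sigma>\<^sup>2)\<^sup>2 / (2 * \<sigma>\<^sup>2))"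
      unfolding exp_add[symmetric] by simp
    then show ?thesis unfolding normal_density_def by (simp add: mult_ac)
  qed
  have "(\<integral>\<^sup>+ x. ennreal (exp (l * x)) \<partial>density lborel (\<lambda>x. ennreal (normal_density 0 \<sigma> x)))
    = (\<integral>\<^sup>+ x. ennreal (normal_density 0 \<sigma> x) * ennreal (exp (l * x)) \<partial>lborel)"
    by (subst nn_integral_density) auto
  also have "\<dots> = (\<integral>\<^sup>+ x. ennreal (exp (l\<^sup>2 * \<sigma>\<^sup>2 / 2)) * ennreal (normal_density (l * \<sigma>\<^sup>2) \<sigma> x) \<partial>lborel)"
    by (simp add: * flip: ennreal_mult)
  also have "\<dots> = ennreal (exp (l\<^sup>2 * \<sigma>\<^sup>2 / 2)) * (\<integral>\<^sup>+ x. ennreal (normal_density (l * \<sigma>\<^sup>2) \<sigma> x) \<partial>lborel)"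
    by (rule nn_integral_cmult) simp
  also have "(\<integral>\<^sup>+ x. ennreal (normal_density (l * \<sigma>\<^sup>2) \<sigma> x) \<partial>lborel) = 1"
    using assms by (subst nn_integral_eq_integral) auto
  finally show ?thesis by simp
qed

locale gaussian_vector =
  fixes G :: "'a set" and \<sigma> :: real
  assumes finite_G: "finite G" and sigma_pos: "0 < \<sigma>"
begin

definition law :: "('a \<Rightarrow> real) measure" where
  "law = PiM G (\<lambda>_. density lborel (normal_density 0 \<sigma>))"

sublocale product_prob_space "\<lambda>_. density lborel (normal_density 0 \<sigma>)" G
  using prob_space_normal_density[OF sigma_pos]
  by (simp add: product_prob_space_def product_prob_space_axioms_def product_sigma_finite_def
      prob_space_imp_sigma_finite)

sublocale law: prob_space law
  unfolding law_def by (rule prob_space_PiM) (rule prob_space_normal_density[OF sigma_pos])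

lemma space_law: "space law = PiE G (\<lambda>_. UNIV)"
  by (simp add: law_def space_PiM)

lemma measurable_coordinate [measurable]: "j \<in> G \<Longrightarrow> (\<lambda>x. x j) \<in> borel_measurable law"
proof -
  assume "j \<in> G"
  then have "(\<lambda>x. x j) \<in> measurable law (density lborel (normal_density 0 \<sigma>))"
    unfolding law_def by (rule measurable_component_singleton)
  then show ?thesis by (simp cong: measurable_cong_sets)
qed

lemma measurable_inner_on [measurable]: "(\<lambda>x. inner_on G x v) \<in> borel_measurable law"
  unfolding inner_on_def by measurable

lemma nn_integral_exp_inner_on:
  "(\<integral>\<^sup>+ x. ennreal (exp (l * inner_on G x v)) \<partial>law) = ennreal (exp (l\<^sup>2 * \<sigma>\<^sup>2 * inner_on G v v / 2))"
proof -
  have "(\<integral>\<^sup>+ x. ennreal (exp (l * inner_on G x v)) \<partial>law)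
      = (\<integral>\<^sup>+ x. (\<Prod>j\<in>G. ennreal (exp (l * v j * x j))) \<partial>law)"
    using finite_G by (simp add: prod_ennreal inner_on_def sum_distrib_left mult_ac flip: exp_sum)
  also have "\<dots> = (\<Prod>j\<in>G. \<integral>\<^sup>+ x. ennreal (exp (l * v j * x)) \<partial>density lborel (normal_density 0 \<sigma>))"
    unfolding law_def by (rule product_nn_integral_prod) (use finite_G in auto)
  also have "\<dots> = (\<Prod>j\<in>G. ennreal (exp ((l * v j)\<^sup>2 * \<sigma>\<^sup>2 / 2)))"
    by (simp add: nn_integral_exp_normal[OF sigma_pos])
  also have "\<dots> = ennreal (exp (\<Sum>j\<in>G. (l * v j)\<^sup>2 * \<sigma>\<^sup>2 / 2))"
    using finite_G by (simp add: prod_ennreal exp_sum)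
  also have "(\<Sum>j\<in>G. (l * v j)\<^sup>2 * \<sigma>\<^sup>2 / 2) = l\<^sup>2 * \<sigma>\<^sup>2 * inner_on G v v / 2"
    by (simp add: inner_on_def power2_eq_square sum_distrib_left sum_divide_distrib mult_ac)
  finally show ?thesis .
qed

lemma prob_inner_on_ge:
  assumes "u > 0" "inner_on G v v > 0"
  shows "law.prob {x \<in> space law. sqrt (inner_on G v v) * \<sigma> * u \<le> inner_on G x v} \<le> exp (- u\<^sup>2 / 2)"
proof -
  define s where "s = sqrt (inner_on G v v) * \<sigma>"
  have s: "s > 0" "s\<^sup>2 = inner_on G v v * \<sigma>\<^sup>2"
    using assms sigma_pos by (auto simp: s_def power_mult_distrib)
  \<comment> \<open>The minimizer of the Chernoff exponent
    \<open>- (l * s * u) + (l * s)\<^sup>2 / 2\<close>, with minimum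
    \<open>- u\<^sup>2 / 2\<close>.\<close>
  define l where "l = u / s"
  have l: "l > 0" using s assms by (simp add: l_def)
  have "law.prob {x \<in> space law. s * u \<le> inner_on G x v} \<le> exp (- (l * (s * u))) * exp (l\<^sup>2 * \<sigma>\<^sup>2 * inner_on G v v / 2)"
  proof -
    have "emeasure law {x \<in> space law. s * u \<le> inner_on G x v}
      \<le> ennreal (exp (- l * (s * u))) * (\<integral>\<^sup>+ x. ennreal (exp (l * inner_on G x v)) * indicator (space law) x \<partial>law)"
      using l by (intro Chernoff_ineq_nn_integral_ge) auto
    also have "(\<integral>\<^sup>+ x. ennreal (exp (l * inner_on G x v)) * indicator (space law) x \<partial>law) = ennreal (exp (l\<^sup>2 * \<sigma>\<^sup>2 * inner_on G v v / 2))"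
      unfolding nn_integral_exp_inner_on[symmetric] by (rule nn_integral_cong) (simp add: indicator_def)
    finally show ?thesis
      by (simp add: law.emeasure_eq_measure flip: ennreal_mult)
  qed
  also have "\<dots> = exp (- u\<^sup>2 / 2)"
  proof -
    have "- (l * (s * u)) + l\<^sup>2 * \<sigma>\<^sup>2 * inner_on G v v / 2 = - (l * s * u) + (l * s)\<^sup>2 / 2"
      by (simp add: power_mult_distrib s(2) mult_ac)
    also have "\<dots> = - u\<^sup>2 / 2" using s by (simp add: l_def power2_eq_square)
    finally show ?thesis by (simp add: exp_add[symmetric])
  qed
  finally show ?thesis by (simp add: s_def)
qed

text \<open>The strict inequality lets null vectors \<open>v\<close> take part: both sides of the
  event are then 0 and it is empty. Otherwise the one-sided tail is applied to \<open>v\<close> and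
  to its negative.\<close>

lemma prob_abs_inner_on_gt:
  assumes "u > 0"
  shows "law.prob {x \<in> space law. sqrt (inner_on G v v) * \<sigma> * u < \<bar>inner_on G x v\<bar>} \<le> 2 * exp (- u\<^sup>2 / 2)"
proof (cases "inner_on G v v = 0")
  case True
  then have "\<forall>j\<in>G. v j * v j = 0"
    using finite_G unfolding inner_on_def by (subst (asm) sum_nonneg_eq_0_iff) auto
  then have "inner_on G x v = 0" for x by (auto simp: inner_on_def)
  then show ?thesis using True by simp
next
  case False
  then have pos: "inner_on G v v > 0" using inner_on_ge_0[of G v] by simp
  define w where "w = (\<lambda>j. (-1) * v j)"
  have w: "inner_on G w w = inner_on G v v" "inner_on G x w = - inner_on G x v" for x
    unfolding w_def inner_on_scale_left inner_on_scale_right by simp_all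
  let ?c = "sqrt (inner_on G v v) * \<sigma> * u"
  have "law.prob {x \<in> space law. ?c < \<bar>inner_on G x v\<bar>}
    \<le> law.prob ({x \<in> space law. ?c \<le> inner_on G x v} \<union> {x \<in> space law. ?c \<le> inner_on G x w})"
    by (intro law.finite_measure_mono) (auto simp: w(2))
  also have "\<dots> \<le> law.prob {x \<in> space law. ?c \<le> inner_on G x v} + law.prob {x \<in> space law. ?c \<le> inner_on G x w}"
    by (intro measure_Un_le) auto
  also have "\<dots> \<le> exp (- u\<^sup>2 / 2) + exp (- u\<^sup>2 / 2)"
    using prob_inner_on_ge[OF assms pos] prob_inner_on_ge[OF assms, of w] pos unfolding w(1)
    by (intro add_mono) auto
  finally show ?thesis by simp
qed

lemma prob_all_abs_inner_on_le:
  assumes "u > 0" "finite V"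
  shows "1 - 2 * real (card V) * exp (- u\<^sup>2 / 2)
    \<le> law.prob {x \<in> space law. \<forall>v\<in>V. \<bar>inner_on G x v\<bar> \<le> sqrt (inner_on G v v) * \<sigma> * u}"
proof -
  let ?E = "{x \<in> space law. \<forall>v\<in>V. \<bar>inner_on G x v\<bar> \<le> sqrt (inner_on G v v) * \<sigma> * u}"
  have "law.prob (space law - ?E)
    \<le> law.prob (\<Union>v\<in>V. {x \<in> space law. sqrt (inner_on G v v) * \<sigma> * u < \<bar>inner_on G x v\<bar>})"
    using assms(2) by (intro law.finite_measure_mono) (auto simp: not_le)
  also have "\<dots> \<le> (\<Sum>v\<in>V. law.prob {x \<in> space law. sqrt (inner_on G v v) * \<sigma> * u < \<bar>inner_on G x v\<bar>})"
    using assms(2) by (intro law.finite_measure_subadditive_finite) auto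
  also have "\<dots> \<le> (\<Sum>v\<in>V. 2 * exp (- u\<^sup>2 / 2))"
    by (intro sum_mono prob_abs_inner_on_gt assms)
  also have "\<dots> = 2 * real (card V) * exp (- u\<^sup>2 / 2)" by simp
  finally show ?thesis
    using assms(2) by (subst (asm) law.prob_compl) auto
qed

text \<open>The infimum over rational points (McShane's formula) replaces a Borel structure on the
  function space, which is not second countable.\<close>
lemma measurable_Lipschitz:
  assumes lip: "\<And>x y. x \<in> space law \<Longrightarrow> y \<in> space law \<Longrightarrow> F x - F y \<le> (\<Sum>j\<in>G. \<bar>x j - y j\<bar>)"
  shows "F \<in> borel_measurable law"
proof -
  define Q where "Q = PiE G (\<lambda>_. \<rat> :: real set)"
  have cQ: "countable Q" unfolding Q_def using finite_G by (intro countable_PiE) (auto simp: countable_rat)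
  have Qs: "Q \<subseteq> space law" unfolding Q_def space_law by auto
  let ?H = "\<lambda>x. INF q\<in>Q. F q + (\<Sum>j\<in>G. \<bar>x j - q j\<bar>)"
  have "?H \<in> borel_measurable law"
    using cQ by (intro borel_measurable_cINF_real) measurable
  moreover have "F x = ?H x" if x: "x \<in> space law" for x
  proof (rule antisym)
    have ne: "Q \<noteq> {}" unfolding Q_def by (auto simp: PiE_eq_empty_iff)
    have low: "F x \<le> F q + (\<Sum>j\<in>G. \<bar>x j - q j\<bar>)" if "q \<in> Q" for q
      using lip[OF x, of q] Qs that by auto
    then show "F x \<le> ?H x" using ne by (intro cINF_greatest)
    show "?H x \<le> F x"
    proof (rule field_le_epsilon)
      fix e :: real assume e: "e > 0"
      \<comment> \<open>The rational point enters twice, once through the Lipschitz bound and once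
        through the distance, so the total error is \<open>2 * card G * \<eta>\<close>; the added 1
        covers an empty \<open>G\<close>.\<close>
      define \<eta> where "\<eta> = e / (2 * (real (card G) + 1))"
      have eta: "\<eta> > 0" "2 * real (card G) * \<eta> \<le> e" using e by (auto simp: \<eta>_def field_simps)
      have "\<exists>r\<in>\<rat>. x j - \<eta> < r \<and> r < x j" for j
        using Rats_dense_in_real[of "x j - \<eta>" "x j"] eta by auto
      then obtain r where r: "\<And>j. r j \<in> \<rat>" "\<And>j. x j - \<eta> < r j" "\<And>j. r j < x j" by metis
      define q where "q = restrict r G"
      have q: "q \<in> Q" unfolding Q_def q_def using r by auto
      have "(\<Sum>j\<in>G. \<bar>x j - q j\<bar>) \<le> (\<Sum>j\<in>G. \<eta>)"
      proof (intro sum_mono)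
        fix j assume "j \<in> G"
        then show "\<bar>x j - q j\<bar> \<le> \<eta>" using r(2,3)[of j] by (simp add: q_def)
      qed
      then have d: "(\<Sum>j\<in>G. \<bar>x j - q j\<bar>) \<le> real (card G) * \<eta>" by simp
      have "?H x \<le> F q + (\<Sum>j\<in>G. \<bar>x j - q j\<bar>)"
        using q low by (intro cINF_lower bdd_belowI2[of _ "F x"]) auto
      also have "F q \<le> F x + (\<Sum>j\<in>G. \<bar>x j - q j\<bar>)"
        using lip[of q x] q Qs x by (auto simp: abs_minus_commute)
      finally show "?H x \<le> F x + e" using d eta by linarith
    qed
  qed
  ultimately show ?thesis by (subst measurable_cong) auto
qed

end

section \<open>Finite differences, truncated polynomials and bumps on the line\<close>

text \<open>The backward difference of the model is \<open>s = -1\<close>; \<open>s = 1\<close>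
  gives its adjoint. Integer arguments keep the calculus free of boundaries and of truncated
  subtraction.\<close>

definition sdiff :: "int \<Rightarrow> nat \<Rightarrow> (int \<Rightarrow> real) \<Rightarrow> int \<Rightarrow> real" where
  "sdiff s k f i = (\<Sum>l\<le>k. (-1) ^ l * real (k choose l) * f (i + s * int l))"

lemma sdiff_0 [simp]: "sdiff s 0 f i = f i"
  by (simp add: sdiff_def)

lemma sdiff_Suc: "sdiff s (Suc k) f i = sdiff s k f i - sdiff s k f (i + s)"
proof -
  define F where "F l = f (i + s * int l)" for l
  have "sdiff s (Suc k) f i = F 0 + (\<Sum>l\<le>k. (-1) ^ Suc l * real (Suc k choose Suc l) * F (Suc l))"
    unfolding sdiff_def F_def by (subst sum.atMost_Suc_shift) simp
  also have "\<dots> = F 0 + (\<Sum>l\<le>k. (-1) ^ Suc l * real (k choose Suc l) * F (Suc l))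
      - (\<Sum>l\<le>k. (-1) ^ l * real (k choose l) * F (Suc l))"
    by (simp add: algebra_simps sum.distrib sum_negf sum_subtractf)
  also have "F 0 + (\<Sum>l\<le>k. (-1) ^ Suc l * real (k choose Suc l) * F (Suc l))
     = (\<Sum>l\<le>Suc k. (-1) ^ l * real (k choose l) * F l)"
    by (subst sum.atMost_Suc_shift) simp
  also have "\<dots> = sdiff s k f i"
    by (simp add: sdiff_def F_def)
  also have "(\<Sum>l\<le>k. (-1) ^ l * real (k choose l) * F (Suc l)) = sdiff s k f (i + s)"
    by (simp add: sdiff_def F_def algebra_simps)
  finally show ?thesis .
qed

lemma sdiff_Suc': "sdiff s (Suc k) f i = sdiff s k (\<lambda>i. f i - f (i + s)) i"
  unfolding sdiff_Suc by (simp add: sdiff_def algebra_simps sum_subtractf)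

lemma sdiff_zero: "(\<And>l. l \<le> k \<Longrightarrow> f (i + s * int l) = 0) \<Longrightarrow> sdiff s k f i = 0"
  by (simp add: sdiff_def)

lemma sdiff_cong: "(\<And>l. l \<le> k \<Longrightarrow> f (i + s * int l) = g (i + s * int l)) \<Longrightarrow> sdiff s k f i = sdiff s k g i"
  by (simp add: sdiff_def)

lemma sdiff_sum: "sdiff s k (\<lambda>i. \<Sum>r\<in>A. c r * f r i) i = (\<Sum>r\<in>A. c r * sdiff s k (f r) i)"
  unfolding sdiff_def sum_distrib_left
  by (subst sum.swap) (simp add: algebra_simps)

section \<open>Truncated polynomials and their differences\<close>

definition rising_poly :: "nat \<Rightarrow> int \<Rightarrow> real" where
  "rising_poly m x = (of_int x + of_nat m) gchoose m"

text \<open>With \<open>c = 0\<close> this is the fundamental solution of the difference of order m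
  + 1. Another \<open>c\<close> keeps the polynomial and moves only the place where it is switched
  on, so the two choices agree outside the stretch between 0 and \<open>c\<close>.\<close>

definition cut_poly :: "nat \<Rightarrow> int \<Rightarrow> int \<Rightarrow> real" where
  "cut_poly m c x = (if c \<le> x then rising_poly m x else 0)"

lemma rising_poly_diff: "rising_poly (Suc m) x - rising_poly (Suc m) (x - 1) = rising_poly m x"
  using gbinomial_Suc_Suc[of "of_int x + of_nat m :: real" m]
  by (simp add: rising_poly_def algebra_simps)

lemma rising_poly_0 [simp]: "rising_poly m 0 = 1"
  unfolding rising_poly_def using binomial_gbinomial[of m m, where ?'a=real] by simp

lemma sdiff_rising_poly: "sdiff (-1) (Suc m) (rising_poly m) i = 0"
proof (induction m arbitrary: i)
  case 0
  show ?case by (simp add: sdiff_def rising_poly_def)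
next
  case (Suc m)
  show ?case
    by (subst sdiff_Suc') (simp add: rising_poly_diff Suc)
qed

lemma sdiff_cut_poly_eq_0:
  assumes "i \<notin> {c..c + int m}"
  shows "sdiff (-1) (Suc m) (cut_poly m c) i = 0"
proof (cases "i < c")
  case True
  then show ?thesis by (intro sdiff_zero) (simp add: cut_poly_def)
next
  case False
  have "sdiff (-1) (Suc m) (cut_poly m c) i = sdiff (-1) (Suc m) (rising_poly m) i"
    using False assms by (intro sdiff_cong) (auto simp: cut_poly_def)
  then show ?thesis by (simp add: sdiff_rising_poly)
qed

text \<open>One backward difference lowers the degree by one, also across the cut, because
  \<open>rising_poly\<close> takes the value 1 at 0 in every degree.\<close>

lemma sdiff_cut_poly_0: "sdiff (-1) (Suc m) (cut_poly m 0) i = (if i = 0 then 1 else 0)"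
proof (induction m arbitrary: i)
  case 0
  show ?case by (auto simp: sdiff_Suc cut_poly_def rising_poly_def)
next
  case (Suc m)
  have "cut_poly (Suc m) 0 i - cut_poly (Suc m) 0 (i + (-1)) = cut_poly m 0 i" for i
  proof (cases "i = 0")
    case False
    then show ?thesis using rising_poly_diff[of m i] by (auto simp: cut_poly_def)
  qed (simp add: cut_poly_def)
  then show ?case
    by (subst sdiff_Suc') (simp only: Suc)
qed

lemma abs_rising_poly_le: "\<bar>rising_poly m x\<bar> \<le> (\<bar>of_int x\<bar> + real m) ^ m"
proof -
  have "\<bar>rising_poly m x\<bar> = (\<Prod>i = 0..<m. \<bar>of_int x + real m - real i\<bar>) / fact m"
    unfolding rising_poly_def gbinomial_prod_rev by (simp add: abs_prod)
  also have "\<dots> \<le> (\<Prod>i = 0..<m. \<bar>of_int x + real m - real i\<bar>) / 1"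
    by (intro divide_left_mono prod_nonneg) auto
  also have "\<dots> \<le> (\<Prod>i = 0..<m. \<bar>of_int x\<bar> + real m)"
    unfolding div_by_1 by (intro prod_mono) auto
  finally show ?thesis by simp
qed

text \<open>Only the |c| points between 0 and \<open>c\<close> contribute, each with a polynomial
  value of order |c|^m. For m = k - 1 this is the origin of the exponent 2k - 1 in the noise
  weights.\<close>

lemma sum_power2_cut_poly_diff_le:
  assumes "finite X"
  shows "(\<Sum>x\<in>X. (cut_poly m 0 x - cut_poly m c x)\<^sup>2)
    \<le> (real m + 1) ^ (2 * m) * \<bar>of_int c\<bar> ^ (2 * m + 1)"
proof -
  define Y where "Y = {min 0 c..<max 0 c}"
  have zero: "cut_poly m 0 x - cut_poly m c x = 0" if "x \<notin> Y" for x
    using that by (auto simp: Y_def cut_poly_def)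
  have bd: "(cut_poly m 0 x - cut_poly m c x)\<^sup>2 \<le> ((real m + 1) * \<bar>of_int c\<bar>) ^ (2 * m)"
    if "x \<in> Y" for x
  proof -
    have "c \<noteq> 0" "\<bar>x\<bar> \<le> \<bar>c\<bar>" using that by (auto simp: Y_def min_def max_def split: if_splits)
    then have c: "1 \<le> \<bar>of_int c :: real\<bar>" "\<bar>of_int x :: real\<bar> \<le> \<bar>of_int c\<bar>"
      by linarith+
    have "\<bar>of_int x\<bar> + real m \<le> (real m + 1) * \<bar>of_int c\<bar>"
      using c mult_left_mono[OF c(1), of "real m"] by (simp add: algebra_simps)
    then have "(\<bar>of_int x\<bar> + real m) ^ m \<le> ((real m + 1) * \<bar>of_int c\<bar>) ^ m"
      by (intro power_mono) auto
    then have "\<bar>rising_poly m x\<bar> \<le> ((real m + 1) * \<bar>of_int c\<bar>) ^ m"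
      using abs_rising_poly_le order_trans by blast
    moreover have "\<bar>cut_poly m 0 x - cut_poly m c x\<bar> \<le> \<bar>rising_poly m x\<bar>"
      by (simp add: cut_poly_def)
    ultimately have "\<bar>cut_poly m 0 x - cut_poly m c x\<bar> \<le> ((real m + 1) * \<bar>of_int c\<bar>) ^ m"
      by linarith
    then have "\<bar>cut_poly m 0 x - cut_poly m c x\<bar>\<^sup>2 \<le> (((real m + 1) * \<bar>of_int c\<bar>) ^ m)\<^sup>2"
      by (intro power_mono) auto
    then show ?thesis by (simp add: power_mult[symmetric] mult.commute)
  qed
  have "(\<Sum>x\<in>X. (cut_poly m 0 x - cut_poly m c x)\<^sup>2) = (\<Sum>x\<in>X \<inter> Y. (cut_poly m 0 x - cut_poly m c x)\<^sup>2)"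
    using assms zero by (intro sum.mono_neutral_right) auto
  also have "\<dots> \<le> (\<Sum>x\<in>X \<inter> Y. ((real m + 1) * \<bar>of_int c\<bar>) ^ (2 * m))"
    by (intro sum_mono bd) auto
  also have "\<dots> \<le> (\<Sum>x\<in>Y. ((real m + 1) * \<bar>of_int c\<bar>) ^ (2 * m))"
    by (intro sum_mono2) (auto simp: Y_def)
  also have "\<dots> = \<bar>of_int c\<bar> * ((real m + 1) * \<bar>of_int c\<bar>) ^ (2 * m)"
    by (simp add: Y_def max_def min_def)
  finally show ?thesis by (simp add: power_mult_distrib mult_ac)
qed

text \<open>The first difference of an average over \<open>\<rho>\<close> points is a difference of step \<open>\<rho>\<close> divided by
  \<open>\<rho>\<close>, so the k-th differences of a k-fold average are of order \<open>1 / \<rho> ^ k\<close>.\<close>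
definition box_avg :: "nat \<Rightarrow> (int \<Rightarrow> real) \<Rightarrow> int \<Rightarrow> real" where
  "box_avg \<rho> f i = (\<Sum>r<\<rho>. f (i + int r)) / real \<rho>"

text \<open>The interval has exactly the length that \<open>k\<close> averages look ahead, so the
  value 1 survives at 0 and nothing is left beyond distance \<open>k * (\<rho> - 1)\<close>. For
  \<open>\<rho> = 1\<close> the bump is the indicator of 0.\<close>

definition bump :: "nat \<Rightarrow> nat \<Rightarrow> int \<Rightarrow> real" where
  "bump k \<rho> = (box_avg \<rho> ^^ k) (indicator {0..int (k * (\<rho> - 1))})"

lemma box_avg_diff:
  "box_avg \<rho> f i - box_avg \<rho> f (i + 1) = (f i - f (i + int \<rho>)) / real \<rho>"
proof -
  have "(\<Sum>r<\<rho>. f (i + int r)) - (\<Sum>r<\<rho>. f (i + int (Suc r))) = f i - f (i + int \<rho>)"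
    using sum_lessThan_telescope'[of "\<lambda>r. f (i + int r)" \<rho>] by (simp add: sum_subtractf)
  then show ?thesis
    unfolding box_avg_def by (simp add: diff_divide_distrib[symmetric] add.assoc add.commute add.left_commute)
qed

lemma abs_sdiff_iterated_box_avg_le:
  assumes "\<rho> \<ge> 1" "\<And>i. \<bar>f i\<bar> \<le> 1"
  shows "\<bar>sdiff 1 k ((box_avg \<rho> ^^ k) f) i\<bar> \<le> (2 / real \<rho>) ^ k"
proof (induction k arbitrary: i)
  case 0
  then show ?case using assms by simp
next
  case (Suc k)
  let ?g = "(box_avg \<rho> ^^ k) f"
  have "sdiff 1 (Suc k) ((box_avg \<rho> ^^ Suc k) f) i = sdiff 1 k (\<lambda>i. (?g i - ?g (i + int \<rho>)) / real \<rho>) i"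
    by (subst sdiff_Suc') (simp add: box_avg_diff)
  also have "\<dots> = (sdiff 1 k ?g i - sdiff 1 k ?g (i + int \<rho>)) / real \<rho>"
    unfolding sdiff_def
    by (simp add: algebra_simps sum_subtractf diff_divide_distrib sum_divide_distrib)
  finally have "\<bar>sdiff 1 (Suc k) ((box_avg \<rho> ^^ Suc k) f) i\<bar> = \<bar>sdiff 1 k ?g i - sdiff 1 k ?g (i + int \<rho>)\<bar> / real \<rho>"
    by simp
  also have "\<dots> \<le> (2 * (2 / real \<rho>) ^ k) / real \<rho>"
    using Suc[of i] Suc[of "i + int \<rho>"] by (intro divide_right_mono) linarith+
  finally show ?case by (simp add: field_simps)
qed

lemma iterated_box_avg_bounds:
  assumes "\<rho> \<ge> 1" "\<And>i. 0 \<le> f i \<and> f i \<le> 1"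
  shows "0 \<le> (box_avg \<rho> ^^ k) f i \<and> (box_avg \<rho> ^^ k) f i \<le> 1"
proof (induction k arbitrary: i)
  case (Suc k)
  have "(\<Sum>r<\<rho>. (box_avg \<rho> ^^ k) f (i + int r)) \<le> (\<Sum>r<\<rho>. 1)"
    using Suc by (intro sum_mono) auto
  moreover have "0 \<le> (\<Sum>r<\<rho>. (box_avg \<rho> ^^ k) f (i + int r))"
    using Suc by (intro sum_nonneg) auto
  ultimately show ?case using assms(1)
    by (simp add: box_avg_def[of _ "(box_avg \<rho> ^^ k) f"])
qed (use assms in simp)

text \<open>The iterated average at \<open>i\<close> reads only the points from \<open>i\<close> to
  \<open>i + k * (\<rho> - 1)\<close>. Applied with the constants 1 and 0 this gives both the value
  at the centre and the support of a bump.\<close>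

lemma iterated_box_avg_const:
  assumes "\<rho> \<ge> 1" "\<And>j. i \<le> j \<Longrightarrow> j \<le> i + int (k * (\<rho> - 1)) \<Longrightarrow> f j = c"
  shows "(box_avg \<rho> ^^ k) f i = c"
  using assms(2)
proof (induction k arbitrary: i)
  case (Suc k)
  have "(box_avg \<rho> ^^ k) f (i + int r) = c" if "r < \<rho>" for r
  proof (rule Suc.IH)
    fix j assume "i + int r \<le> j" "j \<le> i + int r + int (k * (\<rho> - 1))"
    moreover have "r \<le> \<rho> - 1" using that by simp
    ultimately show "f j = c" by (intro Suc.prems) auto
  qed
  then show ?case using assms(1) by (simp add: box_avg_def[of _ "(box_avg \<rho> ^^ k) f"])
qed simp

lemma bump_bounds: "\<rho> \<ge> 1 \<Longrightarrow> 0 \<le> bump k \<rho> i \<and> bump k \<rho> i \<le> 1"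
  unfolding bump_def by (rule iterated_box_avg_bounds) (auto simp: indicator_def)

lemma bump_0: "\<rho> \<ge> 1 \<Longrightarrow> bump k \<rho> 0 = 1"
  unfolding bump_def by (rule iterated_box_avg_const) auto

lemma bump_eq_0: "\<rho> \<ge> 1 \<Longrightarrow> int (k * (\<rho> - 1)) < \<bar>i\<bar> \<Longrightarrow> bump k \<rho> i = 0"
  unfolding bump_def by (rule iterated_box_avg_const) (auto simp: indicator_def)

lemma abs_sdiff_bump_le: "\<rho> \<ge> 1 \<Longrightarrow> \<bar>sdiff 1 k (bump k \<rho>) i\<bar> \<le> (2 / real \<rho>) ^ k"
  unfolding bump_def by (rule abs_sdiff_iterated_box_avg_le) (auto simp: indicator_def)

lemma sdiff_bump_eq_0:
  assumes "\<rho> \<ge> 1" "int (k * \<rho>) < \<bar>i\<bar>"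
  shows "sdiff 1 k (bump k \<rho>) i = 0"
proof (rule sdiff_zero)
  fix l assume "l \<le> k"
  moreover have "k * \<rho> = k * (\<rho> - 1) + k" using assms(1) by (cases \<rho>) auto
  ultimately show "bump k \<rho> (i + 1 * int l) = 0"
    using assms by (intro bump_eq_0) auto
qed

text \<open>At most \<open>2 * k * \<rho> + 1\<close> points carry a k-th difference, and each is
  bounded by (2 / \<rho>)^k.\<close>

lemma sum_sdiff_bump_le:
  assumes "\<rho> \<ge> 1" "k \<ge> 1" "finite X"
  shows "(\<Sum>i\<in>X. (sdiff 1 k (bump k \<rho>) i)\<^sup>2) \<le> 3 * real k * 4 ^ k / real \<rho> ^ (2 * k - 1)"
proof -
  define Y where "Y = {- int (k * \<rho>)..int (k * \<rho>)}"
  have "(\<Sum>i\<in>X. (sdiff 1 k (bump k \<rho>) i)\<^sup>2) = (\<Sum>i\<in>X \<inter> Y. (sdiff 1 k (bump k \<rho>) i)\<^sup>2)"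
    using assms by (intro sum.mono_neutral_right) (auto simp: Y_def intro!: sdiff_bump_eq_0)
  also have "\<dots> \<le> (\<Sum>i\<in>X \<inter> Y. ((2 / real \<rho>) ^ k)\<^sup>2)"
  proof (rule sum_mono)
    fix i
    have "\<bar>sdiff 1 k (bump k \<rho>) i\<bar>\<^sup>2 \<le> ((2 / real \<rho>) ^ k)\<^sup>2"
      using assms abs_sdiff_bump_le by (intro power_mono) auto
    then show "(sdiff 1 k (bump k \<rho>) i)\<^sup>2 \<le> ((2 / real \<rho>) ^ k)\<^sup>2" by simp
  qed
  also have "\<dots> \<le> (\<Sum>i\<in>Y. ((2 / real \<rho>) ^ k)\<^sup>2)"
    by (intro sum_mono2) (auto simp: Y_def)
  also have "\<dots> = (2 * real k * real \<rho> + 1) * (4 ^ k / real \<rho> ^ (2 * k))"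
  proof -
    have "((2 / real \<rho>) ^ k)\<^sup>2 = 4 ^ k / real \<rho> ^ (2 * k)"
      by (simp add: power_divide power_even_eq flip: power_mult_distrib) (simp add: power2_eq_square flip: power_mult_distrib)
    then show ?thesis by (simp add: Y_def)
  qed
  also have "\<dots> \<le> (3 * real k * real \<rho>) * (4 ^ k / real \<rho> ^ (2 * k))"
  proof -
    have "1 \<le> real k * real \<rho>" using assms by (simp flip: of_nat_mult)
    then show ?thesis by (intro mult_right_mono) (simp_all add: mult_ac)
  qed
  also have "real \<rho> ^ (2 * k) = real \<rho> * real \<rho> ^ (2 * k - 1)"
    using assms by (simp add: power_eq_if)
  also have "(3 * real k * real \<rho>) * (4 ^ k / (real \<rho> * real \<rho> ^ (2 * k - 1))) = 3 * real k * 4 ^ k / real \<rho> ^ (2 * k - 1)"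
    using assms by (simp add: field_simps)
  finally show ?thesis .
qed

text \<open>Mixing the bumps of all scales up to \<open>M\<close> with these weights makes the deficit from 1 grow like
  the power \<open>k - 1/2\<close> of the distance to the center, at the price of a logarithm.\<close>
definition scale_weight :: "nat \<Rightarrow> nat \<Rightarrow> nat \<Rightarrow> real" where
  "scale_weight k M \<rho> = sqrt ((real \<rho> / real M) ^ (2 * k - 1))"

definition mixed_bump :: "nat \<Rightarrow> nat \<Rightarrow> int \<Rightarrow> real" where
  "mixed_bump k M i = (\<Sum>r<M. (scale_weight k M (Suc r) - scale_weight k M r) * bump k (Suc r) i)"

lemma scale_weight_mono: "r \<le> r' \<Longrightarrow> scale_weight k M r \<le> scale_weight k M r'"
  unfolding scale_weight_def by (intro real_sqrt_le_mono power_mono divide_right_mono) auto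

lemma scale_weight_diff_nonneg: "0 \<le> scale_weight k M (Suc r) - scale_weight k M r"
  using scale_weight_mono[of r "Suc r"] by simp

lemma scale_weight_diff_sum:
  assumes "k \<ge> 1" "M \<ge> 1"
  shows "(\<Sum>r<M. scale_weight k M (Suc r) - scale_weight k M r) = 1"
  using assms by (subst sum_lessThan_telescope) (simp add: scale_weight_def power_0_left)

lemma mixed_bump_bounds:
  assumes "k \<ge> 1" "M \<ge> 1"
  shows "0 \<le> mixed_bump k M i \<and> mixed_bump k M i \<le> 1"
proof -
  have "mixed_bump k M i \<le> (\<Sum>r<M. (scale_weight k M (Suc r) - scale_weight k M r) * 1)"
    unfolding mixed_bump_def using bump_bounds scale_weight_diff_nonneg
    by (intro sum_mono mult_left_mono) auto
  moreover have "0 \<le> mixed_bump k M i"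
    unfolding mixed_bump_def using bump_bounds scale_weight_diff_nonneg
    by (intro sum_nonneg mult_nonneg_nonneg) auto
  ultimately show ?thesis using scale_weight_diff_sum[OF assms] by simp
qed

lemma mixed_bump_0:
  assumes "k \<ge> 1" "M \<ge> 1"
  shows "mixed_bump k M 0 = 1"
  unfolding mixed_bump_def using scale_weight_diff_sum[OF assms] by (simp add: bump_0)

lemma mixed_bump_eq_0:
  assumes "int (k * (M - 1)) < \<bar>i\<bar>"
  shows "mixed_bump k M i = 0"
  unfolding mixed_bump_def
proof (rule sum.neutral, intro ballI)
  fix r assume "r \<in> {..<M}"
  then have "k * (Suc r - 1) \<le> k * (M - 1)" by (intro mult_le_mono2) auto
  then have "int (k * (Suc r - 1)) < \<bar>i\<bar>" using assms by linarith
  then have "bump k (Suc r) i = 0" by (intro bump_eq_0) auto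
  then show "(scale_weight k M (Suc r) - scale_weight k M r) * bump k (Suc r) i = 0" by simp
qed

text \<open>With \<open>e\<close> the distance to 0 and \<open>q\<close> the ceiling of e / k, all
  bumps of scales 1 to \<open>q\<close> vanish at \<open>i\<close>. Their weights telescope to
  \<open>scale_weight k M q\<close>, which is the deficit.\<close>

lemma mixed_bump_le:
  assumes "k \<ge> 1" "M \<ge> 1" "\<bar>i\<bar> \<le> int (k * (M - 1))"
  shows "mixed_bump k M i \<le> 1 - sqrt ((\<bar>of_int i\<bar> / (real k * real M)) ^ (2 * k - 1))"
proof -
  define e where "e = nat \<bar>i\<bar>"
  define q where "q = (e + k - 1) div k"
  have e: "\<bar>i\<bar> = int e" "\<bar>of_int i\<bar> = real e" by (simp_all add: e_def)
  have qk: "e \<le> q * k"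
    using assms(1) div_mult_mod_eq[of "e + k - 1" k] mod_less_divisor[of k "e + k - 1"]
    unfolding q_def by linarith
  have q1: "k * r < e" if "r < q" for r
  proof -
    have "k * Suc r \<le> k * q" using that by (intro mult_le_mono2) auto
    also have "\<dots> \<le> e + k - 1" unfolding q_def by simp
    finally show ?thesis using assms(1) by simp
  qed
  have qM: "q \<le> M"
  proof (rule ccontr)
    assume "\<not> q \<le> M"
    then have "k * M < e" by (intro q1) simp
    moreover have "k * (M - 1) \<le> k * M" by simp
    ultimately show False using assms(3) e by linarith
  qed
  have "mixed_bump k M i \<le> (\<Sum>r<M. (scale_weight k M (Suc r) - scale_weight k M r) * of_bool (q \<le> r))"
    unfolding mixed_bump_def
  proof (intro sum_mono mult_left_mono scale_weight_diff_nonneg)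
    fix r
    show "bump k (Suc r) i \<le> of_bool (q \<le> r)"
    proof (cases "q \<le> r")
      case False
      then have "bump k (Suc r) i = 0" using q1[of r] e(1)
        by (intro bump_eq_0) (simp_all flip: of_nat_mult)
      then show ?thesis by simp
    qed (use bump_bounds[of "Suc r" k i] in auto)
  qed
  also have "\<dots> = (\<Sum>r=q..<M. scale_weight k M (Suc r) - scale_weight k M r)"
    by (rule sum.mono_neutral_cong_right) auto
  also have "\<dots> = scale_weight k M M - scale_weight k M q"
    using qM by (rule sum_Suc_diff')
  also have "scale_weight k M M = 1" using assms(2) by (simp add: scale_weight_def)
  also have "sqrt ((\<bar>of_int i\<bar> / (real k * real M)) ^ (2 * k - 1)) \<le> scale_weight k M q"
    unfolding scale_weight_def e
  proof (intro real_sqrt_le_mono power_mono)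
    have "real e \<le> real q * real k" using qk by (simp flip: of_nat_mult)
    then show "real e / (real k * real M) \<le> real q / real M"
      using assms by (simp add: field_simps)
  qed simp
  then have "1 - scale_weight k M q \<le> 1 - sqrt ((\<bar>of_int i\<bar> / (real k * real M)) ^ (2 * k - 1))"
    by simp
  finally show ?thesis .
qed

lemma power_diff_pred_le:
  assumes "\<rho> \<ge> 1"
  shows "real \<rho> ^ Suc m - (real \<rho> - 1) ^ Suc m \<le> real (Suc m) * real \<rho> ^ m"
proof -
  have "real \<rho> ^ Suc m - (real \<rho> - 1) ^ Suc m
      = (\<Sum>i<Suc m. (real \<rho> - 1) ^ (m - i) * real \<rho> ^ i)"
    using power_diff_sumr2[of "real \<rho>" "Suc m" "real \<rho> - 1"] by simp
  also have "\<dots> \<le> (\<Sum>i<Suc m. real \<rho> ^ (m - i) * real \<rho> ^ i)"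
    using assms by (intro sum_mono mult_right_mono power_mono) auto
  also have "\<dots> = (\<Sum>i<Suc m. real \<rho> ^ m)"
    by (intro sum.cong) (auto simp flip: power_add)
  finally show ?thesis by simp
qed

text \<open>The increment is a discrete derivative of \<rho>^(k-1/2), of order \<rho>^(k-3/2).
  Against the bound (2 / \<rho>)^k for the k-th difference of a bump it leaves \<rho>^(-3/2),
  written as \<open>sqrt R / R\<^sup>2\<close> to avoid real exponents.\<close>

lemma scale_weight_diff_le:
  assumes "k \<ge> 1" "M \<ge> 1"
  shows "(scale_weight k M (Suc r) - scale_weight k M r) * (2 / real (Suc r)) ^ k
    \<le> 2 ^ k * (2 * real k - 1) / sqrt (real M ^ (2 * k - 1)) * (sqrt (real (Suc r)) / (real (Suc r))\<^sup>2)"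
proof -
  define R where "R = real (Suc r)"
  define a where "a = sqrt (R ^ (2 * k - 1))"
  define b where "b = sqrt ((R - 1) ^ (2 * k - 1))"
  have R: "R \<ge> 1" "R - 1 = real r" by (auto simp: R_def)
  have a: "a > 0" using R by (auto simp: a_def)
  have b: "0 \<le> b" "b \<le> a" using R by (auto simp: a_def b_def intro!: real_sqrt_le_mono power_mono)
  obtain m where m: "k = Suc m" using assms(1) by (cases k) auto
  have "a\<^sup>2 - b\<^sup>2 \<le> (2 * real k - 1) * R ^ (2 * m)"
    using power_diff_pred_le[of "Suc r" "2 * m"] R
    by (simp add: a_def b_def m algebra_simps R_def del: power_Suc)
  \<comment> \<open>Since \<open>b \<le> a\<close>, the left side is at most
    \<open>a\<^sup>2 - b\<^sup>2\<close>: a difference of roots is bounded by the difference of the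
    squares divided by \<open>a\<close>.\<close>
  then have "(a - b) * a \<le> (2 * real k - 1) * R ^ (2 * m)"
    using mult_right_mono[OF b(2) b(1)] by (simp add: power2_eq_square algebra_simps)
  then have ab: "a - b \<le> (2 * real k - 1) * R ^ (2 * m) / a"
    using a by (simp add: pos_le_divide_eq)
  have asq: "sqrt R * a = R ^ k"
  proof -
    have "sqrt R * a = sqrt (R ^ (2 * k))"
      using m by (simp add: a_def real_sqrt_mult)
    also have "\<dots> = R ^ k" using R by (simp add: power_even_eq)
    finally show ?thesis .
  qed
  have 1: "R ^ (2 * m) / a * (1 / R ^ k) = sqrt R / R\<^sup>2"
  proof -
    have "R ^ (2 * m) * R\<^sup>2 = R ^ k * R ^ k" unfolding m mult_2 power_add power2_eq_square by simp
    also have "\<dots> = sqrt R * a * R ^ k" unfolding asq ..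
    finally have "R ^ (2 * m) = sqrt R * a * R ^ k / R\<^sup>2"
      using R by (simp add: nonzero_eq_divide_eq)
    then show ?thesis using a R by simp
  qed
  have "(scale_weight k M (Suc r) - scale_weight k M r) * (2 / R) ^ k
      = (a - b) / sqrt (real M ^ (2 * k - 1)) * (2 ^ k / R ^ k)"
    unfolding scale_weight_def a_def b_def R(2)
    by (simp add: power_divide real_sqrt_divide R_def diff_divide_distrib)
  also have "\<dots> \<le> ((2 * real k - 1) * R ^ (2 * m) / a) / sqrt (real M ^ (2 * k - 1)) * (2 ^ k / R ^ k)"
    using R by (intro mult_right_mono divide_right_mono ab) auto
  also have "\<dots> = 2 ^ k * (2 * real k - 1) / sqrt (real M ^ (2 * k - 1)) * (R ^ (2 * m) / a * (1 / R ^ k))"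
    by (simp add: mult_ac)
  finally show ?thesis unfolding 1 by (simp add: R_def)
qed

text \<open>A discrete antiderivative of x^(-3/2), so that tail sums telescope. The factor 4 has
  room for \<open>v * (v + u) \<le> 15 / 4 * u\<^sup>2\<close>, which follows from x + 1 \<le> 9/4 *
  x.\<close>

lemma sqrt_div_square_le:
  assumes "x \<ge> (1::real)"
  shows "sqrt x / x\<^sup>2 \<le> 4 * (1 / sqrt x - 1 / sqrt (x + 1))"
proof -
  define u v where "u = sqrt x" and "v = sqrt (x + 1)"
  have u: "u \<ge> 1" "u\<^sup>2 = x" and v: "v\<^sup>2 = x + 1" "v \<ge> u"
    using assms by (auto simp: u_def v_def)
  have "v\<^sup>2 \<le> (3 / 2)\<^sup>2 * u\<^sup>2" unfolding u v using assms by (simp add: power2_eq_square)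
  then have "v\<^sup>2 \<le> (3 / 2 * u)\<^sup>2" unfolding power_mult_distrib .
  then have v2: "v \<le> 3 / 2 * u" by (rule power2_le_imp_le) (use u(1) in simp)
  have "(v - u) * (v + u) = 1" using u v by (simp add: power2_eq_square algebra_simps)
  then have d: "v - u = 1 / (v + u)" using u v by (simp add: nonzero_eq_divide_eq)
  have "v * (v + u) \<le> (3 / 2 * u) * (3 / 2 * u + u)" using u v v2 by (intro mult_mono) auto
  also have "\<dots> \<le> 4 * u\<^sup>2" using u(1) by (simp add: power2_eq_square)
  finally have *: "v * (v + u) \<le> 4 * u\<^sup>2" .
  have "x\<^sup>2 = u * (u * u\<^sup>2)" unfolding u(2)[symmetric] by (simp add: power2_eq_square)
  then have "sqrt x / x\<^sup>2 = 1 / (u * u\<^sup>2)" using u(1) unfolding u_def[symmetric] by simp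
  also have "\<dots> = 4 / (u * (4 * u\<^sup>2))" by simp
  also have "\<dots> \<le> 4 / (u * (v * (v + u)))"
    using * u(1) v(2) by (intro divide_left_mono mult_left_mono mult_pos_pos) auto
  also have "\<dots> = 4 * ((v - u) / (u * v))" unfolding d by simp
  also have "(v - u) / (u * v) = 1 / u - 1 / v" using u(1) v(2) by (simp add: diff_divide_distrib)
  finally show ?thesis by (simp add: u_def v_def)
qed

text \<open>Scales below \<open>q\<close> have no k-th difference at \<open>i\<close>, because their
  supports do not reach that far; the tail of \<rho>^(-3/2) from \<open>q\<close> on is of order
  q^(-1/2).\<close>

lemma abs_sdiff_mixed_bump_le:
  assumes "k \<ge> 1" "M \<ge> 1" "q \<ge> 1" "\<And>r. Suc r < q \<Longrightarrow> int (k * Suc r) < \<bar>i\<bar>"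
  shows "\<bar>sdiff 1 k (mixed_bump k M) i\<bar> \<le> 4 * 2 ^ k * (2 * real k - 1) / sqrt (real M ^ (2 * k - 1)) / sqrt (real q)"
proof -
  let ?c = "2 ^ k * (2 * real k - 1) / sqrt (real M ^ (2 * k - 1))"
  have c: "0 \<le> ?c" using assms by auto
  let ?w = "\<lambda>r. scale_weight k M (Suc r) - scale_weight k M r"
  have "\<bar>sdiff 1 k (mixed_bump k M) i\<bar> = \<bar>\<Sum>r<M. ?w r * sdiff 1 k (bump k (Suc r)) i\<bar>"
    unfolding mixed_bump_def[abs_def] by (simp add: sdiff_sum)
  also have "\<dots> \<le> (\<Sum>r<M. ?w r * \<bar>sdiff 1 k (bump k (Suc r)) i\<bar>)"
    using scale_weight_diff_nonneg by (intro order_trans[OF sum_abs]) (simp add: abs_mult)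
  also have "\<dots> \<le> (\<Sum>r<M. of_bool (q \<le> Suc r) * (?c * (sqrt (real (Suc r)) / (real (Suc r))\<^sup>2)))"
  proof (intro sum_mono)
    fix r
    show "?w r * \<bar>sdiff 1 k (bump k (Suc r)) i\<bar>
      \<le> of_bool (q \<le> Suc r) * (?c * (sqrt (real (Suc r)) / (real (Suc r))\<^sup>2))"
    proof (cases "q \<le> Suc r")
      case True
      have "?w r * \<bar>sdiff 1 k (bump k (Suc r)) i\<bar> \<le> ?w r * (2 / real (Suc r)) ^ k"
        by (intro mult_left_mono abs_sdiff_bump_le scale_weight_diff_nonneg) auto
      then show ?thesis using scale_weight_diff_le[OF assms(1,2), of r] True by simp
    next
      case False
      then have "sdiff 1 k (bump k (Suc r)) i = 0" using assms(4)[of r] by (intro sdiff_bump_eq_0) auto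
      then show ?thesis using False by simp
    qed
  qed
  also have "\<dots> = (\<Sum>r\<in>{q - 1..<M}. ?c * (sqrt (real (Suc r)) / (real (Suc r))\<^sup>2))"
    by (rule sum.mono_neutral_cong_right) auto
  also have "\<dots> \<le> (\<Sum>r\<in>{q - 1..<M}. ?c * (4 * (1 / sqrt (real (Suc r)) - 1 / sqrt (real (Suc (Suc r))))))"
  proof (intro sum_mono mult_left_mono c)
    fix r show "sqrt (real (Suc r)) / (real (Suc r))\<^sup>2 \<le> 4 * (1 / sqrt (real (Suc r)) - 1 / sqrt (real (Suc (Suc r))))"
      using sqrt_div_square_le[of "real (Suc r)"] by (simp add: add.commute)
  qed
  also have "\<dots> = 4 * ?c * (\<Sum>r\<in>{q - 1..<M}. - 1 / sqrt (real (Suc (Suc r))) - - 1 / sqrt (real (Suc r)))"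
    unfolding sum_distrib_left by (rule sum.cong) simp_all
  also have "\<dots> \<le> 4 * ?c * (1 / sqrt (real q))"
  proof (cases "q - 1 \<le> M")
    case True
    then have "(\<Sum>r\<in>{q - 1..<M}. - 1 / sqrt (real (Suc (Suc r))) - - 1 / sqrt (real (Suc r)))
       = - 1 / sqrt (real (Suc M)) - - 1 / sqrt (real (Suc (q - 1)))"
      by (rule sum_Suc_diff'[of _ _ "\<lambda>r. - 1 / sqrt (real (Suc r))"])
    then show ?thesis using assms c by (intro mult_left_mono) auto
  next
    case False
    then have "{q - 1..<M} = {}" by auto
    moreover have "0 \<le> 4 * ?c * (1 / sqrt (real q))" using c by (intro mult_nonneg_nonneg) auto
    ultimately show ?thesis by (simp only: sum.empty mult_zero_right)
  qed
  finally show ?thesis by simp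
qed

lemma sdiff_mixed_bump_eq_0:
  assumes "M \<ge> 1" "int (k * M) < \<bar>i\<bar>"
  shows "sdiff 1 k (mixed_bump k M) i = 0"
proof (rule sdiff_zero)
  fix l assume "l \<le> k"
  moreover have "k * M = k * (M - 1) + k" using assms(1) by (cases M) auto
  ultimately show "mixed_bump k M (i + 1 * int l) = 0"
    using assms(2) by (intro mixed_bump_eq_0) auto
qed

section \<open>Square sums of the differences of the bumps\<close>

lemma sum_inverse_Suc_le: "(\<Sum>e\<le>N. 1 / (1 + real e)) \<le> 1 + ln (1 + real N)"
proof (induction N)
  case (Suc N)
  have "ln (1 + real N) - ln (2 + real N) = ln ((1 + real N) / (2 + real N))"
    by (simp add: ln_div)
  also have "\<dots> \<le> (1 + real N) / (2 + real N) - 1"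
    by (intro ln_le_minus_one) (simp add: field_simps)
  also have "\<dots> = - 1 / (2 + real N)" by (simp add: field_simps)
  finally show ?case using Suc by (simp add: algebra_simps)
qed simp

text \<open>The squared pointwise bound is of order 1 / (M^(2k-1) * (1 + |i|)). Its sum over |i|
  \<le> k * M is harmonic, and this is the only source of the logarithm.\<close>

lemma sum_sdiff_mixed_bump_le:
  assumes "k \<ge> 1"
  obtains K where "K > 0"
    "\<And>M X. M \<ge> 1 \<Longrightarrow> finite X \<Longrightarrow>
      (\<Sum>i\<in>X. (sdiff 1 k (mixed_bump k M) i)\<^sup>2) \<le> K * ln (exp 1 * real M) / real M ^ (2 * k - 1)"
proof -
  define C where "C = (4 * 2 ^ k * (2 * real k - 1))\<^sup>2"
  have C: "C > 0" using assms by (auto simp: C_def)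
  define K where "K = C * (4 * real k) * (1 + ln (2 * real k))"
  show ?thesis
  proof
    have "0 \<le> ln (2 * real k)" using assms by (intro ln_ge_zero) auto
    then have k2: "1 \<le> 1 + ln (2 * real k)" by simp
    then show "K > 0" using C assms unfolding K_def by (intro mult_pos_pos) linarith+
    fix M :: nat and X :: "int set"
    assume M: "M \<ge> 1" and X: "finite X"
    define Y where "Y = {- int (k * M)..int (k * M)}"
    have zero: "sdiff 1 k (mixed_bump k M) i = 0" if "i \<notin> Y" for i
      using that M by (intro sdiff_mixed_bump_eq_0) (auto simp: Y_def)
    have bd: "(sdiff 1 k (mixed_bump k M) i)\<^sup>2
       \<le> C / real M ^ (2 * k - 1) * (2 * real k * (1 / (1 + real (nat \<bar>i\<bar>))))" for i
    proof -
      define e where "e = nat \<bar>i\<bar>"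
      \<comment> \<open>The ceiling of \<open>e / k\<close>, raised to 1 at the centre; then
        \<open>1 + e \<le> 2 * k * q\<close> turns 1 / q into a multiple of 1 / (1 + e).\<close>
      define q where "q = max 1 ((e + k - 1) div k)"
      have "e \<le> ((e + k - 1) div k) * k"
        using assms div_mult_mod_eq[of "e + k - 1" k] mod_less_divisor[of k "e + k - 1"] by linarith
      also have "\<dots> \<le> q * k" by (intro mult_le_mono1) (simp add: q_def)
      finally have "e \<le> k * q" by (simp add: mult.commute)
      moreover have "1 * 1 \<le> k * q" using assms by (intro mult_le_mono) (auto simp: q_def)
      ultimately have qk: "1 + e \<le> 2 * k * q" by linarith
      have q1: "k * Suc r < e" if "Suc r < q" for r
      proof -
        have "k * Suc (Suc r) \<le> k * ((e + k - 1) div k)" using that by (intro mult_le_mono2) (auto simp: q_def)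
        also have "\<dots> \<le> e + k - 1" by simp
        finally show ?thesis using assms by simp
      qed
      have "\<bar>sdiff 1 k (mixed_bump k M) i\<bar> \<le> 4 * 2 ^ k * (2 * real k - 1) / sqrt (real M ^ (2 * k - 1)) / sqrt (real q)"
      proof (rule abs_sdiff_mixed_bump_le[OF assms M])
        show "q \<ge> 1" by (simp add: q_def)
        show "int (k * Suc r) < \<bar>i\<bar>" if "Suc r < q" for r using q1[OF that] unfolding e_def zless_nat_eq_int_zless .
      qed
      then have "\<bar>sdiff 1 k (mixed_bump k M) i\<bar>\<^sup>2 \<le> (4 * 2 ^ k * (2 * real k - 1) / sqrt (real M ^ (2 * k - 1)) / sqrt (real q))\<^sup>2"
        by (intro power_mono) auto
      also have "\<dots> = C / real M ^ (2 * k - 1) * (1 / real q)"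
        unfolding C_def power_divide by simp
      also have "\<dots> \<le> C / real M ^ (2 * k - 1) * (2 * real k * (1 / (1 + real e)))"
      proof (rule mult_left_mono)
        have "1 + real e \<le> 2 * real k * real q" using qk
          by (metis (no_types, lifting) of_nat_1 of_nat_add of_nat_le_iff of_nat_mult of_nat_numeral)
        then show "1 / real q \<le> 2 * real k * (1 / (1 + real e))"
          by (simp add: field_simps q_def)
      qed (use C in auto)
      finally show ?thesis by (simp add: e_def)
    qed
    have "(\<Sum>i\<in>X. (sdiff 1 k (mixed_bump k M) i)\<^sup>2) = (\<Sum>i\<in>X \<inter> Y. (sdiff 1 k (mixed_bump k M) i)\<^sup>2)"
      using X zero by (intro sum.mono_neutral_right) auto
    also have "\<dots> \<le> (\<Sum>i\<in>X \<inter> Y. C / real M ^ (2 * k - 1) * (2 * real k * (1 / (1 + real (nat \<bar>i\<bar>)))))"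
      by (intro sum_mono bd)
    also have "\<dots> \<le> (\<Sum>i\<in>Y. C / real M ^ (2 * k - 1) * (2 * real k * (1 / (1 + real (nat \<bar>i\<bar>)))))"
      using C by (intro sum_mono2) (auto simp: Y_def)
    also have "\<dots> = C / real M ^ (2 * k - 1) * (2 * real k) * (\<Sum>i\<in>Y. 1 / (1 + real (nat \<bar>i\<bar>)))"
      by (simp add: sum_distrib_left)
    also have "(\<Sum>i\<in>Y. 1 / (1 + real (nat \<bar>i\<bar>))) \<le> 2 * (\<Sum>e\<le>k * M. 1 / (1 + real e))"
    proof -
      have Y: "Y \<subseteq> int ` {..k * M} \<union> (\<lambda>e. - int e) ` {..k * M}"
      proof
        fix i assume "i \<in> Y"
        then have "(i = int (nat \<bar>i\<bar>) \<or> i = - int (nat \<bar>i\<bar>)) \<and> nat \<bar>i\<bar> \<le> k * M"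
          unfolding Y_def nat_le_iff by auto
        then show "i \<in> int ` {..k * M} \<union> (\<lambda>e. - int e) ` {..k * M}" by blast
      qed
      have "(\<Sum>i\<in>Y. 1 / (1 + real (nat \<bar>i\<bar>)))
          \<le> (\<Sum>i\<in>int ` {..k * M} \<union> (\<lambda>e. - int e) ` {..k * M}. 1 / (1 + real (nat \<bar>i\<bar>)))"
        by (intro sum_mono2 Y) auto
      also have "\<dots> \<le> (\<Sum>i\<in>int ` {..k * M}. 1 / (1 + real (nat \<bar>i\<bar>))) + (\<Sum>i\<in>(\<lambda>e. - int e) ` {..k * M}. 1 / (1 + real (nat \<bar>i\<bar>)))"
        by (subst sum.union_inter[symmetric]) (auto intro!: sum_nonneg)
      also have "\<dots> = 2 * (\<Sum>e\<le>k * M. 1 / (1 + real e))"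
        by (simp add: sum.reindex inj_on_def)
      finally show ?thesis .
    qed
    also have "(\<Sum>e\<le>k * M. 1 / (1 + real e)) \<le> 1 + ln (1 + real (k * M))"
      by (rule sum_inverse_Suc_le)
    also have "1 + ln (1 + real (k * M)) \<le> (1 + ln (2 * real k)) * ln (exp 1 * real M)"
    proof -
      have kM: "1 \<le> real k * real M" using assms M by (simp flip: of_nat_mult)
      have lnM: "0 \<le> ln (real M)" using M by (intro ln_ge_zero) auto
      have "ln (1 + real (k * M)) \<le> ln (2 * real k * real M)"
        using kM by (intro ln_mono) (simp_all add: mult_ac)
      also have "\<dots> = ln (2 * real k) + ln (real M)"
        using assms M by (simp add: ln_mult)
      finally have "1 + ln (1 + real (k * M)) \<le> 1 + ln (2 * real k) + ln (real M)" by simp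
      also have "\<dots> \<le> (1 + ln (2 * real k)) * (1 + ln (real M))"
        using k2 lnM by (simp add: algebra_simps)
      also have "1 + ln (real M) = ln (exp 1 * real M)" using M by (simp add: ln_mult)
      finally show ?thesis .
    qed
    finally have "(\<Sum>i\<in>X. (sdiff 1 k (mixed_bump k M) i)\<^sup>2)
       \<le> C / real M ^ (2 * k - 1) * (2 * real k) * (2 * ((1 + ln (2 * real k)) * ln (exp 1 * real M)))"
      using C by (simp add: mult_left_mono divide_right_mono)
    also have "\<dots> = K * ln (exp 1 * real M) / real M ^ (2 * k - 1)"
      by (simp add: K_def)
    finally show "(\<Sum>i\<in>X. (sdiff 1 k (mixed_bump k M) i)\<^sup>2) \<le> K * ln (exp 1 * real M) / real M ^ (2 * k - 1)" .
  qed
qed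

text \<open>One constant serves both profiles, uniformly in the width and in the finite set of
  points, so it can be fixed before the side lengths and the tessellation are known.\<close>

definition energy_bound :: "nat \<Rightarrow> real \<Rightarrow> bool" where
  "energy_bound k K \<longleftrightarrow> 0 \<le> K \<and> (\<forall>M X. 1 \<le> M \<longrightarrow> finite X \<longrightarrow>
     (\<Sum>i\<in>X. (sdiff 1 k (bump k M) i)\<^sup>2) \<le> K / real M ^ (2 * k - 1) \<and>
     (\<Sum>i\<in>X. (sdiff 1 k (mixed_bump k M) i)\<^sup>2) \<le> K * ln (exp 1 * real M) / real M ^ (2 * k - 1))"

lemma energy_boundD:
  assumes "energy_bound k K"
  shows "0 \<le> K"
    and "1 \<le> M \<Longrightarrow> finite X \<Longrightarrow> (\<Sum>i\<in>X. (sdiff 1 k (bump k M) i)\<^sup>2) \<le> K / real M ^ (2 * k - 1)"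
    and "1 \<le> M \<Longrightarrow> finite X \<Longrightarrow>
      (\<Sum>i\<in>X. (sdiff 1 k (mixed_bump k M) i)\<^sup>2) \<le> K * ln (exp 1 * real M) / real M ^ (2 * k - 1)"
  using assms unfolding energy_bound_def by blast+

lemma energy_bound_exists:
  assumes k: "1 \<le> k"
  shows "\<exists>K>0. energy_bound k K"
proof -
  obtain K1 where K1: "0 < K1" "\<And>M X. M \<ge> 1 \<Longrightarrow> finite X \<Longrightarrow>
      (\<Sum>i\<in>X. (sdiff 1 k (mixed_bump k M) i)\<^sup>2) \<le> K1 * ln (exp 1 * real M) / real M ^ (2 * k - 1)"
    using sum_sdiff_mixed_bump_le[OF k] by blast
  define K where "K = max K1 (3 * real k * 4 ^ k)"
  have K0: "0 < K" using K1(1) by (simp add: K_def)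
  moreover have "energy_bound k K"
    unfolding energy_bound_def
  proof (intro conjI allI impI)
    fix M :: nat and X :: "int set"
    assume M: "1 \<le> M" and X: "finite X"
    show "(\<Sum>i\<in>X. (sdiff 1 k (bump k M) i)\<^sup>2) \<le> K / real M ^ (2 * k - 1)"
      using sum_sdiff_bump_le[OF M k X] by (rule order_trans) (intro divide_right_mono, auto simp: K_def)
    have "0 \<le> ln (exp 1 * real M)" using M by (simp add: ln_mult)
    then show "(\<Sum>i\<in>X. (sdiff 1 k (mixed_bump k M) i)\<^sup>2) \<le> K * ln (exp 1 * real M) / real M ^ (2 * k - 1)"
      using K1(2)[OF M X] by (elim order_trans) (intro divide_right_mono mult_right_mono, auto simp: K_def)
  qed (use K0 in simp)
  ultimately show ?thesis by blast
qed

section \<open>The difference operator and its dictionary\<close>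

text \<open>The matrix entry in row \<open>j\<close> and column \<open>i\<close>. The binomial
  coefficient is 0 when j - i exceeds k, so one case distinction suffices.\<close>

definition diff_coeff :: "nat \<Rightarrow> nat \<Rightarrow> nat \<Rightarrow> nat \<Rightarrow> real" where
  "diff_coeff k N j i = real N ^ (k - 1) * (if i \<le> j then (-1) ^ (j - i) * real (k choose (j - i)) else 0)"

definition diff_kernel :: "nat \<Rightarrow> (nat \<Rightarrow> nat) \<Rightarrow> nat \<Rightarrow> mindex \<Rightarrow> mindex \<Rightarrow> real" where
  "diff_kernel d n k j i = (\<Prod>c=1..d. diff_coeff k (n c) (j c) (i c))"

lemma sum_diff_coeff:
  assumes "j \<in> {k + 1..N}"
  shows "(\<Sum>y=1..N. diff_coeff k N j y * F y)
    = real N ^ (k - 1) * (\<Sum>l=0..k. (-1) ^ l * real (k choose l) * F (j - l))"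
proof -
  have "(\<Sum>y=1..N. diff_coeff k N j y * F y) = (\<Sum>y=j - k..j. diff_coeff k N j y * F y)"
    using assms by (intro sum.mono_neutral_right) (auto simp: diff_coeff_def binomial_eq_0)
  also have "\<dots> = (\<Sum>l=0..k. diff_coeff k N j (j - l) * F (j - l))"
    using assms by (intro sum.reindex_bij_witness[of _ "\<lambda>l. j - l" "\<lambda>y. j - y"]) auto
  also have "\<dots> = (\<Sum>l=0..k. real N ^ (k - 1) * ((-1) ^ l * real (k choose l) * F (j - l)))"
    using assms by (intro sum.cong) (auto simp: diff_coeff_def)
  finally show ?thesis by (simp add: sum_distrib_left)
qed

lemma sum_PiE_insert:
  assumes "x \<notin> A" "finite A" "\<And>c. finite (B c)"
  shows "(\<Sum>g\<in>PiE (insert x A) B. F g) = (\<Sum>y\<in>B x. \<Sum>g\<in>PiE A B. F (g(x := y)))"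
proof -
  have "(\<Sum>g\<in>PiE (insert x A) B. F g) = (\<Sum>(y, g)\<in>B x \<times> PiE A B. F (g(x := y)))"
    unfolding PiE_insert_eq using assms inj_combinator[OF assms(1), of B]
    by (subst sum.reindex) (auto simp: case_prod_unfold)
  then show ?thesis by (simp add: sum.cartesian_product)
qed

text \<open>The last operator of the fold is the outermost one, so the induction peels off the
  highest coordinate; coordinates beyond \<open>m\<close> stay as parameters.\<close>

lemma fold_partial_diff_eq:
  assumes "\<And>c. c \<in> {1..m} \<Longrightarrow> j c \<in> {k + 1..n c}"
  shows "fold (partial_diff n k) [1..<m + 1] f j
    = (\<Sum>i\<in>PiE {1..m} (\<lambda>c. {1..n c}). (\<Prod>c=1..m. diff_coeff k (n c) (j c) (i c)) *
         f (\<lambda>c. if c \<in> {1..m} then i c else j c))"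
  using assms
proof (induction m arbitrary: j)
  case 0
  show ?case by simp
next
  case (Suc m)
  let ?I = "{1..m}" and ?B = "\<lambda>c. {1..n c}"
  let ?F = "\<lambda>i. (\<Prod>c=1..Suc m. diff_coeff k (n c) (j c) (i c)) *
      f (\<lambda>c. if c \<in> {1..Suc m} then i c else j c)"
  have ins: "{1..Suc m} = insert (Suc m) ?I" by auto
  define h where "h = fold (partial_diff n k) [1..<m + 1] f"
  have jm: "j (Suc m) \<in> {k + 1..n (Suc m)}" by (rule Suc.prems) simp
  have "fold (partial_diff n k) [1..<Suc m + 1] f j = partial_diff n k (Suc m) h j"
  proof -
    have "[1..<Suc m + 1] = [1..<m + 1] @ [Suc m]" by simp
    then show ?thesis unfolding h_def by (simp only: fold_append fold_simps comp_apply)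
  qed
  also have "\<dots> = real (n (Suc m)) ^ (k - 1) * (\<Sum>l=0..k. (-1) ^ l * real (k choose l) * h (j(Suc m := j (Suc m) - l)))"
    using jm unfolding partial_diff_def by simp
  also have "\<dots> = (\<Sum>y=1..n (Suc m). diff_coeff k (n (Suc m)) (j (Suc m)) y * h (j(Suc m := y)))"
    by (rule sum_diff_coeff[OF jm, symmetric])
  also have "\<dots> = (\<Sum>y=1..n (Suc m). \<Sum>g\<in>PiE ?I ?B.
      ?F (g(Suc m := y)))"
  proof (rule sum.cong[OF refl])
    fix y assume "y \<in> {1..n (Suc m)}"
    have hj: "h (j(Suc m := y)) = (\<Sum>i\<in>PiE ?I ?B. (\<Prod>c=1..m. diff_coeff k (n c) ((j(Suc m := y)) c) (i c)) *
         f (\<lambda>c. if c \<in> {1..m} then i c else (j(Suc m := y)) c))"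
      \<comment> \<open>Here \<open>y\<close> runs through the whole side and may lie below k + 1,
        but the induction hypothesis restricts only the coordinates up to \<open>m\<close>.\<close>
      unfolding h_def using Suc.prems by (intro Suc.IH) auto
    show "diff_coeff k (n (Suc m)) (j (Suc m)) y * h (j(Suc m := y)) = (\<Sum>g\<in>PiE ?I ?B.
      ?F (g(Suc m := y)))"
      unfolding hj sum_distrib_left
    proof (rule sum.cong[OF refl])
      fix g assume "g \<in> PiE ?I ?B"
      have 1: "(\<Prod>c=1..Suc m. diff_coeff k (n c) (j c) ((g(Suc m := y)) c))
         = diff_coeff k (n (Suc m)) (j (Suc m)) y * (\<Prod>c=1..m. diff_coeff k (n c) ((j(Suc m := y)) c) (g c))"
        unfolding ins by (subst prod.insert) (auto intro!: prod.cong)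
      have 2: "(\<lambda>c. if c \<in> {1..m} then g c else (j(Suc m := y)) c)
         = (\<lambda>c. if c \<in> {1..Suc m} then (g(Suc m := y)) c else j c)"
        by (auto simp: fun_eq_iff)
      show "diff_coeff k (n (Suc m)) (j (Suc m)) y * ((\<Prod>c=1..m. diff_coeff k (n c) ((j(Suc m := y)) c) (g c)) *
         f (\<lambda>c. if c \<in> {1..m} then g c else (j(Suc m := y)) c))
       = ?F (g(Suc m := y))"
        unfolding 1 2 by (simp only: mult.assoc)
    qed
  qed
  also have "\<dots> = (\<Sum>i\<in>PiE {1..Suc m} ?B. ?F i)"
    unfolding ins by (subst sum_PiE_insert) auto
  finally show ?case .
qed

lemma finite_grid: "finite (grid d n)" and finite_diff_grid: "finite (diff_grid d n k)"
  by (auto simp: grid_def diff_grid_def hyperrect_def intro!: finite_PiE)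

lemma card_grid: "card (grid d n) = num_entries d n"
  by (simp add: grid_def hyperrect_def num_entries_def card_PiE)

lemma diff_grid_subset: "diff_grid d n k \<subseteq> grid d n"
  unfolding grid_def diff_grid_def hyperrect_def by (intro PiE_mono) auto

lemma total_diff_eq:
  assumes "j \<in> diff_grid d n k"
  shows "total_diff d n k f j = inner_on (grid d n) (diff_kernel d n k j) f"
proof -
  have j: "j \<in> PiE {1..d} (\<lambda>c. {k + 1..n c})" using assms by (simp add: diff_grid_def hyperrect_def)
  have "total_diff d n k f j = (\<Sum>i\<in>grid d n. (\<Prod>c=1..d. diff_coeff k (n c) (j c) (i c)) *
         f (\<lambda>c. if c \<in> {1..d} then i c else j c))"
    unfolding total_diff_def grid_def hyperrect_def using j by (intro fold_partial_diff_eq) auto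
  also have "\<dots> = inner_on (grid d n) (diff_kernel d n k j) f"
    unfolding inner_on_def diff_kernel_def
  proof (rule sum.cong[OF refl])
    fix i assume "i \<in> grid d n"
    then have "(\<lambda>c. if c \<in> {1..d} then i c else j c) = i"
      using j by (auto simp: grid_def hyperrect_def fun_eq_iff PiE_def extensional_def)
    then show "(\<Prod>c=1..d. diff_coeff k (n c) (j c) (i c)) * f (\<lambda>c. if c \<in> {1..d} then i c else j c)
      = (\<Prod>c=1..d. diff_coeff k (n c) (j c) (i c)) * f i" by simp
  qed
  finally show ?thesis .
qed

lemma sum_diff_coeff_sdiff:
  assumes "j \<in> {k + 1..N}"
  shows "(\<Sum>y=1..N. diff_coeff k N j y * F (int y)) = real N ^ (k - 1) * sdiff (-1) k F (int j)"
  unfolding sum_diff_coeff[OF assms] sdiff_def using assms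
  by (auto simp: atLeast0AtMost of_nat_diff intro!: sum.cong)

text \<open>The support condition removes the boundary: rows outside the difference range carry the
  value 0, so the truncated adjoint is the plain forward difference.\<close>

lemma sum_diff_coeff_adjoint:
  assumes supp: "\<And>y. F y \<noteq> 0 \<Longrightarrow> int (k + 1) \<le> y \<and> y \<le> int N" and i: "i \<in> {1..N}"
  shows "(\<Sum>j=k + 1..N. diff_coeff k N j i * F (int j)) = real N ^ (k - 1) * sdiff 1 k F (int i)"
proof -
  have z: "F (int j) = 0" if "j \<notin> {k + 1..N}" for j
  proof (rule ccontr)
    assume "F (int j) \<noteq> 0"
    then show False using supp[of "int j"] that by simp
  qed
  have "(\<Sum>j=k + 1..N. diff_coeff k N j i * F (int j)) = (\<Sum>j\<in>{i..i + k} \<inter> {k + 1..N}. diff_coeff k N j i * F (int j))"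
    by (intro sum.mono_neutral_right) (auto simp: diff_coeff_def binomial_eq_0)
  also have "\<dots> = (\<Sum>j=i..i + k. diff_coeff k N j i * F (int j))"
    using z by (intro sum.mono_neutral_left) auto
  also have "\<dots> = (\<Sum>l\<le>k. diff_coeff k N (i + l) i * F (int (i + l)))"
    by (intro sum.reindex_bij_witness[of _ "\<lambda>l. i + l" "\<lambda>j. j - i"]) auto
  also have "\<dots> = real N ^ (k - 1) * sdiff 1 k F (int i)"
    unfolding sdiff_def sum_distrib_left by (intro sum.cong) (auto simp: diff_coeff_def)
  finally show ?thesis .
qed

lemma sdiff_shift: "sdiff s k (\<lambda>x. f (x - a)) i = sdiff s k f (i - a)"
  by (simp add: sdiff_def algebra_simps)

text \<open>The k-th differences of \<open>atom d n k t j\<close> are supported on the cube with lower corner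
  \<open>t\<close> and side k, and they are the unit vector at \<open>j\<close> when \<open>t = j\<close>.\<close>
definition atom :: "nat \<Rightarrow> (nat \<Rightarrow> nat) \<Rightarrow> nat \<Rightarrow> mindex \<Rightarrow> mindex \<Rightarrow> tensor" where
  "atom d n k t j = (\<lambda>i. if i \<in> grid d n
     then \<Prod>c=1..d. cut_poly (k - 1) (int (t c) - int (j c)) (int (i c) - int (j c)) / real (n c) ^ (k - 1)
     else 0)"

lemma inner_on_grid_prod:
  "inner_on (grid d n) (\<lambda>i. \<Prod>c=1..d. u c (i c)) (\<lambda>i. \<Prod>c=1..d. v c (i c)) = (\<Prod>c=1..d. \<Sum>y=1..n c. u c y * v c y)"
  unfolding inner_on_def grid_def hyperrect_def by (subst prod_sum_PiE) (auto simp: prod.distrib)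

text \<open>Kernel and atom are both products over the coordinates, so the sum over the grid
  factorises; the powers of the side lengths cancel.\<close>

lemma inner_on_kernel_atom:
  assumes "j' \<in> diff_grid d n k" "k \<ge> 1" "\<forall>c\<in>{1..d}. 1 \<le> n c"
  shows "inner_on (grid d n) (diff_kernel d n k j') (atom d n k t j)
    = (\<Prod>c=1..d. sdiff (-1) k (cut_poly (k - 1) (int (t c) - int (j c))) (int (j' c) - int (j c)))"
proof -
  have "inner_on (grid d n) (diff_kernel d n k j') (atom d n k t j)
     = inner_on (grid d n) (\<lambda>i. \<Prod>c=1..d. diff_coeff k (n c) (j' c) (i c))
        (\<lambda>i. \<Prod>c=1..d. cut_poly (k - 1) (int (t c) - int (j c)) (int (i c) - int (j c)) / real (n c) ^ (k - 1))"
    by (rule inner_on_cong) (auto simp: diff_kernel_def atom_def)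
  also have "\<dots> = (\<Prod>c=1..d. \<Sum>y=1..n c. diff_coeff k (n c) (j' c) y *
       (cut_poly (k - 1) (int (t c) - int (j c)) (int y - int (j c)) / real (n c) ^ (k - 1)))"
    by (rule inner_on_grid_prod)
  also have "\<dots> = (\<Prod>c=1..d. sdiff (-1) k (cut_poly (k - 1) (int (t c) - int (j c))) (int (j' c) - int (j c)))"
  proof (rule prod.cong[OF refl])
    fix c assume c: "c \<in> {1..d}"
    then have j': "j' c \<in> {k + 1..n c}" using assms(1) by (auto simp: diff_grid_def hyperrect_def)
    have "(\<Sum>y=1..n c. diff_coeff k (n c) (j' c) y *
       (cut_poly (k - 1) (int (t c) - int (j c)) (int y - int (j c)) / real (n c) ^ (k - 1)))
      = (\<Sum>y=1..n c. diff_coeff k (n c) (j' c) y *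
       (cut_poly (k - 1) (int (t c) - int (j c)) (int y - int (j c)))) / real (n c) ^ (k - 1)"
      by (simp add: sum_divide_distrib)
    also have "\<dots> = sdiff (-1) k (cut_poly (k - 1) (int (t c) - int (j c))) (int (j' c) - int (j c))"
      using bspec[OF assms(3) c] by (subst sum_diff_coeff_sdiff[OF j', where F="\<lambda>x. cut_poly (k - 1) (int (t c) - int (j c)) (x - int (j c))"])
        (simp add: sdiff_shift)
    finally show "(\<Sum>y=1..n c. diff_coeff k (n c) (j' c) y *
       (cut_poly (k - 1) (int (t c) - int (j c)) (int y - int (j c)) / real (n c) ^ (k - 1)))
       = sdiff (-1) k (cut_poly (k - 1) (int (t c) - int (j c))) (int (j' c) - int (j c))" .
  qed
  finally show ?thesis .
qed

lemma inner_on_kernel_atom_self: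
  assumes "j' \<in> diff_grid d n k" "j \<in> diff_grid d n k" "k \<ge> 1" "\<forall>c\<in>{1..d}. 1 \<le> n c"
  shows "inner_on (grid d n) (diff_kernel d n k j') (atom d n k j j) = (if j' = j then 1 else 0)"
proof -
  obtain m where m: "k = Suc m" using assms(3) by (cases k) auto
  have "inner_on (grid d n) (diff_kernel d n k j') (atom d n k j j) = (\<Prod>c=1..d. if j' c = j c then 1 else 0)"
    unfolding inner_on_kernel_atom[OF assms(1,3,4)] unfolding m
    by (simp add: sdiff_cut_poly_0 del: of_nat_Suc)
  moreover have "j' = j \<longleftrightarrow> (\<forall>c\<in>{1..d}. j' c = j c)"
    using assms(1,2) unfolding diff_grid_def hyperrect_def by (metis PiE_ext)
  moreover have "(\<Prod>c=1..d. if j' c = j c then 1 else (0::real)) = 0" if "\<exists>c\<in>{1..d}. j' c \<noteq> j c"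
    using that by (intro prod_zero) auto
  ultimately show ?thesis by auto
qed

lemma inner_on_kernel_atom_eq_0:
  assumes "j' \<in> diff_grid d n k" "k \<ge> 1" "\<forall>c\<in>{1..d}. 1 \<le> n c"
    "c \<in> {1..d}" "j' c \<notin> {t c..t c + k - 1}"
  shows "inner_on (grid d n) (diff_kernel d n k j') (atom d n k t j) = 0"
proof -
  obtain m where m: "k = Suc m" using assms(2) by (cases k) auto
  have "sdiff (-1) k (cut_poly (k - 1) (int (t c) - int (j c))) (int (j' c) - int (j c)) = 0"
    unfolding m using assms(5) m by (simp, intro sdiff_cut_poly_eq_0) auto
  then show ?thesis
    unfolding inner_on_kernel_atom[OF assms(1-3)] using assms(4) by (intro prod_zero) auto
qed

lemma sum_grid_coordinate:
  assumes "c \<in> {1..d}" "n c \<ge> 1"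
  shows "(\<Sum>i\<in>grid d n. F (i c)) = real (num_entries d n) / real (n c) * (\<Sum>y=1..n c. F y)"
proof -
  have "(\<Sum>i\<in>grid d n. F (i c)) = (\<Sum>i\<in>grid d n. \<Prod>c'=1..d. if c' = c then F (i c') else 1)"
    using assms by (intro sum.cong) auto
  also have "\<dots> = (\<Prod>c'=1..d. \<Sum>y=1..n c'. if c' = c then F y else 1)"
    unfolding grid_def hyperrect_def by (subst prod_sum_PiE) auto
  also have "\<dots> = (\<Sum>y=1..n c. F y) * (\<Prod>c'\<in>{1..d} - {c}. real (n c'))"
    using assms by (subst prod.remove[of _ c]) (auto intro!: prod.cong)
  also have "(\<Prod>c'\<in>{1..d} - {c}. real (n c')) = real (num_entries d n) / real (n c)"
    unfolding num_entries_def using assms by (subst (2) prod.remove[of _ c]) auto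
  finally show ?thesis by simp
qed

text \<open>The product of the losses in \<open>norm_atom_diff_le\<close>: the scaling of the
  factors, the Cauchy-Schwarz factor \<open>d\<close>, and the one-dimensional bound for moving a
  cut.\<close>

definition atom_const :: "nat \<Rightarrow> nat \<Rightarrow> real" where
  "atom_const d k = (real k + 1) ^ (2 * d * (k - 1)) * real d * real k ^ (2 * (k - 1))"

text \<open>Divided by \<open>U\<close>, all factors lie in [-1, 1], where a difference of products
  is at most the sum of the differences of the factors. Each of these depends on one coordinate, so
  its sum over the grid is N / n c times the one-dimensional bound.\<close>

lemma norm_atom_diff_le:
  assumes "j \<in> grid d n" "k \<ge> 1" "\<forall>c\<in>{1..d}. 1 \<le> n c"
  shows "inner_on (grid d n) (\<lambda>i. atom d n k j j i - atom d n k t j i) (\<lambda>i. atom d n k j j i - atom d n k t j i)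
    \<le> real (num_entries d n) * atom_const d k * (\<Sum>c=1..d. (\<bar>real (j c) - real (t c)\<bar> / real (n c)) ^ (2 * k - 1))"
proof -
  let ?r = "\<lambda>i. atom d n k j j i - atom d n k t j i"
  define U where "U = (real k + 1) ^ (k - 1)"
  have U: "U \<ge> 1" unfolding U_def by (rule one_le_power) simp
  define u where "u t c y = cut_poly (k - 1) (int (t c) - int (j c)) (int y - int (j c)) / real (n c) ^ (k - 1)"
    for t :: mindex and c y :: nat
  have ub: "\<bar>u t c y\<bar> \<le> U" if "c \<in> {1..d}" "y \<in> {1..n c}" for t c y
  proof -
    have jc: "j c \<in> {1..n c}" using assms(1) that by (auto simp: grid_def hyperrect_def)
    have "\<bar>cut_poly (k - 1) (int (t c) - int (j c)) (int y - int (j c))\<bar> \<le> \<bar>rising_poly (k - 1) (int y - int (j c))\<bar>"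
      by (simp add: cut_poly_def)
    also have "\<dots> \<le> (\<bar>of_int (int y - int (j c))\<bar> + real (k - 1)) ^ (k - 1)"
      by (rule abs_rising_poly_le)
    also have "\<dots> \<le> ((real k + 1) * real (n c)) ^ (k - 1)"
    proof (rule power_mono)
      have "\<bar>of_int (int y - int (j c))\<bar> \<le> real (n c)" "real (k - 1) \<le> real k * 1" using jc that by auto
      moreover have "real k * 1 \<le> real k * real (n c)" using jc by (intro mult_left_mono) auto
      ultimately show "\<bar>of_int (int y - int (j c))\<bar> + real (k - 1) \<le> (real k + 1) * real (n c)"
        unfolding distrib_right by linarith
    qed simp
    finally show ?thesis using bspec[OF assms(3) that(1)] unfolding u_def U_def
      by (simp add: power_mult_distrib divide_le_eq)
  qed
  have pt: "(?r i)\<^sup>2 \<le> U ^ (2 * d) * real d * (\<Sum>c=1..d. (u j c (i c) - u t c (i c))\<^sup>2)"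
    if i: "i \<in> grid d n" for i
  proof -
    let ?P = "(\<Prod>c=1..d. u j c (i c) / U) - (\<Prod>c=1..d. u t c (i c) / U)"
    have ic: "i c \<in> {1..n c}" if "c \<in> {1..d}" for c using i that by (auto simp: grid_def hyperrect_def)
    have "\<bar>?P\<bar>
        \<le> (\<Sum>c=1..d. \<bar>u j c (i c) / U - u t c (i c) / U\<bar>)"
      using norm_prod_diff[of "{1..d}" "\<lambda>c. u j c (i c) / U" "\<lambda>c. u t c (i c) / U"] ub[OF _ ic] U
      by (auto simp: divide_le_eq)
    also have "\<dots> \<le> (\<Sum>c=1..d. \<bar>u j c (i c) - u t c (i c)\<bar>)"
      using U by (intro sum_mono) (simp add: divide_le_eq mult_le_cancel_left1 flip: diff_divide_distrib)
    finally have le: "\<bar>?P\<bar> \<le> (\<Sum>c=1..d. \<bar>u j c (i c) - u t c (i c)\<bar>)" .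
    have eq: "?r i = U ^ d * ?P"
    proof -
      have "U ^ d * (\<Prod>c=1..d. u t c (i c) / U) = (\<Prod>c=1..d. u t c (i c))" for t
        using U by (simp add: prod_dividef)
      moreover have "atom d n k t j i = (\<Prod>c=1..d. u t c (i c))" for t
        using i by (simp only: atom_def u_def if_True)
      ultimately show ?thesis unfolding right_diff_distrib by (simp only:)
    qed
    have "(?r i)\<^sup>2 = U ^ (2 * d) * \<bar>?P\<bar>\<^sup>2"
      unfolding eq power_mult_distrib power2_abs power_even_eq ..
    also have "\<dots> \<le> U ^ (2 * d) * (\<Sum>c=1..d. \<bar>u j c (i c) - u t c (i c)\<bar>)\<^sup>2"
      using le U by (intro mult_left_mono power_mono) auto
    also have "(\<Sum>c=1..d. \<bar>u j c (i c) - u t c (i c)\<bar>)\<^sup>2 \<le> real d * (\<Sum>c=1..d. (u j c (i c) - u t c (i c))\<^sup>2)"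
      using Cauchy_Schwarz_ineq_sum[of "\<lambda>_. 1" "\<lambda>c. \<bar>u j c (i c) - u t c (i c)\<bar>" "{1..d}"] by simp
    finally show ?thesis using U by (simp add: mult.assoc mult_left_mono)
  qed
  have "inner_on (grid d n) ?r ?r
     = (\<Sum>i\<in>grid d n. (?r i)\<^sup>2)"
    by (simp add: inner_on_def power2_eq_square)
  also have "\<dots> \<le> (\<Sum>i\<in>grid d n. U ^ (2 * d) * real d * (\<Sum>c=1..d. (u j c (i c) - u t c (i c))\<^sup>2))"
    by (intro sum_mono pt)
  also have "\<dots> = U ^ (2 * d) * real d * (\<Sum>c=1..d. \<Sum>i\<in>grid d n. (u j c (i c) - u t c (i c))\<^sup>2)"
    by (subst sum.swap) (simp add: sum_distrib_left)
  also have "\<dots> \<le> U ^ (2 * d) * real d * (\<Sum>c=1..d. real (num_entries d n) * real k ^ (2 * (k - 1)) * (\<bar>real (j c) - real (t c)\<bar> / real (n c)) ^ (2 * k - 1))"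
  proof (intro mult_left_mono sum_mono)
    fix c assume c: "c \<in> {1..d}"
    let ?F = "\<lambda>x. (cut_poly (k - 1) 0 x - cut_poly (k - 1) (int (t c) - int (j c)) x)\<^sup>2"
    have "(\<Sum>i\<in>grid d n. (u j c (i c) - u t c (i c))\<^sup>2) = real (num_entries d n) / real (n c) * (\<Sum>y=1..n c. (u j c y - u t c y)\<^sup>2)"
      using assms(3) c by (intro sum_grid_coordinate[where F="\<lambda>y. (u j c y - u t c y)\<^sup>2"]) auto
    also have "(\<Sum>y=1..n c. (u j c y - u t c y)\<^sup>2) = (\<Sum>y=1..n c. ?F (int y - int (j c))) / real (n c) ^ (2 * (k - 1))"
      unfolding u_def diff_divide_distrib[symmetric] power_divide power_even_eq sum_divide_distrib by simp
    also have "(\<Sum>y=1..n c. ?F (int y - int (j c))) = (\<Sum>x\<in>(\<lambda>y. int y - int (j c)) ` {1..n c}. ?F x)"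
      by (subst sum.reindex) (auto simp: inj_on_def)
    also have "\<dots> \<le> (real (k - 1) + 1) ^ (2 * (k - 1)) * \<bar>of_int (int (t c) - int (j c))\<bar> ^ (2 * (k - 1) + 1)"
      by (rule sum_power2_cut_poly_diff_le) simp
    also have "real (k - 1) + 1 = real k" using assms(2) by simp
    also have "2 * (k - 1) + 1 = 2 * k - 1" using assms(2) by simp
    finally have "(\<Sum>i\<in>grid d n. (u j c (i c) - u t c (i c))\<^sup>2) \<le> real (num_entries d n) / real (n c) *
        (real k ^ (2 * (k - 1)) * \<bar>of_int (int (t c) - int (j c))\<bar> ^ (2 * k - 1) / real (n c) ^ (2 * (k - 1)))"
      by (simp add: mult_left_mono divide_right_mono)
    also have "\<dots> = real (num_entries d n) * real k ^ (2 * (k - 1)) * (\<bar>real (j c) - real (t c)\<bar> / real (n c)) ^ (2 * k - 1)"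
    proof -
      have "2 * k - 1 = Suc (2 * (k - 1))" using assms(2) by simp
      moreover have "\<bar>of_int (int (t c) - int (j c))\<bar> = \<bar>real (j c) - real (t c)\<bar>" by simp
      ultimately show ?thesis by (simp only: power_divide power_Suc) (simp add: mult_ac)
    qed
    finally show "(\<Sum>i\<in>grid d n. (u j c (i c) - u t c (i c))\<^sup>2) \<le> real (num_entries d n) * real k ^ (2 * (k - 1)) * (\<bar>real (j c) - real (t c)\<bar> / real (n c)) ^ (2 * k - 1)" .
  qed (use U in auto)
  also have "\<dots> = real (num_entries d n) * atom_const d k * (\<Sum>c=1..d. (\<bar>real (j c) - real (t c)\<bar> / real (n c)) ^ (2 * k - 1))"
  proof -
    have "U ^ (2 * d) = (real k + 1) ^ (2 * d * (k - 1))"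
      unfolding U_def power_mult[symmetric] by (simp add: mult.commute)
    then show ?thesis unfolding atom_const_def sum_distrib_left by (simp add: mult_ac)
  qed
  finally show ?thesis .
qed

section \<open>The estimator\<close>

lemma frob_norm_power2: "(frob_norm d n f)\<^sup>2 = inner_on (grid d n) f f"
  by (simp add: frob_norm_def L2_set_def inner_on_def sum_nonneg power2_eq_square)

lemma tinner_eq: "tinner d n = inner_on (grid d n)"
  by (simp add: fun_eq_iff tinner_def inner_on_def)

lemma tensors_eq: "tensors d n = supported_on (grid d n)"
  by (simp add: tensors_def supported_on_def)

locale tensor_model =
  fixes d :: nat and n :: "nat \<Rightarrow> nat" and k :: nat
  assumes n_ge_1: "\<forall>c\<in>{1..d}. 1 \<le> n c" and k_ge_1: "1 \<le> k"
begin

abbreviation "N \<equiv> real (num_entries d n)"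
abbreviation "G \<equiv> grid d n"
abbreviation "J \<equiv> diff_grid d n k"
abbreviation "Dk \<equiv> total_diff d n k"
abbreviation "ip \<equiv> inner_on G"

lemma num_entries_pos: "0 < num_entries d n"
  unfolding num_entries_def using n_ge_1 by (intro prod_pos) (auto simp: Suc_le_eq)

lemma finite_G [simp]: "finite G" and finite_J [simp]: "finite J"
  by (rule finite_grid finite_diff_grid)+

text \<open>The orthogonal complement of the null space is the row space of the difference operator,
  so its rows are orthonormalised. They are first set to 0 off the grid, where
  \<open>diff_kernel\<close> need not vanish.\<close>

lemma exists_perp_basis:
  "\<exists>B. orthonormal G B \<and>
    (\<forall>f. (\<forall>j\<in>J. Dk f j = 0) \<longleftrightarrow> (\<forall>b\<in>B. ip f b = 0))"
proof -
  let ?a = "\<lambda>j i. if i \<in> G then diff_kernel d n k j i else 0"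
  have a: "ip (?a j) f = Dk f j" if "j \<in> J" for f j
    unfolding total_diff_eq[OF that] by (rule inner_on_cong) auto
  obtain B where B: "orthonormal G B" "card B \<le> card J" "\<And>j. j \<in> J \<Longrightarrow> proj_on G B (?a j) = ?a j"
    "\<And>b v. b \<in> B \<Longrightarrow> (\<And>j. j \<in> J \<Longrightarrow> ip (?a j) v = 0) \<Longrightarrow> ip b v = 0"
    by (rule gram_schmidt[of G J ?a]) (auto simp: supported_on_def)
  have "(\<forall>j\<in>J. Dk f j = 0) \<longleftrightarrow> (\<forall>b\<in>B. ip f b = 0)" for f
  proof
    assume "\<forall>j\<in>J. Dk f j = 0"
    then show "\<forall>b\<in>B. ip f b = 0" using B(4)[of _ f] a by (simp add: inner_on_commute)
  next
    assume *: "\<forall>b\<in>B. ip f b = 0"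
    show "\<forall>j\<in>J. Dk f j = 0"
    proof
      fix j assume j: "j \<in> J"
      have "Dk f j = ip (proj_on G B (?a j)) f" using a[OF j, of f] B(3)[OF j] by simp
      also have "\<dots> = 0" unfolding inner_on_proj_left using * by (intro sum.neutral) auto
      finally show "Dk f j = 0" .
    qed
  qed
  then show ?thesis using B(1) by blast
qed

definition perp_basis :: "tensor set" where
  "perp_basis = (SOME B. orthonormal G B \<and> (\<forall>f. (\<forall>j\<in>J. Dk f j = 0) \<longleftrightarrow> (\<forall>b\<in>B. ip f b = 0)))"

lemma orthonormal_perp_basis [simp]: "orthonormal G perp_basis"
  and total_diff_eq_0_iff: "(\<forall>j\<in>J. Dk f j = 0) \<longleftrightarrow> (\<forall>b\<in>perp_basis. ip f b = 0)"
  using someI_ex[OF exists_perp_basis] unfolding perp_basis_def by blast+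

abbreviation pr :: "tensor \<Rightarrow> tensor" where "pr \<equiv> proj_on G perp_basis"

text \<open>Membership becomes a fixed point equation. From left to right, \<open>h - pr h\<close>
  lies in the null space and is therefore orthogonal to \<open>h\<close> as well as to
  \<open>pr h\<close>, hence to itself.\<close>

lemma null_perp_eq: "null_perp d n k = {h. pr h = h}"
proof safe
  fix h assume h: "h \<in> null_perp d n k"
  let ?r = "\<lambda>j. h j - pr h j"
  have hs: "h \<in> supported_on G" using h by (simp add: null_perp_def tensors_eq)
  have rs: "?r \<in> supported_on G"
    using supported_on_closed(2)[OF hs proj_on_supported[OF orthonormal_perp_basis]] .
  have rb: "ip ?r b = 0" if "b \<in> perp_basis" for b
    using inner_on_proj_basis[OF orthonormal_perp_basis that, of h] by (simp add: inner_on_diff_left)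
  then have "?r \<in> null_space d n k" using rs total_diff_eq_0_iff[of ?r] by (simp add: null_space_def tensors_eq)
  then have "ip ?r h = 0" using h by (simp add: null_perp_def tinner_eq)
  moreover have "ip ?r (pr h) = 0"
    unfolding inner_on_commute[of G ?r "pr h"] inner_on_proj_left by (intro sum.neutral) (simp add: rb)
  ultimately have "ip ?r ?r = 0" by (simp add: inner_on_diff_right)
  then have "?r = (\<lambda>_. 0)" by (rule inner_on_eq_0[OF finite_G rs])
  then show "pr h = h" by (auto simp: fun_eq_iff)
next
  fix h assume h: "pr h = h"
  have "h \<in> supported_on G" using proj_on_supported[OF orthonormal_perp_basis, of h] h by simp
  moreover have "ip f h = 0" if "f \<in> null_space d n k" for f
  proof -
    have "ip f b = 0" if "b \<in> perp_basis" for b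
      using \<open>f \<in> null_space d n k\<close> that total_diff_eq_0_iff[of f] by (simp add: null_space_def)
    then have "ip (pr h) f = 0" unfolding inner_on_proj_left by (intro sum.neutral) auto
    then show ?thesis using h inner_on_commute[of G f h] by simp
  qed
  ultimately show "h \<in> null_perp d n k" by (simp add: null_perp_def tensors_eq tinner_eq)
qed

lemma pr_idem [simp]: "pr (pr f) = pr f"
  by (simp add: proj_on_idem)

lemma proj_perp_eq: "proj_perp d n k f = pr f"
  unfolding orth_proj_def
proof (rule the_equality)
  have "ip (\<lambda>j. f j - pr f j) v = 0" if "v \<in> null_perp d n k" for v
  proof -
    have "ip f v = ip (pr f) v" using that inner_on_proj_swap[of G perp_basis f v] by (simp add: null_perp_eq)
    then show ?thesis by (simp add: inner_on_diff_left)
  qed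
  then show "pr f \<in> null_perp d n k \<and> (\<forall>v\<in>null_perp d n k. tinner d n (\<lambda>j. f j - pr f j) v = 0)"
    by (simp add: null_perp_eq tinner_eq)
next
  fix h assume "h \<in> null_perp d n k \<and> (\<forall>v\<in>null_perp d n k. tinner d n (\<lambda>j. f j - h j) v = 0)"
  then have h: "pr h = h" "\<And>v. pr v = v \<Longrightarrow> ip (\<lambda>j. f j - h j) v = 0"
    by (auto simp: null_perp_eq tinner_eq)
  have "pr (\<lambda>j. f j - h j) = (\<lambda>_. 0)"
    unfolding proj_on_def[of _ _ "\<lambda>j. f j - h j"]
    using h(2)[OF proj_on_self[OF orthonormal_perp_basis]] by (intro ext sum.neutral) auto
  then show "h = pr f" using h(1) by (simp add: proj_on_linear fun_eq_iff)
qed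

lemma total_diff_linear:
  assumes "j \<in> J"
  shows "Dk (\<lambda>i. f i + g i) j = Dk f j + Dk g j"
    and "Dk (\<lambda>i. f i - g i) j = Dk f j - Dk g j"
    and "Dk (\<lambda>i. c * f i) j = c * Dk f j"
    and "Dk (\<lambda>i. \<Sum>b\<in>B. w b * F b i) j = (\<Sum>b\<in>B. w b * Dk (F b) j)"
  using assms by (simp_all add: total_diff_eq inner_on_linear inner_on_sum_right)

lemma total_diff_pr: "j \<in> J \<Longrightarrow> Dk (pr f) j = Dk f j"
proof -
  assume j: "j \<in> J"
  let ?r = "\<lambda>i. f i - pr f i"
  have "ip ?r b = 0" if "b \<in> perp_basis" for b
    using inner_on_proj_basis[OF orthonormal_perp_basis that, of f] by (simp add: inner_on_diff_left)
  then have "Dk ?r j = 0" using total_diff_eq_0_iff[of ?r] j by blast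
  then show ?thesis using j by (simp add: total_diff_linear)
qed

text \<open>Injectivity of the difference operator on the complement, which allows elements there to
  be identified by their differences.\<close>

lemma pr_eq_0_of_total_diff:
  assumes "pr f = f" "\<forall>j\<in>J. Dk f j = 0"
  shows "f = (\<lambda>_. 0)"
proof -
  have "ip f b = 0" if "b \<in> perp_basis" for b
    using total_diff_eq_0_iff[of f] assms(2) that by blast
  then have "pr f = (\<lambda>_. 0)" unfolding proj_on_def by simp
  then show ?thesis using assms(1) by simp
qed

section \<open>Existence, strong convexity and stability of the minimizer\<close>

definition crit :: "real \<Rightarrow> tensor \<Rightarrow> tensor \<Rightarrow> real" where
  "crit lam z f = ip (\<lambda>j. z j - f j) (\<lambda>j. z j - f j) / N + 2 * lam * TV d n k f"

lemma objective_eq: "pr f = f \<Longrightarrow> objective d n k lam Y f = crit lam (pr Y) f"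
  by (simp add: objective_def crit_def proj_perp_eq frob_norm_power2 proj_on_linear)

lemma TV_convex:
  assumes "0 \<le> \<theta>" "\<theta> \<le> 1"
  shows "TV d n k (\<lambda>i. (1 - \<theta>) * f i + \<theta> * g i) \<le> (1 - \<theta>) * TV d n k f + \<theta> * TV d n k g"
proof -
  have "TV d n k (\<lambda>i. (1 - \<theta>) * f i + \<theta> * g i) = (\<Sum>j\<in>J. \<bar>(1 - \<theta>) * Dk f j + \<theta> * Dk g j\<bar>)"
    unfolding TV_def by (intro sum.cong) (auto simp: total_diff_linear)
  also have "\<dots> \<le> (\<Sum>j\<in>J. (1 - \<theta>) * \<bar>Dk f j\<bar> + \<theta> * \<bar>Dk g j\<bar>)"
    using assms by (intro sum_mono order_trans[OF abs_triangle_ineq]) (simp add: abs_mult)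
  finally show ?thesis by (simp add: TV_def sum.distrib sum_distrib_left)
qed

lemma TV_nonneg: "0 \<le> TV d n k f"
  unfolding TV_def by (intro sum_nonneg) auto

text \<open>Compactness in the product topology, with the coordinates off the grid pinned at 0. If
  one coordinate of \<open>g\<close> exceeds \<open>R\<close>, twice the norm of \<open>z\<close>,
  the misfit of \<open>g\<close> is at least that of 0, so the minimum over the cube is
  global.\<close>

lemma crit_minimum_exists:
  assumes "0 \<le> lam"
  shows "\<exists>f. pr f = f \<and> (\<forall>g. pr g = g \<longrightarrow> crit lam z f \<le> crit lam z g)"
proof -
  have N: "N > 0" using num_entries_pos by simp
  define R where "R = 2 * sqrt (ip z z)"
  define K where "K = {f. pr f = f} \<inter> PiE UNIV (\<lambda>i. if i \<in> G then {-R..R} else {0})"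
  have [continuous_intros]: "continuous_on X (\<lambda>f::tensor. f i)" for X i
    by (rule continuous_on_subset[OF continuous_on_product_coordinates]) simp
  have "compact (PiE UNIV (\<lambda>i. if i \<in> G then {-R..R} else {0::real}))"
  proof -
    have "compactin (product_topology (\<lambda>i. euclidean) UNIV) (PiE UNIV (\<lambda>i. if i \<in> G then {-R..R} else {0::real}))"
      unfolding compactin_PiE by auto
    then show ?thesis unfolding euclidean_product_topology by simp
  qed
  moreover have "closed {f. pr f = f}"
  proof -
    have eq: "{f. pr f = f} = (\<Inter>i. {f. pr f i = f i})" by (auto simp: fun_eq_iff)
    show ?thesis
      unfolding eq unfolding proj_on_def inner_on_def
      by (intro closed_INT ballI closed_Collect_eq continuous_intros)
  qed
  ultimately have "compact K" unfolding K_def by (intro closed_Int_compact)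
  moreover have z0: "(\<lambda>_. 0) \<in> K" by (auto simp: K_def proj_on_def R_def inner_on_ge_0 inner_on_def[of _ "\<lambda>_. 0"])
  moreover have "continuous_on K (crit lam z)"
  proof -
    have eq: "crit lam z = (\<lambda>f. (\<Sum>j\<in>G. (z j - f j) * (z j - f j)) / N + 2 * lam * (\<Sum>j\<in>J. \<bar>\<Sum>i\<in>G. diff_kernel d n k j i * f i\<bar>))"
      unfolding crit_def[abs_def] TV_def by (simp add: total_diff_eq inner_on_def fun_eq_iff)
    show ?thesis unfolding eq using N by (intro continuous_intros) auto
  qed
  ultimately obtain f where f: "f \<in> K" "\<And>g. g \<in> K \<Longrightarrow> crit lam z f \<le> crit lam z g"
    using continuous_attains_inf[of K "crit lam z"] by blast
  have "crit lam z f \<le> crit lam z g" if g: "pr g = g" for g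
  proof (cases "g \<in> K")
    case False
    have "g \<in> supported_on G" using proj_on_supported[OF orthonormal_perp_basis, of g] g by simp
    then have "g \<in> K" if "\<forall>i\<in>G. \<bar>g i\<bar> \<le> R"
      using that g unfolding K_def supported_on_def by (auto simp: PiE_iff abs_le_iff)
    then obtain i where i: "i \<in> G" "\<bar>g i\<bar> > R"
      using False by (meson not_le)
    have le: "\<bar>h i\<bar> \<le> sqrt (ip h h)" for h
    proof (rule real_le_rsqrt)
      have "h i * h i \<le> ip h h" unfolding inner_on_def using i
        by (intro member_le_sum) auto
      then show "\<bar>h i\<bar>\<^sup>2 \<le> ip h h" by (simp add: power2_eq_square)
    qed
    have "sqrt (ip z z) \<le> sqrt (ip (\<lambda>j. z j - g j) (\<lambda>j. z j - g j))"
      using le[of z] le[of "\<lambda>j. z j - g j"] i(2) unfolding R_def by linarith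
    then have "ip z z \<le> ip (\<lambda>j. z j - g j) (\<lambda>j. z j - g j)" by simp
    moreover have "TV d n k (\<lambda>_. 0) = 0" unfolding TV_def by (simp add: total_diff_eq inner_on_def)
    ultimately have "crit lam z (\<lambda>_. 0) \<le> crit lam z g"
      using N assms TV_nonneg[of g] unfolding crit_def by (simp add: add_increasing2 divide_right_mono)
    then show ?thesis using f(2)[OF z0] by simp
  qed (rule f)
  then show ?thesis using f(1) by (auto simp: K_def)
qed

abbreviation "est lam \<equiv> estimator d n k lam"

text \<open>\<open>arg_min_on\<close> is a choice among minimizers; its properties follow once some
  minimizer is known to exist.\<close>

lemma estimator_minimizes:
  assumes "0 \<le> lam"
  shows "pr (est lam Y) = est lam Y"
    and "pr g = g \<Longrightarrow> crit lam (pr Y) (est lam Y) \<le> crit lam (pr Y) g"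
proof -
  obtain f where f: "pr f = f" "\<And>g. pr g = g \<Longrightarrow> crit lam (pr Y) f \<le> crit lam (pr Y) g"
    using crit_minimum_exists[OF assms] by blast
  have "is_arg_min (objective d n k lam Y) (\<lambda>f. f \<in> null_perp d n k) f"
    using f by (auto simp: is_arg_min_def null_perp_eq objective_eq not_less)
  then have "is_arg_min (objective d n k lam Y) (\<lambda>f. f \<in> null_perp d n k) (est lam Y)"
    unfolding estimator_def arg_min_on_def arg_min_def
    by (rule someI[where P="is_arg_min (objective d n k lam Y) (\<lambda>f. f \<in> null_perp d n k)"])
  then have *: "pr (est lam Y) = est lam Y \<and>
      (\<forall>g. pr g = g \<longrightarrow> \<not> objective d n k lam Y g < objective d n k lam Y (est lam Y))"
    unfolding is_arg_min_def null_perp_eq by blast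
  then show "pr (est lam Y) = est lam Y" by blast
  show "crit lam (pr Y) (est lam Y) \<le> crit lam (pr Y) g" if "pr g = g"
  proof -
    have "objective d n k lam Y (est lam Y) \<le> objective d n k lam Y g"
      using * that not_less by blast
    then show ?thesis unfolding objective_eq[OF that] objective_eq[OF conjunct1[OF *]] .
  qed
qed

text \<open>The minimizer is compared with the points of the segment towards \<open>g\<close>: the
  quadratic part gains \<theta> * (1 - \<theta>) * q and the total variation is convex. Dividing by
  \<theta> and letting \<theta> tend to 0 gives the full constant.\<close>

lemma crit_strongly_convex:
  assumes lam: "0 \<le> lam" and f: "pr f = f" and min: "\<And>g. pr g = g \<Longrightarrow> crit lam z f \<le> crit lam z g" and g: "pr g = g"
  shows "ip (\<lambda>j. f j - g j) (\<lambda>j. f j - g j) / N \<le> crit lam z g - crit lam z f"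
proof -
  have N: "N > 0" using num_entries_pos by simp
  define q where "q = ip (\<lambda>j. f j - g j) (\<lambda>j. f j - g j) / N"
  have *: "(1 - \<theta>) * q \<le> crit lam z g - crit lam z f" if \<theta>: "0 < \<theta>" "\<theta> < 1" for \<theta> :: real
  proof -
    let ?h = "\<lambda>i. (1 - \<theta>) * f i + \<theta> * g i"
    have "pr ?h = ?h" using f g by (simp add: proj_on_linear)
    then have fh: "crit lam z f \<le> crit lam z ?h" by (rule min)
    have eq: "ip (\<lambda>j. z j - ?h j) (\<lambda>j. z j - ?h j)
       = (1 - \<theta>) * ip (\<lambda>j. z j - f j) (\<lambda>j. z j - f j) + \<theta> * ip (\<lambda>j. z j - g j) (\<lambda>j. z j - g j)
         - \<theta> * (1 - \<theta>) * ip (\<lambda>j. f j - g j) (\<lambda>j. f j - g j)"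
      unfolding inner_on_def sum_distrib_left sum.distrib[symmetric] sum_subtractf[symmetric]
      by (intro sum.cong) (auto simp: algebra_simps)
    have "2 * lam * TV d n k ?h \<le> 2 * lam * ((1 - \<theta>) * TV d n k f + \<theta> * TV d n k g)"
      using TV_convex[of \<theta> f g] \<theta> lam by (intro mult_left_mono) auto
    then have "crit lam z ?h \<le> (1 - \<theta>) * crit lam z f + \<theta> * crit lam z g - \<theta> * (1 - \<theta>) * q"
      unfolding crit_def eq q_def
      by (simp add: algebra_simps add_divide_distrib diff_divide_distrib)
    then have "\<theta> * ((1 - \<theta>) * q) \<le> \<theta> * (crit lam z g - crit lam z f)"
      using fh by (simp add: algebra_simps)
    then show ?thesis using \<theta> by simp
  qed
  have "((\<lambda>\<theta>. (1 - \<theta>) * q) \<longlongrightarrow> (1 - 0) * q) (at_right 0)"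
    by (intro tendsto_intros)
  moreover have "eventually (\<lambda>\<theta>. (1 - \<theta>) * q \<le> crit lam z g - crit lam z f) (at_right 0)"
    unfolding eventually_at_right_field using * by (intro exI[of _ 1]) auto
  ultimately show ?thesis
    using tendsto_upperbound[of "\<lambda>\<theta>. (1 - \<theta>) * q" "(1 - 0) * q" "at_right 0"] by (simp add: q_def)
qed

lemma estimator_strongly_convex:
  assumes "0 \<le> lam" "pr g = g"
  shows "ip (\<lambda>j. est lam Y j - g j) (\<lambda>j. est lam Y j - g j) / N
    \<le> crit lam (pr Y) g - crit lam (pr Y) (est lam Y)"
  using estimator_minimizes[OF assms(1)] assms by (intro crit_strongly_convex) auto

text \<open>Strong convexity is used at both minimizers, each compared with the other. In the sum
  the total variations cancel and an inner product of data with estimates remains. This stability is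
  what makes the loss measurable.\<close>

lemma estimator_Lipschitz:
  assumes "0 \<le> lam"
  shows "ip (\<lambda>j. est lam Y j - est lam Y' j) (\<lambda>j. est lam Y j - est lam Y' j)
    \<le> ip (\<lambda>j. Y j - Y' j) (\<lambda>j. Y j - Y' j)"
proof -
  let ?f = "est lam Y" and ?f' = "est lam Y'"
  have N: "N > 0" using num_entries_pos by simp
  define a where "a = ip (\<lambda>j. ?f j - ?f' j) (\<lambda>j. ?f j - ?f' j)"
  define b where "b = ip (\<lambda>j. Y j - Y' j) (\<lambda>j. Y j - Y' j)"
  have a: "a = ip (\<lambda>j. ?f' j - ?f j) (\<lambda>j. ?f' j - ?f j)"
    unfolding a_def inner_on_def by (intro sum.cong) (auto simp: algebra_simps)
  let ?c = "ip (\<lambda>j. pr Y j - pr Y' j) (\<lambda>j. ?f j - ?f' j)"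
  have 1: "a / N + a / N \<le> (crit lam (pr Y) ?f' - crit lam (pr Y) ?f) + (crit lam (pr Y') ?f - crit lam (pr Y') ?f')"
    using estimator_strongly_convex[OF assms estimator_minimizes(1)[OF assms], of Y Y']
      estimator_strongly_convex[OF assms estimator_minimizes(1)[OF assms], of Y' Y]
    unfolding a_def[symmetric] a[symmetric] by linarith
  have "ip (\<lambda>j. pr Y j - ?f' j) (\<lambda>j. pr Y j - ?f' j) - ip (\<lambda>j. pr Y j - ?f j) (\<lambda>j. pr Y j - ?f j)
    + (ip (\<lambda>j. pr Y' j - ?f j) (\<lambda>j. pr Y' j - ?f j) - ip (\<lambda>j. pr Y' j - ?f' j) (\<lambda>j. pr Y' j - ?f' j)) = 2 * ?c"
    unfolding inner_on_def sum_distrib_left sum.distrib[symmetric] sum_subtractf[symmetric]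
    by (intro sum.cong) (auto simp: algebra_simps)
  from this[symmetric]
  have 2: "(crit lam (pr Y) ?f' - crit lam (pr Y) ?f) + (crit lam (pr Y') ?f - crit lam (pr Y') ?f') = 2 * ?c / N"
    unfolding crit_def by (simp only: diff_divide_distrib add_divide_distrib)
  have 3: "?c \<le> sqrt (ip (\<lambda>j. pr Y j - pr Y' j) (\<lambda>j. pr Y j - pr Y' j)) * sqrt a"
    unfolding a_def by (rule inner_on_le)
  have 4: "sqrt (ip (\<lambda>j. pr Y j - pr Y' j) (\<lambda>j. pr Y j - pr Y' j)) * sqrt a \<le> sqrt b * sqrt a"
    using norm_proj_on_le[OF orthonormal_perp_basis, of "\<lambda>j. Y j - Y' j"]
    by (intro mult_right_mono real_sqrt_le_mono) (auto simp: b_def proj_on_linear a_def inner_on_ge_0)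
  have "(a + a) / N \<le> 2 * ?c / N" using 1 2 by (simp add: add_divide_distrib)
  then have "a + a \<le> 2 * ?c" using N by (simp add: divide_le_cancel)
  then have "a \<le> sqrt b * sqrt a" using 3 4 by linarith
  moreover have "a = sqrt a * sqrt a" by (simp add: a_def inner_on_ge_0)
  ultimately have "sqrt a * sqrt a \<le> sqrt b * sqrt a" by simp
  moreover have "0 \<le> sqrt a" "0 \<le> sqrt b" by (simp_all add: a_def b_def inner_on_ge_0)
  ultimately have "sqrt a \<le> sqrt b"
    using mult_right_le_imp_le[of "sqrt a" "sqrt a" "sqrt b"] by (cases "sqrt a = 0") auto
  then show ?thesis by (simp add: a_def b_def)
qed

end

section \<open>A deterministic oracle inequality\<close>

lemma two_mult_le: "2 * x * y \<le> 2 * x\<^sup>2 + y\<^sup>2 / (2::real)"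
proof -
  have "0 \<le> (2 * x - y)\<^sup>2" by simp
  then show ?thesis by (simp add: power2_eq_square algebra_simps)
qed

context tensor_model
begin

text \<open>The \<psi> j of the overview: the projection does not change the differences of the
  atom.\<close>

definition perp_atom :: "mindex \<Rightarrow> tensor" where
  "perp_atom j = pr (atom d n k j j)"

lemma total_diff_atom: "j \<in> J \<Longrightarrow> j' \<in> J \<Longrightarrow> Dk (atom d n k j j) j' = (if j' = j then 1 else 0)"
  using inner_on_kernel_atom_self[OF _ _ k_ge_1 n_ge_1] by (simp add: total_diff_eq)

text \<open>Both sides lie in the complement and have the same differences.\<close>

lemma synthesis:
  assumes "pr h = h"
  shows "h = (\<lambda>i. \<Sum>j\<in>J. Dk h j * perp_atom j i)"
proof -
  let ?s = "\<lambda>i. \<Sum>j\<in>J. Dk h j * perp_atom j i"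
  let ?r = "\<lambda>i. h i - ?s i"
  have "pr ?s = ?s" by (simp add: proj_on_sum perp_atom_def)
  then have "pr ?r = ?r" using assms by (simp add: proj_on_linear)
  moreover have "Dk ?r j' = 0" if j': "j' \<in> J" for j'
  proof -
    have "Dk ?s j' = (\<Sum>j\<in>J. Dk h j * (if j' = j then 1 else 0))"
      unfolding total_diff_linear(4)[OF j'] using j'
      by (intro sum.cong) (simp_all add: perp_atom_def total_diff_pr total_diff_atom)
    also have "\<dots> = (\<Sum>j\<in>J. if j' = j then Dk h j else 0)" by (intro sum.cong) auto
    also have "\<dots> = Dk h j'" using j' by simp
    finally show ?thesis using j' by (simp add: total_diff_linear)
  qed
  ultimately have "?r = (\<lambda>_. 0)" by (intro pr_eq_0_of_total_diff) auto
  then show ?thesis by (auto simp: fun_eq_iff)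
qed

text \<open>The term \<open>- ip h h / N\<close> comes from strong convexity and is kept as a
  reserve: one half absorbs the projected noise and the other half the bumps, so the approximation
  error keeps the factor 1.\<close>

lemma basic_inequality:
  assumes lam: "0 \<le> lam" and g: "pr g = g" and Y: "\<And>i. i \<in> G \<Longrightarrow> Y i = f0 i + e i"
  defines "f \<equiv> est lam Y"
  defines "h \<equiv> (\<lambda>i. f i - g i)"
  shows "ip (\<lambda>i. f i - pr f0 i) (\<lambda>i. f i - pr f0 i) / N
    \<le> ip (\<lambda>i. g i - pr f0 i) (\<lambda>i. g i - pr f0 i) / N
      + 2 * ip e h / N + 2 * lam * (TV d n k g - TV d n k f)
      - ip h h / N"
proof -
  have prY: "pr Y = (\<lambda>i. pr f0 i + pr e i)"
    unfolding proj_on_linear(1)[symmetric] using Y by (rule proj_on_cong)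
  have f: "pr f = f" unfolding f_def by (rule estimator_minimizes(1)[OF lam])
  have "pr h = h" unfolding h_def using f g by (simp add: proj_on_linear)
  then have eh: "ip e h = ip (pr e) h" using inner_on_proj_swap[of G perp_basis e h] by simp
  have conv: "ip h h / N \<le> crit lam (pr Y) g - crit lam (pr Y) f"
    unfolding h_def f_def by (rule estimator_strongly_convex[OF lam g])
  have "ip (\<lambda>i. pr Y i - g i) (\<lambda>i. pr Y i - g i) - ip (\<lambda>i. pr Y i - f i) (\<lambda>i. pr Y i - f i)
    = ip (\<lambda>i. g i - pr f0 i) (\<lambda>i. g i - pr f0 i) - ip (\<lambda>i. f i - pr f0 i) (\<lambda>i. f i - pr f0 i) + 2 * ip (pr e) h"
    unfolding prY h_def inner_on_def sum_distrib_left sum.distrib[symmetric] sum_subtractf[symmetric]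
    by (intro sum.cong) (auto simp: algebra_simps)
  from arg_cong[OF this, of "\<lambda>x. x / N"] conv show ?thesis
    unfolding crit_def eh by (simp add: diff_divide_distrib add_divide_distrib algebra_simps)
qed

text \<open>Off \<open>S\<close> the triangle inequality is used in the form that keeps a negative
  term in \<open>f - g\<close>; this term later pays for the noise there.\<close>

lemma TV_diff_le:
  assumes "S \<subseteq> J"
  shows "TV d n k g - TV d n k f
    \<le> 2 * (\<Sum>j\<in>J - S. \<bar>Dk g j\<bar>) + (\<Sum>j\<in>S. \<bar>Dk (\<lambda>i. f i - g i) j\<bar>) - (\<Sum>j\<in>J - S. \<bar>Dk (\<lambda>i. f i - g i) j\<bar>)"
proof -
  let ?h = "\<lambda>i. f i - g i"
  have h: "Dk ?h j = Dk f j - Dk g j" if "j \<in> J" for j using that by (rule total_diff_linear)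
  have split: "TV d n k u = (\<Sum>j\<in>J - S. \<bar>Dk u j\<bar>) + (\<Sum>j\<in>S. \<bar>Dk u j\<bar>)" for u
    unfolding TV_def by (rule sum.subset_diff[OF assms finite_J])
  have "(\<Sum>j\<in>J - S. \<bar>Dk g j\<bar>) - (\<Sum>j\<in>J - S. \<bar>Dk f j\<bar>) \<le> (\<Sum>j\<in>J - S. 2 * \<bar>Dk g j\<bar> - \<bar>Dk ?h j\<bar>)"
    unfolding sum_subtractf[symmetric]
  proof (rule sum_mono)
    fix j assume "j \<in> J - S"
    then show "\<bar>Dk g j\<bar> - \<bar>Dk f j\<bar> \<le> 2 * \<bar>Dk g j\<bar> - \<bar>Dk ?h j\<bar>" using h[of j] by auto
  qed
  moreover have "(\<Sum>j\<in>S. \<bar>Dk g j\<bar>) - (\<Sum>j\<in>S. \<bar>Dk f j\<bar>) \<le> (\<Sum>j\<in>S. \<bar>Dk ?h j\<bar>)"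
    unfolding sum_subtractf[symmetric]
  proof (rule sum_mono)
    fix j assume "j \<in> S"
    then show "\<bar>Dk g j\<bar> - \<bar>Dk f j\<bar> \<le> \<bar>Dk ?h j\<bar>" using h[of j] assms by auto
  qed
  ultimately show ?thesis unfolding split by (simp add: sum_subtractf sum_distrib_left)
qed

definition adj :: "tensor \<Rightarrow> tensor" where
  "adj w i = (\<Sum>j\<in>J. w j * diff_kernel d n k j i)"

lemma sum_total_diff_adj: "(\<Sum>j\<in>J. w j * Dk h j) = ip (adj w) h"
proof -
  have "(\<Sum>j\<in>J. w j * Dk h j) = (\<Sum>j\<in>J. \<Sum>i\<in>G. w j * diff_kernel d n k j i * h i)"
    by (intro sum.cong) (auto simp: total_diff_eq inner_on_def sum_distrib_left mult_ac)
  also have "\<dots> = (\<Sum>i\<in>G. \<Sum>j\<in>J. w j * diff_kernel d n k j i * h i)" by (rule sum.swap)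
  finally show ?thesis by (simp add: inner_on_def adj_def sum_distrib_right)
qed

text \<open>The functions \<open>w p\<close> interpolate the signs of the differences on \<open>S\<close>; near \<open>S\<close> the amount by
  which they fall below 1 has to pay for the noise that the projection onto \<open>Q\<close> does not capture.\<close>
lemma oracle_inequality:
  assumes lam: "0 \<le> lam" and Y: "\<And>i. i \<in> G \<Longrightarrow> Y i = f0 i + e i"
    and S: "S \<subseteq> J" and Q: "orthonormal G Q"
    and w_nonneg: "\<And>p j. p \<in> S \<Longrightarrow> 0 \<le> w p j"
    and w_S: "\<And>p p'. p \<in> S \<Longrightarrow> p' \<in> S \<Longrightarrow> w p p' = (if p = p' then 1 else 0)"
    and disj: "\<And>p p' i. p \<in> S \<Longrightarrow> p' \<in> S \<Longrightarrow> p \<noteq> p' \<Longrightarrow> i \<in> G \<Longrightarrow> adj (w p) i * adj (w p') i = 0"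
    and noise: "\<And>j. j \<in> J \<Longrightarrow> \<bar>ip e (\<lambda>i. perp_atom j i - proj_on G Q (perp_atom j) i)\<bar>
        \<le> N * lam * (1 - (\<Sum>p\<in>S. w p j))"
  defines "f \<equiv> est lam Y"
  shows "ip (\<lambda>i. f i - pr f0 i) (\<lambda>i. f i - pr f0 i) / N
    \<le> ip (\<lambda>i. g i - pr f0 i) (\<lambda>i. g i - pr f0 i) / N
      + 4 * lam * (\<Sum>j\<in>J - S. \<bar>Dk g j\<bar>)
      + 2 * (\<Sum>q\<in>Q. (ip e q)\<^sup>2) / N
      + 2 * lam\<^sup>2 * N * (\<Sum>p\<in>S. ip (adj (w p)) (adj (w p)))"
proof -
  have N: "N > 0" using num_entries_pos by simp
  have finS: "finite S" by (rule finite_subset[OF S finite_J])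
  define h where "h = (\<lambda>i. f i - pr g i)"
  define H where "H = ip h h"
  define a where "a j = \<bar>Dk h j\<bar>" for j
  define \<omega> where "\<omega> j = (\<Sum>p\<in>S. w p j)" for j
  define \<Gamma> where "\<Gamma> = (\<Sum>p\<in>S. ip (adj (w p)) (adj (w p)))"
  have H0: "0 \<le> H" by (simp add: H_def inner_on_ge_0)
  have G0: "0 \<le> \<Gamma>" unfolding \<Gamma>_def by (intro sum_nonneg) (rule inner_on_ge_0)
  have f: "pr f = f" unfolding f_def by (rule estimator_minimizes(1)[OF lam])
  have h: "pr h = h" unfolding h_def using f by (simp add: proj_on_linear)
  have "ip e h = ip e (proj_on G Q h) + ip e (\<lambda>i. h i - proj_on G Q h i)"
    by (simp add: inner_on_diff_right)
  have res: "(\<lambda>i. h i - proj_on G Q h i) = (\<lambda>i. \<Sum>j\<in>J. Dk h j * (perp_atom j i - proj_on G Q (perp_atom j) i))"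
  proof -
    have "proj_on G Q h = (\<lambda>i. \<Sum>j\<in>J. Dk h j * proj_on G Q (perp_atom j) i)"
      by (subst (1) synthesis[OF h]) (rule proj_on_sum)
    then show ?thesis
      by (subst (1) synthesis[OF h]) (simp add: right_diff_distrib sum_subtractf)
  qed
  have e1: "ip e (\<lambda>i. h i - proj_on G Q h i) \<le> N * lam * (\<Sum>j\<in>J. a j * (1 - \<omega> j))"
  proof -
    have "ip e (\<lambda>i. h i - proj_on G Q h i) = (\<Sum>j\<in>J. Dk h j * ip e (\<lambda>i. perp_atom j i - proj_on G Q (perp_atom j) i))"
      unfolding res by (rule inner_on_sum_right)
    also have "\<dots> \<le> (\<Sum>j\<in>J. a j * (N * lam * (1 - \<omega> j)))"
    proof (rule sum_mono)
      fix j assume j: "j \<in> J"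
      have "Dk h j * ip e (\<lambda>i. perp_atom j i - proj_on G Q (perp_atom j) i)
        \<le> a j * \<bar>ip e (\<lambda>i. perp_atom j i - proj_on G Q (perp_atom j) i)\<bar>"
        unfolding a_def abs_mult[symmetric] by simp
      also have "\<dots> \<le> a j * (N * lam * (1 - \<omega> j))"
        using noise[OF j] unfolding \<omega>_def[symmetric] by (intro mult_left_mono) (auto simp: a_def)
      finally show "Dk h j * ip e (\<lambda>i. perp_atom j i - proj_on G Q (perp_atom j) i) \<le> a j * (N * lam * (1 - \<omega> j))" .
    qed
    finally show ?thesis by (simp add: sum_distrib_left mult_ac)
  qed
  \<comment> \<open>The first half of the reserve \<open>H\<close> is spent here, on the noise
    captured by \<open>Q\<close>.\<close>
  have e2: "2 * ip e (proj_on G Q h) \<le> 2 * (\<Sum>q\<in>Q. (ip e q)\<^sup>2) + H / 2"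
  proof -
    define x where "x = sqrt (\<Sum>q\<in>Q. (ip e q)\<^sup>2)"
    define y where "y = sqrt H"
    have "ip e (proj_on G Q h) = ip (proj_on G Q e) h" by (rule inner_on_proj_swap[symmetric])
    also have "\<dots> \<le> sqrt (ip (proj_on G Q e) (proj_on G Q e)) * y" unfolding y_def H_def by (rule inner_on_le)
    also have "ip (proj_on G Q e) (proj_on G Q e) = (\<Sum>q\<in>Q. (ip e q)\<^sup>2)"
      unfolding inner_on_proj_proj[OF Q] by (simp add: power2_eq_square)
    finally have "2 * ip e (proj_on G Q h) \<le> 2 * x * y" by (simp add: x_def)
    also have "\<dots> \<le> 2 * x\<^sup>2 + y\<^sup>2 / 2" by (rule two_mult_le)
    finally show ?thesis using H0 by (simp add: x_def y_def sum_nonneg)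
  qed
  define s where "s p = sgn (Dk h p)" for p
  define W where "W j = (\<Sum>p\<in>S. s p * w p j)" for j
  have W_le: "\<bar>W j\<bar> \<le> \<omega> j" for j
    unfolding W_def \<omega>_def
  proof (rule order_trans[OF sum_abs], rule sum_mono)
    fix p assume "p \<in> S"
    then show "\<bar>s p * w p j\<bar> \<le> w p j"
      using w_nonneg[of p j] by (auto simp: s_def abs_mult sgn_if)
  qed
  have W_S: "W p = s p" "\<omega> p = 1" if "p \<in> S" for p
  proof -
    have "W p = (\<Sum>p'\<in>S. if p' = p then s p' else 0)"
      unfolding W_def using that w_S by (intro sum.cong) auto
    then show "W p = s p" using that finS by simp
    have "\<omega> p = (\<Sum>p'\<in>S. if p' = p then 1 else 0)"
      unfolding \<omega>_def using that w_S by (intro sum.cong) auto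
    then show "\<omega> p = 1" using that finS by simp
  qed
  have WD: "(\<Sum>j\<in>S. a j) - (\<Sum>j\<in>J - S. \<omega> j * a j) \<le> (\<Sum>j\<in>J. W j * Dk h j)"
  proof -
    have "(\<Sum>j\<in>J. W j * Dk h j) = (\<Sum>j\<in>J - S. W j * Dk h j) + (\<Sum>j\<in>S. W j * Dk h j)"
      by (rule sum.subset_diff[OF S finite_J])
    moreover have "(\<Sum>j\<in>S. W j * Dk h j) = (\<Sum>j\<in>S. a j)"
      using W_S by (intro sum.cong) (auto simp: s_def a_def sgn_if)
    moreover have "(\<Sum>j\<in>J - S. - (\<omega> j * a j)) \<le> (\<Sum>j\<in>J - S. W j * Dk h j)"
    proof (rule sum_mono)
      fix j
      have "\<bar>W j * Dk h j\<bar> \<le> \<omega> j * a j"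
        unfolding abs_mult a_def using W_le[of j] by (intro mult_right_mono) auto
      then show "- (\<omega> j * a j) \<le> W j * Dk h j" by linarith
    qed
    ultimately show ?thesis by (simp add: sum_negf)
  qed
  have adjW: "adj W i = (\<Sum>p\<in>S. s p * adj (w p) i)" for i
    unfolding adj_def W_def sum_distrib_right sum_distrib_left
    by (subst sum.swap) (simp add: mult_ac)
  \<comment> \<open>The supports of the adjoint differences are disjoint, so the cross terms vanish
    and the energies add up.\<close>
  have W2: "ip (adj W) (adj W) \<le> \<Gamma>"
  proof -
    have "adj W i * adj W i \<le> (\<Sum>p\<in>S. adj (w p) i * adj (w p) i)" if i: "i \<in> G" for i
    proof -
      have "adj W i * adj W i = (\<Sum>p\<in>S. \<Sum>p'\<in>S. (s p * adj (w p) i) * (s p' * adj (w p') i))"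
        unfolding adjW by (rule sum_product)
      also have "\<dots> = (\<Sum>p\<in>S. \<Sum>p'\<in>S. if p' = p then (s p * adj (w p) i) * (s p * adj (w p) i) else 0)"
      proof (intro sum.cong refl)
        fix p p' assume "p \<in> S" "p' \<in> S"
        then show "(s p * adj (w p) i) * (s p' * adj (w p') i)
          = (if p' = p then (s p * adj (w p) i) * (s p * adj (w p) i) else 0)"
          using disj[of p p' i] i by auto
      qed
      also have "\<dots> = (\<Sum>p\<in>S. (s p * adj (w p) i) * (s p * adj (w p) i))" using finS by simp
      also have "\<dots> \<le> (\<Sum>p\<in>S. adj (w p) i * adj (w p) i)"
        by (intro sum_mono) (auto simp: s_def sgn_if)
      finally show ?thesis .
    qed
    then have "ip (adj W) (adj W) \<le> (\<Sum>i\<in>G. \<Sum>p\<in>S. adj (w p) i * adj (w p) i)"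
      unfolding inner_on_def by (intro sum_mono) auto
    also have "\<dots> = \<Gamma>" unfolding \<Gamma>_def inner_on_def by (rule sum.swap)
    finally show ?thesis .
  qed
  \<comment> \<open>The second half of the reserve is spent on the interpolant.\<close>
  have e3: "2 * lam * (\<Sum>j\<in>J. W j * Dk h j) \<le> 2 * lam\<^sup>2 * N * \<Gamma> + H / N / 2"
  proof -
    define x where "x = lam * sqrt (N * \<Gamma>)"
    define y where "y = sqrt (H / N)"
    have "(\<Sum>j\<in>J. W j * Dk h j) \<le> sqrt (ip (adj W) (adj W)) * sqrt H"
      unfolding sum_total_diff_adj H_def by (rule inner_on_le)
    also have "\<dots> \<le> sqrt \<Gamma> * sqrt H" using W2 H0 by (intro mult_right_mono) auto
    also have "\<dots> = sqrt (N * \<Gamma>) * y" using N by (simp add: y_def real_sqrt_mult real_sqrt_divide)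
    finally have "2 * lam * (\<Sum>j\<in>J. W j * Dk h j) \<le> 2 * lam * (sqrt (N * \<Gamma>) * y)"
      using lam by (intro mult_left_mono) auto
    also have "\<dots> = 2 * x * y" by (simp add: x_def)
    also have "\<dots> \<le> 2 * x\<^sup>2 + y\<^sup>2 / 2" by (rule two_mult_le)
    finally show ?thesis using N G0 H0 by (simp add: x_def y_def power_mult_distrib)
  qed
  have TVd: "TV d n k (pr g) - TV d n k f \<le> 2 * (\<Sum>j\<in>J - S. \<bar>Dk g j\<bar>) + (\<Sum>j\<in>S. a j) - (\<Sum>j\<in>J - S. a j)"
    using TV_diff_le[OF S, of "pr g" f] unfolding h_def[symmetric] a_def[symmetric]
    by (simp add: total_diff_pr)
  \<comment> \<open>The noise brings the deficits 1 - \<omega>, the penalty the sign -1 off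
    \<open>S\<close> and +1 on \<open>S\<close>. Together this leaves the weight 1 on
    \<open>S\<close> and -\<omega> off \<open>S\<close>, which is the lower bound for the pairing
    with \<open>W\<close>.\<close>
  have comb: "(\<Sum>j\<in>J. a j * (1 - \<omega> j)) + ((\<Sum>j\<in>S. a j) - (\<Sum>j\<in>J - S. a j)) \<le> (\<Sum>j\<in>J. W j * Dk h j)"
  proof -
    have "(\<Sum>j\<in>J. a j * (1 - \<omega> j)) = (\<Sum>j\<in>J - S. a j * (1 - \<omega> j)) + (\<Sum>j\<in>S. a j * (1 - \<omega> j))"
      by (rule sum.subset_diff[OF S finite_J])
    moreover have "(\<Sum>j\<in>S. a j * (1 - \<omega> j)) = 0" using W_S by (intro sum.neutral) auto
    moreover have "(\<Sum>j\<in>J - S. a j * (1 - \<omega> j)) = (\<Sum>j\<in>J - S. a j) - (\<Sum>j\<in>J - S. \<omega> j * a j)"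
      by (simp add: algebra_simps sum_subtractf)
    ultimately show ?thesis using WD by linarith
  qed
  have basic: "ip (\<lambda>i. f i - pr f0 i) (\<lambda>i. f i - pr f0 i) / N
    \<le> ip (\<lambda>i. pr g i - pr f0 i) (\<lambda>i. pr g i - pr f0 i) / N
      + 2 * ip e h / N + 2 * lam * (TV d n k (pr g) - TV d n k f) - H / N"
    unfolding h_def f_def H_def by (rule basic_inequality[OF lam pr_idem Y])
  have gle: "ip (\<lambda>i. pr g i - pr f0 i) (\<lambda>i. pr g i - pr f0 i) / N \<le> ip (\<lambda>i. g i - pr f0 i) (\<lambda>i. g i - pr f0 i) / N"
    using norm_proj_on_le[OF orthonormal_perp_basis, of "\<lambda>i. g i - pr f0 i"] N
    by (intro divide_right_mono) (auto simp: proj_on_linear)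
  have "2 * ip e h \<le> (2 * (\<Sum>q\<in>Q. (ip e q)\<^sup>2) + H / 2) + 2 * (N * lam * (\<Sum>j\<in>J. a j * (1 - \<omega> j)))"
    using e1 e2 by (simp add: inner_on_diff_right)
  then have "2 * ip e h / N \<le> ((2 * (\<Sum>q\<in>Q. (ip e q)\<^sup>2) + H / 2) + 2 * (N * lam * (\<Sum>j\<in>J. a j * (1 - \<omega> j)))) / N"
    using N by (intro divide_right_mono) auto
  also have "\<dots> = 2 * (\<Sum>q\<in>Q. (ip e q)\<^sup>2) / N + H / N / 2 + 2 * lam * (\<Sum>j\<in>J. a j * (1 - \<omega> j))"
    using N by (simp add: add_divide_distrib)
  finally have E: "2 * ip e h / N \<le> 2 * (\<Sum>q\<in>Q. (ip e q)\<^sup>2) / N + H / N / 2 + 2 * lam * (\<Sum>j\<in>J. a j * (1 - \<omega> j))" .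
  have "2 * lam * (TV d n k (pr g) - TV d n k f)
    \<le> 2 * lam * (2 * (\<Sum>j\<in>J - S. \<bar>Dk g j\<bar>) + (\<Sum>j\<in>S. a j) - (\<Sum>j\<in>J - S. a j))"
    using TVd lam by (intro mult_left_mono) auto
  then have T: "2 * lam * (TV d n k (pr g) - TV d n k f)
    \<le> 4 * lam * (\<Sum>j\<in>J - S. \<bar>Dk g j\<bar>) + 2 * lam * ((\<Sum>j\<in>S. a j) - (\<Sum>j\<in>J - S. a j))"
    by (simp add: algebra_simps)
  have "2 * lam * ((\<Sum>j\<in>J. a j * (1 - \<omega> j)) + ((\<Sum>j\<in>S. a j) - (\<Sum>j\<in>J - S. a j))) \<le> 2 * lam * (\<Sum>j\<in>J. W j * Dk h j)"
    using comb lam by (intro mult_left_mono) auto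
  then have C: "2 * lam * (\<Sum>j\<in>J. a j * (1 - \<omega> j)) + 2 * lam * ((\<Sum>j\<in>S. a j) - (\<Sum>j\<in>J - S. a j))
    \<le> 2 * lam\<^sup>2 * N * \<Gamma> + H / N / 2"
    using e3 unfolding distrib_left by linarith
  show ?thesis
    using basic gle E T C unfolding \<Gamma>_def[symmetric] by linarith
qed

end

section \<open>Tensor product bumps\<close>

context tensor_model
begin

definition bump_factor :: "(nat \<Rightarrow> nat) \<Rightarrow> nat \<Rightarrow> nat \<Rightarrow> int \<Rightarrow> real" where
  "bump_factor M c c' = (if c' = c then mixed_bump k (M c') else bump k (M c'))"

text \<open>Using the rougher profile in one coordinate at a time makes the logarithms add up
  instead of multiplying.\<close>
definition tensor_bump :: "(nat \<Rightarrow> nat) \<Rightarrow> mindex \<Rightarrow> tensor" where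
  "tensor_bump M p j = (\<Sum>c=1..d. \<Prod>c'=1..d. bump_factor M c c' (int (j c') - int (p c'))) / real d"

context
  fixes M :: "nat \<Rightarrow> nat"
  assumes M: "\<And>c. c \<in> {1..d} \<Longrightarrow> 1 \<le> M c" and d: "1 \<le> d"
begin

lemma bump_factor_bounds: "c' \<in> {1..d} \<Longrightarrow> 0 \<le> bump_factor M c c' y \<and> bump_factor M c c' y \<le> 1"
  unfolding bump_factor_def using M[of c'] bump_bounds[of "M c'" k y] mixed_bump_bounds[OF k_ge_1, of "M c'" y]
  by (cases "c' = c") simp_all

lemma bump_factor_0: "c' \<in> {1..d} \<Longrightarrow> bump_factor M c c' 0 = 1"
  unfolding bump_factor_def using M[of c'] by (cases "c' = c") (simp_all add: bump_0 mixed_bump_0[OF k_ge_1])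

lemma bump_factor_eq_0: "c' \<in> {1..d} \<Longrightarrow> int (k * (M c' - 1)) < \<bar>y\<bar> \<Longrightarrow> bump_factor M c c' y = 0"
  unfolding bump_factor_def using M[of c'] bump_eq_0[of "M c'" k y] mixed_bump_eq_0[of k "M c'" y]
  by (cases "c' = c") simp_all

lemma sdiff_bump_factor_eq_0: "c' \<in> {1..d} \<Longrightarrow> int (k * M c') < \<bar>y\<bar> \<Longrightarrow> sdiff 1 k (bump_factor M c c') y = 0"
  unfolding bump_factor_def using M[of c'] sdiff_bump_eq_0[of "M c'" k y] sdiff_mixed_bump_eq_0[of "M c'" k y]
  by (cases "c' = c") simp_all

lemma tensor_bump_nonneg: "0 \<le> tensor_bump M p j"
  unfolding tensor_bump_def using bump_factor_bounds
  by (intro divide_nonneg_nonneg sum_nonneg prod_nonneg) auto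

lemma tensor_bump_self: "tensor_bump M p p = 1"
proof -
  have "(\<Sum>c=1..d. \<Prod>c'=1..d. bump_factor M c c' (int (p c') - int (p c'))) = (\<Sum>c=1..d. 1)"
    by (intro sum.cong refl prod.neutral) (auto simp: bump_factor_0)
  then show ?thesis unfolding tensor_bump_def using d by simp
qed

lemma tensor_bump_eq_0:
  assumes "c' \<in> {1..d}" "int (k * (M c' - 1)) < \<bar>int (j c') - int (p c')\<bar>"
  shows "tensor_bump M p j = 0"
proof -
  have z: "(\<Prod>c'=1..d. bump_factor M c c' (int (j c') - int (p c'))) = 0" for c
    using assms(1) bump_factor_eq_0[OF assms] by (intro prod_zero bexI[of _ c']) auto
  show ?thesis unfolding tensor_bump_def z by simp
qed

text \<open>In the summand of coordinate \<open>c\<close> only the mixed factor is used, the others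
  being at most 1. The average over \<open>c\<close> costs the factor 1 / d, which is why the lower
  bound on \<open>lam\<close> contains \<open>real d\<close>.\<close>

lemma tensor_bump_le:
  assumes "\<And>c. c \<in> {1..d} \<Longrightarrow> \<bar>int (j c) - int (p c)\<bar> \<le> int (k * (M c - 1))"
  shows "tensor_bump M p j
    \<le> 1 - (\<Sum>c=1..d. sqrt ((\<bar>real (j c) - real (p c)\<bar> / (real k * real (M c))) ^ (2 * k - 1))) / real d"
proof -
  have "(\<Sum>c=1..d. \<Prod>c'=1..d. bump_factor M c c' (int (j c') - int (p c')))
    \<le> (\<Sum>c=1..d. 1 - sqrt ((\<bar>real (j c) - real (p c)\<bar> / (real k * real (M c))) ^ (2 * k - 1)))"
  proof (rule sum_mono)
    fix c assume c: "c \<in> {1..d}"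
    let ?F = "\<lambda>c'. bump_factor M c c' (int (j c') - int (p c'))"
    have "(\<Prod>c'=1..d. ?F c') = ?F c * (\<Prod>c'\<in>{1..d} - {c}. ?F c')"
      using c by (intro prod.remove) auto
    also have "\<dots> \<le> ?F c * 1"
      using bump_factor_bounds c by (intro mult_left_mono prod_le_1) auto
    also have "?F c * 1 = mixed_bump k (M c) (int (j c) - int (p c))" by (simp add: bump_factor_def)
    also have "\<dots> \<le> 1 - sqrt ((\<bar>of_int (int (j c) - int (p c))\<bar> / (real k * real (M c))) ^ (2 * k - 1))"
      using c by (intro mixed_bump_le k_ge_1 M assms)
    finally show "(\<Prod>c'=1..d. ?F c') \<le> 1 - sqrt ((\<bar>real (j c) - real (p c)\<bar> / (real k * real (M c))) ^ (2 * k - 1))"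
      by simp
  qed
  also have "\<dots> = real d - (\<Sum>c=1..d. sqrt ((\<bar>real (j c) - real (p c)\<bar> / (real k * real (M c))) ^ (2 * k - 1)))"
    by (simp add: sum_subtractf)
  finally show ?thesis
    unfolding tensor_bump_def using d by (simp add: divide_le_eq left_diff_distrib)
qed

text \<open>The condition on \<open>p\<close> keeps the support of every factor within the
  difference range, so each coordinate contributes a forward difference without boundary
  terms.\<close>

lemma adj_tensor_bump:
  assumes p: "\<forall>c\<in>{1..d}. int (k + 1) \<le> int (p c) - int (k * M c) \<and> int (p c) + int (k * M c) \<le> int (n c)"
    and i: "i \<in> G"
  shows "adj (tensor_bump M p) i
    = (\<Sum>c=1..d. \<Prod>c'=1..d. real (n c') ^ (k - 1) * sdiff 1 k (bump_factor M c c') (int (i c') - int (p c'))) / real d"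
proof -
  let ?F = "\<lambda>c c' y. bump_factor M c c' (y - int (p c'))"
  have fac: "(\<Sum>y=k + 1..n c'. ?F c c' (int y) * diff_coeff k (n c') y (i c'))
     = real (n c') ^ (k - 1) * sdiff 1 k (bump_factor M c c') (int (i c') - int (p c'))"
    if c': "c' \<in> {1..d}" for c c'
  proof -
    have ic: "i c' \<in> {1..n c'}" using i c' by (auto simp: grid_def hyperrect_def)
    have supp: "int (k + 1) \<le> y \<and> y \<le> int (n c')" if "?F c c' y \<noteq> 0" for y
    proof -
      have "\<bar>y - int (p c')\<bar> \<le> int (k * (M c' - 1))"
        using that bump_factor_eq_0[OF c', of "y - int (p c')" c] by (auto simp: not_less[symmetric])
      moreover have "int (k * (M c' - 1)) \<le> int (k * M c')" unfolding of_nat_le_iff by (intro mult_le_mono2) simp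
      ultimately show ?thesis using bspec[OF p c'] by linarith
    qed
    have "(\<Sum>y=k + 1..n c'. ?F c c' (int y) * diff_coeff k (n c') y (i c'))
      = (\<Sum>y=k + 1..n c'. diff_coeff k (n c') y (i c') * ?F c c' (int y))"
      by (simp add: mult.commute)
    also have "\<dots> = real (n c') ^ (k - 1) * sdiff 1 k (?F c c') (int (i c'))"
      using supp ic by (rule sum_diff_coeff_adjoint)
    finally show ?thesis by (simp only: sdiff_shift)
  qed
  have "adj (tensor_bump M p) i = (\<Sum>j\<in>J. \<Sum>c=1..d. (\<Prod>c'=1..d. ?F c c' (int (j c'))) * diff_kernel d n k j i) / real d"
    unfolding adj_def tensor_bump_def by (simp add: sum_divide_distrib sum_distrib_right)
  also have "(\<Sum>j\<in>J. \<Sum>c=1..d. (\<Prod>c'=1..d. ?F c c' (int (j c'))) * diff_kernel d n k j i)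
    = (\<Sum>c=1..d. \<Sum>j\<in>J. \<Prod>c'=1..d. ?F c c' (int (j c')) * diff_coeff k (n c') (j c') (i c'))"
    by (subst sum.swap) (simp add: diff_kernel_def prod.distrib)
  also have "\<dots> = (\<Sum>c=1..d. \<Prod>c'=1..d. \<Sum>y=k + 1..n c'. ?F c c' (int y) * diff_coeff k (n c') y (i c'))"
    unfolding diff_grid_def hyperrect_def by (subst prod_sum_PiE) auto
  also have "\<dots> = (\<Sum>c=1..d. \<Prod>c'=1..d. real (n c') ^ (k - 1) * sdiff 1 k (bump_factor M c c') (int (i c') - int (p c')))"
    by (intro sum.cong prod.cong refl fac)
  finally show ?thesis .
qed

lemma adj_tensor_bump_eq_0:
  assumes p: "\<forall>c\<in>{1..d}. int (k + 1) \<le> int (p c) - int (k * M c) \<and> int (p c) + int (k * M c) \<le> int (n c)"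
    and i: "i \<in> G" and c': "c' \<in> {1..d}" "int (k * M c') < \<bar>int (i c') - int (p c')\<bar>"
  shows "adj (tensor_bump M p) i = 0"
proof -
  have z: "(\<Prod>c'=1..d. real (n c') ^ (k - 1) * sdiff 1 k (bump_factor M c c') (int (i c') - int (p c'))) = 0" for c
    using c'(1) sdiff_bump_factor_eq_0[OF c'] by (intro prod_zero bexI[of _ c']) auto
  show ?thesis unfolding adj_tensor_bump[OF p i] z by simp
qed

text \<open>Each summand has a single mixed factor and so a single logarithm. The factor
  \<open>N\<close> adds one power of each side length to the 2k - 2 powers from the differences,
  matching the exponent 2k - 1 of the widths.\<close>

lemma norm_adj_tensor_bump_le:
  assumes p: "\<forall>c\<in>{1..d}. int (k + 1) \<le> int (p c) - int (k * M c) \<and> int (p c) + int (k * M c) \<le> int (n c)"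
    and Kb: "energy_bound k Kb"
  shows "N * ip (adj (tensor_bump M p)) (adj (tensor_bump M p))
    \<le> Kb ^ d * (\<Prod>c=1..d. (real (n c) / real (M c)) ^ (2 * k - 1)) * (\<Sum>c=1..d. ln (exp 1 * real (M c)))"
proof -
  define u where "u c c' y = real (n c') ^ (k - 1) * sdiff 1 k (bump_factor M c c') (int y - int (p c'))" for c c' y
  define b where "b c c' = Kb * (if c' = c then ln (exp 1 * real (M c')) else 1) / real (M c') ^ (2 * k - 1)" for c c'
  have Nprod: "N = (\<Prod>c=1..d. real (n c))" by (simp add: num_entries_def)
  have lnM: "0 \<le> ln (exp 1 * real (M c))" if "c \<in> {1..d}" for c
    using M[OF that] by (simp add: ln_mult)
  have sq: "(adj (tensor_bump M p) i)\<^sup>2 \<le> (\<Sum>c=1..d. (\<Prod>c'=1..d. u c c' (i c'))\<^sup>2)" if i: "i \<in> G" for i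
  proof -
    have "(\<Sum>c=1..d. \<Prod>c'=1..d. u c c' (i c'))\<^sup>2 \<le> real d * (\<Sum>c=1..d. (\<Prod>c'=1..d. u c c' (i c'))\<^sup>2)"
      using Cauchy_Schwarz_ineq_sum[of "\<lambda>_. 1" "\<lambda>c. \<Prod>c'=1..d. u c c' (i c')" "{1..d}"] by simp
    \<comment> \<open>The loss of Cauchy-Schwarz is rounded up to the square of \<open>d\<close>,
      which cancels against the average in \<open>tensor_bump\<close>.\<close>
    also have "\<dots> \<le> (real d)\<^sup>2 * (\<Sum>c=1..d. (\<Prod>c'=1..d. u c c' (i c'))\<^sup>2)"
      using d by (intro mult_right_mono sum_nonneg) (auto simp: power2_eq_square)
    finally show ?thesis
      unfolding adj_tensor_bump[OF p i] u_def[symmetric] power_divide using d by (simp add: divide_le_eq mult.commute)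
  qed
  have one: "(\<Sum>y=1..n c'. (u c c' y)\<^sup>2) \<le> real (n c') ^ (2 * (k - 1)) * b c c'" if c': "c' \<in> {1..d}" for c c'
  proof -
    let ?X = "(\<lambda>y. int y - int (p c')) ` {1..n c'}"
    have "(\<Sum>y=1..n c'. (u c c' y)\<^sup>2) = real (n c') ^ (2 * (k - 1)) * (\<Sum>y=1..n c'. (sdiff 1 k (bump_factor M c c') (int y - int (p c')))\<^sup>2)"
      unfolding u_def power_mult_distrib power_even_eq sum_distrib_left ..
    also have "(\<Sum>y=1..n c'. (sdiff 1 k (bump_factor M c c') (int y - int (p c')))\<^sup>2) = (\<Sum>x\<in>?X. (sdiff 1 k (bump_factor M c c') x)\<^sup>2)"
      by (subst sum.reindex) (auto simp: inj_on_def)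
    also have "\<dots> \<le> b c c'"
      using energy_boundD(2,3)[OF Kb M[OF c'], of ?X] by (cases "c' = c") (simp_all add: bump_factor_def b_def)
    finally show ?thesis by (simp add: mult_left_mono)
  qed
  have "ip (adj (tensor_bump M p)) (adj (tensor_bump M p)) \<le> (\<Sum>i\<in>G. \<Sum>c=1..d. (\<Prod>c'=1..d. u c c' (i c'))\<^sup>2)"
    unfolding inner_on_def using sq by (intro sum_mono) (simp add: power2_eq_square)
  also have "\<dots> = (\<Sum>c=1..d. \<Sum>i\<in>G. \<Prod>c'=1..d. (u c c' (i c'))\<^sup>2)"
    by (subst sum.swap) (simp add: prod_power_distrib)
  also have "\<dots> = (\<Sum>c=1..d. \<Prod>c'=1..d. \<Sum>y=1..n c'. (u c c' y)\<^sup>2)"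
    unfolding grid_def hyperrect_def by (subst prod_sum_PiE) auto
  also have "\<dots> \<le> (\<Sum>c=1..d. \<Prod>c'=1..d. real (n c') ^ (2 * (k - 1)) * b c c')"
    using one by (intro sum_mono prod_mono) (auto intro: sum_nonneg)
  finally have "N * ip (adj (tensor_bump M p)) (adj (tensor_bump M p))
     \<le> N * (\<Sum>c=1..d. \<Prod>c'=1..d. real (n c') ^ (2 * (k - 1)) * b c c')"
    by (intro mult_left_mono) auto
  also have "\<dots> = (\<Sum>c=1..d. \<Prod>c'=1..d. Kb * (real (n c') / real (M c')) ^ (2 * k - 1) * (if c' = c then ln (exp 1 * real (M c')) else 1))"
    unfolding sum_distrib_left Nprod prod.distrib[symmetric]
  proof (intro sum.cong prod.cong refl)
    fix c c' assume "c' \<in> {1..d}"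
    have "2 * k - 1 = Suc (2 * (k - 1))" using k_ge_1 by simp
    then have "real (n c') ^ (2 * k - 1) = real (n c') * real (n c') ^ (2 * (k - 1))" by (simp only: power_Suc)
    then show "real (n c') * (real (n c') ^ (2 * (k - 1)) * b c c')
      = Kb * (real (n c') / real (M c')) ^ (2 * k - 1) * (if c' = c then ln (exp 1 * real (M c')) else 1)"
      unfolding b_def power_divide by (simp add: mult_ac)
  qed
  also have "\<dots> = (\<Sum>c=1..d. Kb ^ d * (\<Prod>c=1..d. (real (n c) / real (M c)) ^ (2 * k - 1)) * ln (exp 1 * real (M c)))"
    by (intro sum.cong refl) (simp add: prod.distrib)
  finally show ?thesis by (simp add: sum_distrib_left)
qed

end

end

section \<open>Tessellations and active sets\<close>

text \<open>Rounding x / m to a positive integer. The bound in the second part can fail only for the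
  value 1, and that case is treated separately where it occurs.\<close>

lemma div_bounds:
  fixes m x :: nat
  assumes "1 \<le> m"
  shows "x < 2 * m * max 1 (x div m)" and "max 1 (x div m) \<ge> 2 \<Longrightarrow> m * max 1 (x div m) \<le> x"
proof -
  have "x < m * (x div m + 1)" using assms dividend_less_times_div[of m x] by simp
  also have "\<dots> \<le> m * (2 * max 1 (x div m))" by (intro mult_le_mono2) simp
  finally show "x < 2 * m * max 1 (x div m)" by (simp add: mult_ac)
  assume "max 1 (x div m) \<ge> 2"
  then have "max 1 (x div m) = x div m" by simp
  then show "m * max 1 (x div m) \<le> x" by simp
qed

context tensor_model
begin

definition min_dist :: "(mindex \<Rightarrow> mindex) \<Rightarrow> (mindex \<Rightarrow> mindex) \<Rightarrow> mindex \<Rightarrow> nat \<Rightarrow> nat" where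
  "min_dist lo hi p c = min (side_dist k lo hi p c Minus) (side_dist k lo hi p c Plus)"

definition volume_sum :: "(mindex \<Rightarrow> mindex) \<Rightarrow> (mindex \<Rightarrow> mindex) \<Rightarrow> mindex \<Rightarrow> real" where
  "volume_sum lo hi p = (\<Sum>z\<in>PiE {1..d} (\<lambda>_. {Minus, Plus}).
     (N / real (side_volume d k lo hi p z)) ^ (2 * k - 1))"

end

locale tessellated_model = tensor_model d n k for d n k +
  fixes S :: "mindex set" and lo hi :: "mindex \<Rightarrow> mindex"
  assumes S_ext: "S \<subseteq> hyperrect d (\<lambda>i. k + 1 + (k + 2) * k) (\<lambda>i. n i + 1 - k - (k + 2) * k)"
    and tess: "is_tessellation d n k S lo hi"
    and side: "\<forall>p\<in>S. \<forall>i\<in>{1..d}. (k + 2) * k \<le> min (side_dist k lo hi p i Minus) (side_dist k lo hi p i Plus)"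
    and d_ge_1: "1 \<le> d"
begin

abbreviation "\<delta> \<equiv> min_dist lo hi"
abbreviation "D \<equiv> d_max k S lo hi"

lemma cells_subset: "p \<in> S \<Longrightarrow> hyperrect d (lo p) (hi p) \<subseteq> J"
  using tess unfolding is_tessellation_def by blast

lemma cell_cover: "j \<in> J \<Longrightarrow> \<exists>p\<in>S. j \<in> hyperrect d (lo p) (hi p)"
  using tess unfolding is_tessellation_def by blast

lemma interior_cells:
  assumes "p \<in> S" "p' \<in> S" "j \<in> hyperrect_interior d (lo p) (hi p)" "j \<in> hyperrect_interior d (lo p') (hi p')"
  shows "p = p'"
proof (rule ccontr)
  assume "p \<noteq> p'"
  then have "hyperrect_interior d (lo p) (hi p) \<inter> hyperrect d (lo p') (hi p') = {}"
    using tess assms(1,2) unfolding is_tessellation_def by blast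
  moreover have "hyperrect_interior d (lo p') (hi p') \<subseteq> hyperrect d (lo p') (hi p')"
    unfolding hyperrect_def hyperrect_interior_def by (intro PiE_mono) auto
  ultimately show False using assms(3,4) by blast
qed

lemma S_in_interior:
  assumes "p \<in> S"
  shows "hyperrect d p (\<lambda>i. p i + k - 1) \<subseteq> hyperrect_interior d (lo p) (hi p)"
  using tess assms unfolding is_tessellation_def by blast

lemma p_ext: "p \<in> S \<Longrightarrow> p \<in> extensional {1..d}"
  using S_ext unfolding hyperrect_def PiE_def by blast

lemma p_interior: "p \<in> S \<Longrightarrow> p \<in> hyperrect_interior d (lo p) (hi p)"
proof -
  assume p: "p \<in> S"
  have "p \<in> hyperrect d p (\<lambda>i. p i + k - 1)"
    using p_ext[OF p] k_ge_1 unfolding hyperrect_def PiE_def by auto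
  then show ?thesis using S_in_interior[OF p] by blast
qed

lemma interior_subset: "hyperrect_interior d a b \<subseteq> hyperrect d a b"
  unfolding hyperrect_def hyperrect_interior_def by (intro PiE_mono) auto

lemma S_subset: "S \<subseteq> J"
  using p_interior cells_subset interior_subset by blast

lemma finite_S: "finite S"
  by (rule finite_subset[OF S_subset finite_J])

lemma cell_geometry:
  assumes p: "p \<in> S" and c: "c \<in> {1..d}"
  shows "k + 1 \<le> lo p c" "lo p c + \<delta> p c \<le> p c" "p c + k + \<delta> p c \<le> hi p c + 1" "hi p c \<le> n c"
    "k < \<delta> p c" "\<delta> p c \<le> D c" "hi p c \<le> lo p c + 3 * D c" "\<delta> p c \<le> n c"
proof -
  have int: "lo p i < p i" "p i + k - 1 < hi p i" if i: "i \<in> {1..d}" for i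
  proof -
    show "lo p i < p i" using p_interior[OF p] i unfolding hyperrect_interior_def by auto
    \<comment> \<open>The far corner of the block of \<open>p\<close>, restricted because members of
      \<open>hyperrect\<close> are extensional.\<close>
    have "restrict (\<lambda>i. p i + k - 1) {1..d} \<in> hyperrect d p (\<lambda>i. p i + k - 1)"
      using k_ge_1 unfolding hyperrect_def by auto
    then have "restrict (\<lambda>i. p i + k - 1) {1..d} \<in> hyperrect_interior d (lo p) (hi p)"
      using S_in_interior[OF p] by blast
    then show "p i + k - 1 < hi p i" using i unfolding hyperrect_interior_def by (auto dest: PiE_mem)
  qed
  have le: "lo p i \<le> hi p i" if "i \<in> {1..d}" for i using int[OF that] by linarith
  have "restrict (lo p) {1..d} \<in> hyperrect d (lo p) (hi p)" "restrict (hi p) {1..d} \<in> hyperrect d (lo p) (hi p)"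
    using le unfolding hyperrect_def by auto
  then have J: "restrict (lo p) {1..d} \<in> J" "restrict (hi p) {1..d} \<in> J" using cells_subset[OF p] by blast+
  show lo: "k + 1 \<le> lo p c" using J(1) c unfolding diff_grid_def hyperrect_def by (auto dest: PiE_mem)
  show hi: "hi p c \<le> n c" using J(2) c unfolding diff_grid_def hyperrect_def by (auto dest: PiE_mem)
  have dist: "\<delta> p c = min (p c - lo p c) (hi p c + 1 - (p c + k))" by (simp add: min_dist_def)
  show 2: "lo p c + \<delta> p c \<le> p c" and 3: "p c + k + \<delta> p c \<le> hi p c + 1"
    unfolding dist using int[OF c] by linarith+
  have "k * 1 < (k + 2) * k" using k_ge_1 by (simp add: algebra_simps)
  also have "\<dots> \<le> \<delta> p c" using side p c unfolding min_dist_def by blast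
  finally show 5: "k < \<delta> p c" by simp
  have mx: "max (side_dist k lo hi p c Minus) (side_dist k lo hi p c Plus) \<le> D c"
    unfolding d_max_def using finite_S p by (intro Max_ge) auto
  then show 6: "\<delta> p c \<le> D c" unfolding min_dist_def by linarith
  have "p c - lo p c \<le> D c" "hi p c + 1 - (p c + k) \<le> D c" using mx by auto
  \<comment> \<open>The length is made of the two side distances and k - 1 further steps, and k is
    below \<open>D c\<close>.\<close>
  then show "hi p c \<le> lo p c + 3 * D c" using 5 6 int[OF c] by linarith
  show "\<delta> p c \<le> n c" using 2 3 hi by linarith
qed

text \<open>Of all corners \<open>z\<close> only the one with the shorter side in every coordinate
  is kept.\<close>

lemma volume_sum_ge:
  assumes p: "p \<in> S"
  shows "(\<Prod>c=1..d. (real (n c) / real (\<delta> p c)) ^ (2 * k - 1)) \<le> volume_sum lo hi p"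
proof -
  define z where "z = restrict (\<lambda>c. if side_dist k lo hi p c Minus \<le> side_dist k lo hi p c Plus then Minus else Plus) {1..d}"
  have z: "z \<in> PiE {1..d} (\<lambda>_. {Minus, Plus})" by (auto simp: z_def)
  have "side_dist k lo hi p c (z c) = \<delta> p c" if "c \<in> {1..d}" for c
    using that by (simp add: z_def min_dist_def)
  then have vol: "side_volume d k lo hi p z = (\<Prod>c=1..d. \<delta> p c)"
    unfolding side_volume_def by (intro prod.cong) auto
  have "(\<Prod>c=1..d. (real (n c) / real (\<delta> p c)) ^ (2 * k - 1))
     = (N / real (side_volume d k lo hi p z)) ^ (2 * k - 1)"
    unfolding vol num_entries_def by (simp only: of_nat_prod prod_dividef[symmetric] prod_power_distrib)
  also have "\<dots> \<le> volume_sum lo hi p"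
    unfolding volume_sum_def using z by (intro member_le_sum) (auto intro!: finite_PiE)
  finally show ?thesis .
qed

text \<open>Every ratio n c / \<delta> p c is at least 1, so all but one may be dropped. One
  coordinate is enough, since \<open>radius\<close> contains the inverse of its ratio.\<close>

lemma volume_sum_ge_1:
  assumes p: "p \<in> S"
  shows "(real (n 1) / real (D 1)) ^ (2 * k - 1) \<le> volume_sum lo hi p"
proof -
  have 1: "1 \<in> {1..d}" using d_ge_1 by simp
  note g = cell_geometry[OF p]
  have ge1: "1 \<le> (real (n c) / real (\<delta> p c)) ^ (2 * k - 1)" if "c \<in> {1..d}" for c
    using g(5,8)[OF that] by (intro one_le_power) (simp add: le_divide_eq)
  have "(real (n 1) / real (D 1)) ^ (2 * k - 1) \<le> (real (n 1) / real (\<delta> p 1)) ^ (2 * k - 1)"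
    using g(5,6)[OF 1] by (intro power_mono divide_left_mono mult_pos_pos) auto
  also have "\<dots> = (real (n 1) / real (\<delta> p 1)) ^ (2 * k - 1) * 1" by simp
  also have "\<dots> \<le> (real (n 1) / real (\<delta> p 1)) ^ (2 * k - 1) * (\<Prod>c\<in>{1..d} - {1}. (real (n c) / real (\<delta> p c)) ^ (2 * k - 1))"
    using ge1 by (intro mult_left_mono prod_ge_1) auto
  also have "\<dots> = (\<Prod>c=1..d. (real (n c) / real (\<delta> p c)) ^ (2 * k - 1))"
    using 1 by (intro prod.remove[symmetric]) auto
  also have "\<dots> \<le> volume_sum lo hi p" by (rule volume_sum_ge[OF p])
  finally show ?thesis by simp
qed

section \<open>Widths of the bumps, anchors and active indices\<close>

definition scale :: "nat \<Rightarrow> mindex \<Rightarrow> nat \<Rightarrow> nat" where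
  "scale m p c = max 1 (\<delta> p c div m)"

text \<open>A lattice of mesh about D / m from the lower corner of the cell. The cell is at most 3 *
  D long and D is below 2 * m meshes, hence \<open>6 * m\<close> steps. Lattice points may leave the
  grid; only indices in \<open>J\<close> become active.\<close>

abbreviation "cell_anchors m p \<equiv> (\<lambda>a c. lo p c + a c * max 1 (D c div m)) ` PiE {1..d} (\<lambda>_. {0..6 * m})"

definition anchors :: "nat \<Rightarrow> mindex set" where
  "anchors m = S \<union> (\<Union>p\<in>S. cell_anchors m p)"

text \<open>The differences of an atom cut at \<open>t'\<close> live on the cube of side k above
  \<open>t'\<close>, so these are the indices needed to span all atoms cut at anchors.\<close>

definition active :: "nat \<Rightarrow> mindex set" where
  "active m = {j \<in> J. \<exists>t'\<in>anchors m. \<forall>c\<in>{1..d}. j c \<in> {t' c..t' c + k - 1}}"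

lemma active_subset: "active m \<subseteq> J"
  by (auto simp: active_def)

lemma finite_anchors: "finite (anchors m)"
  unfolding anchors_def using finite_S by (intro finite_UnI finite_UN_I finite_imageI finite_PiE) auto

lemma card_active_le: "card (active m) \<le> card S * ((1 + (6 * m + 1) ^ d) * k ^ d)"
proof -
  have "card (anchors m) \<le> card S + card (\<Union>p\<in>S. cell_anchors m p)"
    unfolding anchors_def by (rule card_Un_le)
  also have "\<dots> \<le> card S + (\<Sum>p\<in>S. card (cell_anchors m p))"
    using finite_S by (intro add_left_mono card_UN_le)
  also have "\<dots> \<le> card S + (\<Sum>p\<in>S. (6 * m + 1) ^ d)"
  proof (intro add_left_mono sum_mono)
    fix p
    have "card (cell_anchors m p) \<le> card (PiE {1..d} (\<lambda>_::nat. {0..6 * m}))"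
      by (intro card_image_le finite_PiE) auto
    then show "card (cell_anchors m p) \<le> (6 * m + 1) ^ d"
      by (simp add: card_PiE)
  qed
  finally have A: "card (anchors m) \<le> card S * (1 + (6 * m + 1) ^ d)" by simp
  have "active m \<subseteq> (\<Union>t'\<in>anchors m. PiE {1..d} (\<lambda>c. {t' c..t' c + k - 1}))"
  proof
    fix j assume "j \<in> active m"
    then obtain t' where "t' \<in> anchors m" "j \<in> J" "\<forall>c\<in>{1..d}. j c \<in> {t' c..t' c + k - 1}"
      by (auto simp: active_def)
    moreover from this have "j \<in> PiE {1..d} (\<lambda>c. {t' c..t' c + k - 1})"
      unfolding diff_grid_def hyperrect_def PiE_def by blast
    ultimately show "j \<in> (\<Union>t'\<in>anchors m. PiE {1..d} (\<lambda>c. {t' c..t' c + k - 1}))" by blast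
  qed
  then have "card (active m) \<le> card (\<Union>t'\<in>anchors m. PiE {1..d} (\<lambda>c. {t' c..t' c + k - 1}))"
    using finite_anchors by (intro card_mono finite_UN_I finite_PiE) auto
  also have "\<dots> \<le> (\<Sum>t'\<in>anchors m. card (PiE {1..d} (\<lambda>c. {t' c..t' c + k - 1})))"
    by (intro card_UN_le finite_anchors)
  also have "\<dots> = (\<Sum>t'\<in>anchors m. k ^ d)"
    using k_ge_1 by (intro sum.cong refl) (simp add: card_PiE)
  also have "\<dots> \<le> card S * ((1 + (6 * m + 1) ^ d) * k ^ d)"
    using mult_le_mono1[OF A, of "k ^ d"] by (simp only: mult.assoc sum_constant of_nat_id)
  finally show ?thesis .
qed

text \<open>The offset from the lower corner is rounded down to a multiple of the mesh. With mesh 1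
  the rounding is exact, so the bound also holds when D / m is below 1.\<close>

lemma anchor_near:
  assumes j: "j \<in> J" and m: "1 \<le> m"
  obtains t' p where "t' \<in> anchors m" "p \<in> S"
    "\<And>c. c \<in> {1..d} \<Longrightarrow> \<bar>real (j c) - real (t' c)\<bar> \<le> real (D c) / real m"
proof -
  obtain p where p: "p \<in> S" "j \<in> hyperrect d (lo p) (hi p)" using cell_cover[OF j] by blast
  define q where "q c = max 1 (D c div m)" for c
  define a where "a = restrict (\<lambda>c. (j c - lo p c) div q c) {1..d}"
  define t' where "t' = (\<lambda>c. lo p c + a c * q c)"
  have jc: "lo p c \<le> j c" "j c \<le> hi p c" if "c \<in> {1..d}" for c
    using p(2) that unfolding hyperrect_def by (auto dest: PiE_mem)
  have a: "a \<in> PiE {1..d} (\<lambda>_. {0..6 * m})"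
  proof -
    have "(j c - lo p c) div q c \<le> 6 * m" if c: "c \<in> {1..d}" for c
    proof -
      have "j c - lo p c \<le> 3 * D c" using jc[OF c] cell_geometry(7)[OF p(1) c] by linarith
      also have "\<dots> \<le> 6 * m * q c" using div_bounds(1)[OF m, of "D c"] unfolding q_def by linarith
      finally have "(j c - lo p c) div q c \<le> (6 * m * q c) div q c" by (rule div_le_mono)
      then show ?thesis by (simp add: q_def)
    qed
    then show ?thesis by (auto simp: a_def)
  qed
  show ?thesis
  proof
    have "t' \<in> cell_anchors m p"
      unfolding t'_def q_def using a by (rule imageI)
    then show "t' \<in> anchors m" unfolding anchors_def using p(1) by blast
    show "p \<in> S" by (rule p(1))
    fix c assume c: "c \<in> {1..d}"
    have "t' c = lo p c + (j c - lo p c) div q c * q c" using c by (simp add: t'_def a_def)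
    then have jt: "j c = t' c + (j c - lo p c) mod q c"
      using jc(1)[OF c] div_mult_mod_eq[of "j c - lo p c" "q c"] by linarith
    show "\<bar>real (j c) - real (t' c)\<bar> \<le> real (D c) / real m"
    proof (cases "q c \<ge> 2")
      case True
      then have "m * q c \<le> D c" unfolding q_def by (rule div_bounds(2)[OF m])
      then have "real m * real (q c) \<le> real (D c)" by (simp flip: of_nat_mult)
      then have qD: "real (q c) \<le> real (D c) / real m" using m by (simp add: field_simps)
      have "(j c - lo p c) mod q c < q c" by (simp add: q_def)
      then have "\<bar>real (j c) - real (t' c)\<bar> \<le> real (q c)" using jt by linarith
      then show ?thesis using qD by linarith
    next
      case False
      then have "q c = 1" by (simp add: q_def)
      then show ?thesis using jt by simp
    qed
  qed
qed

text \<open>The support stays inside the cell for two reasons: a width of at least 2 satisfies m *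
  width \<le> \<delta> with m > k, and width 1 is covered by k < \<delta>.\<close>

lemma scale_bounds:
  assumes p: "p \<in> S" and c: "c \<in> {1..d}" and m: "k < m"
  shows "1 \<le> scale m p c" "k * scale m p c < \<delta> p c" "real (\<delta> p c) \<le> 2 * real m * real (scale m p c)"
    "2 \<le> scale m p c \<Longrightarrow> m * scale m p c \<le> \<delta> p c"
proof -
  have m1: "1 \<le> m" using m by simp
  show s1: "1 \<le> scale m p c" by (simp add: scale_def)
  show s4: "m * scale m p c \<le> \<delta> p c" if "2 \<le> scale m p c"
    using div_bounds(2)[OF m1] that unfolding scale_def .
  show "k * scale m p c < \<delta> p c"
  proof (cases "2 \<le> scale m p c")
    case True
    have "k * scale m p c < m * scale m p c" using m s1 by simp
    then show ?thesis using s4[OF True] by linarith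
  next
    case False
    then have "scale m p c = 1" using s1 by simp
    then show ?thesis using cell_geometry(5)[OF p c] by simp
  qed
  have "\<delta> p c < 2 * m * scale m p c" using div_bounds(1)[OF m1] unfolding scale_def .
  then have "real (\<delta> p c) \<le> real (2 * m * scale m p c)" by (simp only: of_nat_le_iff less_imp_le)
  then show "real (\<delta> p c) \<le> 2 * real m * real (scale m p c)" by simp
qed

lemma scale_support:
  assumes p: "p \<in> S" and m: "k < m"
  shows "\<forall>c\<in>{1..d}. int (k + 1) \<le> int (p c) - int (k * scale m p c) \<and> int (p c) + int (k * scale m p c) \<le> int (n c)"
proof
  fix c assume c: "c \<in> {1..d}"
  have "k + 1 + k * scale m p c \<le> p c" "p c + k * scale m p c \<le> n c"
    using cell_geometry(1-4)[OF p c] scale_bounds(2)[OF p c m] k_ge_1 by linarith+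
  then have "int (k + 1 + k * scale m p c) \<le> int (p c)" "int (p c + k * scale m p c) \<le> int (n c)"
    by (simp_all only: of_nat_le_iff)
  then show "int (k + 1) \<le> int (p c) - int (k * scale m p c) \<and> int (p c) + int (k * scale m p c) \<le> int (n c)"
    unfolding of_nat_add by linarith
qed

lemma scale_interior:
  assumes p: "p \<in> S" and m: "k < m" and j: "j \<in> G" "\<And>c. c \<in> {1..d} \<Longrightarrow> \<bar>int (j c) - int (p c)\<bar> \<le> int (k * scale m p c)"
  shows "j \<in> hyperrect_interior d (lo p) (hi p)"
proof -
  have "lo p c < j c \<and> j c < hi p c" if c: "c \<in> {1..d}" for c
    using cell_geometry(2,3)[OF p c] scale_bounds(2)[OF p c m] j(2)[OF c] k_ge_1 by linarith
  then show ?thesis using j(1) unfolding grid_def hyperrect_def hyperrect_interior_def PiE_def by auto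
qed

end

context tensor_model
begin

section \<open>Noise weights against the deficits of the bumps\<close>

definition residual :: "tensor set \<Rightarrow> mindex \<Rightarrow> tensor" where
  "residual Q j = (\<lambda>i. perp_atom j i - proj_on G Q (perp_atom j) i)"

end

context tessellated_model
begin

text \<open>The atom of \<open>j\<close> cut at an anchor has only active differences, so by
  \<open>synthesis\<close> its projection lies in the span of \<open>Q\<close>. The distance of
  \<open>perp_atom j\<close> to the span is thus at most the distance between two cuts of the same
  polynomial.\<close>

lemma residual_norm_le:
  assumes Q: "orthonormal G Q" and act: "\<And>i. i \<in> active m \<Longrightarrow> proj_on G Q (perp_atom i) = perp_atom i"
    and j: "j \<in> J" and t': "t' \<in> anchors m"
  shows "ip (residual Q j) (residual Q j)
    \<le> N * atom_const d k * (\<Sum>c=1..d. (\<bar>real (j c) - real (t' c)\<bar> / real (n c)) ^ (2 * k - 1))"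
proof -
  define v where "v = pr (atom d n k t' j)"
  have v: "pr v = v" by (simp add: v_def)
  have Dv: "Dk v i = 0" if i: "i \<in> J" "i \<notin> active m" for i
  proof -
    obtain c where c: "c \<in> {1..d}" "i c \<notin> {t' c..t' c + k - 1}"
      using i t' unfolding active_def by blast
    show ?thesis
      using inner_on_kernel_atom_eq_0[where t=t' and c=c and j=j, OF i(1) k_ge_1 n_ge_1 c] i(1)
      unfolding v_def total_diff_pr[OF i(1)] unfolding total_diff_eq[OF i(1)] by simp
  qed
  have "proj_on G Q v = (\<lambda>i. \<Sum>j\<in>J. Dk v j * proj_on G Q (perp_atom j) i)"
    by (subst (1) synthesis[OF v]) (rule proj_on_sum)
  also have "\<dots> = (\<lambda>i. \<Sum>j\<in>J. Dk v j * perp_atom j i)"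
  proof (intro ext sum.cong refl)
    fix i j assume "j \<in> J"
    then show "Dk v j * proj_on G Q (perp_atom j) i = Dk v j * perp_atom j i"
      using act[of j] Dv[of j] by (cases "j \<in> active m") auto
  qed
  also have "\<dots> = v" by (rule synthesis[OF v, symmetric])
  finally have "proj_on G Q v = v" .
  then have "ip (residual Q j) (residual Q j) \<le> ip (\<lambda>i. perp_atom j i - v i) (\<lambda>i. perp_atom j i - v i)"
    unfolding residual_def by (rule norm_residual_le[OF Q])
  also have "(\<lambda>i. perp_atom j i - v i) = pr (\<lambda>i. atom d n k j j i - atom d n k t' j i)"
    by (simp add: v_def perp_atom_def proj_on_linear)
  also have "ip \<dots> \<dots> \<le> ip (\<lambda>i. atom d n k j j i - atom d n k t' j i) (\<lambda>i. atom d n k j j i - atom d n k t' j i)"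
    by (rule norm_proj_on_le) simp
  also have "\<dots> \<le> N * atom_const d k * (\<Sum>c=1..d. (\<bar>real (j c) - real (t' c)\<bar> / real (n c)) ^ (2 * k - 1))"
    using j diff_grid_subset k_ge_1 n_ge_1 by (intro norm_atom_diff_le) auto
  finally show ?thesis .
qed

abbreviation "radius \<equiv> sqrt (\<Sum>c=1..d. (real (D c) / real (n c)) ^ (2 * k - 1))"

lemma bump_support:
  assumes p: "p \<in> S" and m: "k < m" and j: "j \<in> J" and nz: "tensor_bump (scale m p) p j \<noteq> 0"
  shows "c \<in> {1..d} \<Longrightarrow> \<bar>int (j c) - int (p c)\<bar> \<le> int (k * (scale m p c - 1))"
    and "j \<in> hyperrect_interior d (lo p) (hi p)"
proof -
  have s: "\<And>c. c \<in> {1..d} \<Longrightarrow> 1 \<le> scale m p c" using scale_bounds(1)[OF p _ m] by blast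
  show *: "\<bar>int (j c) - int (p c)\<bar> \<le> int (k * (scale m p c - 1))" if "c \<in> {1..d}" for c
  proof (rule ccontr)
    assume "\<not> \<bar>int (j c) - int (p c)\<bar> \<le> int (k * (scale m p c - 1))"
    then have "tensor_bump (scale m p) p j = 0"
      by (intro tensor_bump_eq_0[OF s d_ge_1 that]) (auto simp: not_le)
    then show False using nz by blast
  qed
  show "j \<in> hyperrect_interior d (lo p) (hi p)"
  proof (rule scale_interior[OF p m])
    show "j \<in> G" using j diff_grid_subset by blast
    fix c assume c: "c \<in> {1..d}"
    have "int (k * (scale m p c - 1)) \<le> int (k * scale m p c)" unfolding of_nat_le_iff by (intro mult_le_mono2) simp
    then show "\<bar>int (j c) - int (p c)\<bar> \<le> int (k * scale m p c)" using *[OF c] by linarith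
  qed
qed

text \<open>Where all bumps vanish, a nearby anchor keeps the weight below a fraction 1 / m of the
  squared radius. Inside a bump the anchor is its centre, and the deficit has to win coordinate by
  coordinate. In both cases the hypothesis relating \<open>cs\<close> and \<open>m\<close> closes
  the gap.\<close>

lemma noise_condition:
  assumes m: "k < m" and cs: "0 < cs" "atom_const d k * real k \<le> cs\<^sup>2 * real m"
    and l0: "0 \<le> l0" and lam: "cs * real d * radius * l0 \<le> lam"
    and j: "j \<in> J"
    and v: "\<And>t'. t' \<in> anchors m \<Longrightarrow>
      v \<le> l0 * sqrt (atom_const d k * (\<Sum>c=1..d. (\<bar>real (j c) - real (t' c)\<bar> / real (n c)) ^ (2 * k - 1)))"
  shows "v \<le> lam * (1 - (\<Sum>p\<in>S. tensor_bump (scale m p) p j))"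
proof (cases "\<exists>p\<in>S. tensor_bump (scale m p) p j \<noteq> 0")
  case False
  then have 0: "(\<Sum>p\<in>S. tensor_bump (scale m p) p j) = 0" by (intro sum.neutral) auto
  have A0: "0 \<le> atom_const d k" by (simp add: atom_const_def)
  have m1: "1 \<le> m" using m by simp
  obtain t' p where t': "t' \<in> anchors m" "p \<in> S"
    "\<And>c. c \<in> {1..d} \<Longrightarrow> \<bar>real (j c) - real (t' c)\<bar> \<le> real (D c) / real m"
    using anchor_near[OF j m1] by blast
  let ?B = "(\<Sum>c=1..d. (\<bar>real (j c) - real (t' c)\<bar> / real (n c)) ^ (2 * k - 1))"
  have "?B
      \<le> (\<Sum>c=1..d. (real (D c) / real (n c)) ^ (2 * k - 1) / real m)"
  proof (rule sum_mono)
    fix c assume c: "c \<in> {1..d}"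
    have "(\<bar>real (j c) - real (t' c)\<bar> / real (n c)) ^ (2 * k - 1) \<le> (real (D c) / real m / real (n c)) ^ (2 * k - 1)"
      using t'(3)[OF c] by (intro power_mono divide_right_mono) auto
    also have "\<dots> = (real (D c) / real (n c)) ^ (2 * k - 1) / real m ^ (2 * k - 1)"
      by (simp add: power_divide power_mult_distrib mult.commute)
    \<comment> \<open>One power of \<open>m\<close> is enough, and it is available for every
      k.\<close>
    also have "\<dots> \<le> (real (D c) / real (n c)) ^ (2 * k - 1) / real m"
      using m1 k_ge_1 by (intro divide_left_mono self_le_power) auto
    finally show "(\<bar>real (j c) - real (t' c)\<bar> / real (n c)) ^ (2 * k - 1) \<le> (real (D c) / real (n c)) ^ (2 * k - 1) / real m" .
  qed
  also have "\<dots> = radius\<^sup>2 / real m"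
    by (simp add: sum_nonneg sum_divide_distrib)
  finally have B: "?B \<le> radius\<^sup>2 / real m" .
  have "atom_const d k * 1 \<le> atom_const d k * real k" using k_ge_1 A0 by (intro mult_left_mono) auto
  then have Am: "atom_const d k / real m \<le> cs\<^sup>2" using cs(2) m1 by (simp add: divide_le_eq)
  have "sqrt (atom_const d k * ?B)
    \<le> sqrt (atom_const d k * (radius\<^sup>2 / real m))"
    using B A0 by (intro real_sqrt_le_mono mult_left_mono) auto
  also have "\<dots> \<le> sqrt (cs\<^sup>2 * radius\<^sup>2)"
    using mult_right_mono[OF Am, of "radius\<^sup>2"] by (intro real_sqrt_le_mono) (simp del: real_sqrt_pow2_iff)
  also have "\<dots> = cs * radius" using cs(1) by (simp add: real_sqrt_mult sum_nonneg)
  finally have "v \<le> l0 * (cs * radius)"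
    using v[OF t'(1)] mult_left_mono[OF _ l0] order_trans by blast
  also have "\<dots> \<le> l0 * (cs * radius) * real d"
  proof -
    have "0 \<le> l0 * (cs * radius)" using l0 cs(1) by (intro mult_nonneg_nonneg) (auto intro: sum_nonneg)
    then show ?thesis using mult_left_mono[of 1 "real d" "l0 * (cs * radius)"] d_ge_1 by simp
  qed
  also have "\<dots> \<le> lam" using lam by (simp add: mult_ac)
  finally show ?thesis unfolding 0 by simp
next
  case True
  then obtain p where p: "p \<in> S" "tensor_bump (scale m p) p j \<noteq> 0" by blast
  have A0: "0 \<le> atom_const d k" by (simp add: atom_const_def)
  have uniq: "tensor_bump (scale m p') p' j = 0" if "p' \<in> S" "p' \<noteq> p" for p'
    using interior_cells[OF that(1) p(1) bump_support(2)[OF that(1) m j] bump_support(2)[OF p(1) m j p(2)]] that(2) by blast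
  have "(\<Sum>p'\<in>S. tensor_bump (scale m p') p' j) = tensor_bump (scale m p) p j"
    using finite_S p(1) uniq by (subst sum.remove[of _ p]) auto
  moreover define e where "e c = \<bar>real (j c) - real (p c)\<bar>" for c
  define Z where "Z = (\<Sum>c=1..d. sqrt ((e c / (real k * real (scale m p c))) ^ (2 * k - 1)))"
  have "tensor_bump (scale m p) p j \<le> 1 - Z / real d"
    unfolding Z_def e_def using scale_bounds(1)[OF p(1) _ m] bump_support(1)[OF p(1) m j p(2)] d_ge_1
    by (intro tensor_bump_le) auto
  ultimately have om: "Z / real d \<le> 1 - (\<Sum>p'\<in>S. tensor_bump (scale m p') p' j)" by simp
  have mk: "real m / real k \<ge> 1" using m k_ge_1 by simp
  \<comment> \<open>The width is at most D / m, so the deficit, measured in units of k times the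
    width, gains a factor m / k over the noise.\<close>
  have summand: "sqrt (real m / real k) * sqrt ((e c / real (n c)) ^ (2 * k - 1))
      \<le> radius * sqrt ((e c / (real k * real (scale m p c))) ^ (2 * k - 1))" if c: "c \<in> {1..d}" for c
  proof (cases "e c = 0")
    case True
    then show ?thesis using k_ge_1 by (simp add: power_0_left)
  next
    case False
    let ?s = "real (scale m p c)"
    have e0: "0 \<le> e c" by (simp add: e_def)
    \<comment> \<open>A bump of width 1 sits on the single value \<open>p c\<close>, against the
      assumption that \<open>e c\<close> is nonzero.\<close>
    have "scale m p c \<noteq> 1"
    proof
      assume "scale m p c = 1"
      then have "int (j c) = int (p c)" using bump_support(1)[OF p(1) m j p(2) c] by simp
      then show False using False by (simp add: e_def)
    qed
    then have "2 \<le> scale m p c" using scale_bounds(1)[OF p(1) c m] by linarith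
    then have "m * scale m p c \<le> D c"
      using scale_bounds(4)[OF p(1) c m] cell_geometry(6)[OF p(1) c] by linarith
    then have mD: "real m * ?s \<le> real (D c)" by (simp flip: of_nat_mult)
    have s: "0 < ?s" using scale_bounds(1)[OF p(1) c m] by simp
    have n: "0 < real (n c)" using n_ge_1 c by (auto simp: Suc_le_eq)
    have base: "real m / real k * (e c / real (n c)) \<le> real (D c) / real (n c) * (e c / (real k * ?s))"
    proof -
      have "real m / real k * (e c / real (n c)) = (real m * ?s) * (e c / (real k * ?s * real (n c)))"
        using s by simp
      also have "\<dots> \<le> real (D c) * (e c / (real k * ?s * real (n c)))"
        using mD e0 by (intro mult_right_mono) auto
      finally show ?thesis by (simp add: mult_ac)
    qed
    have "real m / real k * (e c / real (n c)) ^ (2 * k - 1) \<le> (real m / real k) ^ (2 * k - 1) * (e c / real (n c)) ^ (2 * k - 1)"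
      using mk k_ge_1 e0 by (intro mult_right_mono self_le_power) auto
    also have "\<dots> = (real m / real k * (e c / real (n c))) ^ (2 * k - 1)" by (simp only: power_mult_distrib)
    also have "\<dots> \<le> (real (D c) / real (n c) * (e c / (real k * ?s))) ^ (2 * k - 1)"
      using base e0 by (intro power_mono) auto
    finally have "sqrt (real m / real k * (e c / real (n c)) ^ (2 * k - 1))
       \<le> sqrt ((real (D c) / real (n c) * (e c / (real k * ?s))) ^ (2 * k - 1))"
      by (rule real_sqrt_le_mono)
    then have "sqrt (real m / real k) * sqrt ((e c / real (n c)) ^ (2 * k - 1))
      \<le> sqrt ((real (D c) / real (n c)) ^ (2 * k - 1)) * sqrt ((e c / (real k * ?s)) ^ (2 * k - 1))"
      by (simp only: real_sqrt_mult power_mult_distrib)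
    also have "\<dots> \<le> radius * sqrt ((e c / (real k * ?s)) ^ (2 * k - 1))"
      using c e0 by (intro mult_right_mono real_sqrt_le_mono member_le_sum[where f="\<lambda>c. (real (D c) / real (n c)) ^ (2 * k - 1)"]) auto
    finally show ?thesis .
  qed
  let ?E = "(\<Sum>c=1..d. (e c / real (n c)) ^ (2 * k - 1))"
  have "sqrt ?E \<le> (\<Sum>c=1..d. sqrt ((e c / real (n c)) ^ (2 * k - 1)))"
    using L2_set_le_sum[of "{1..d}" "\<lambda>c. sqrt ((e c / real (n c)) ^ (2 * k - 1))"]
    by (simp add: L2_set_def e_def)
  then have "sqrt (real m / real k) * sqrt ?E
     \<le> (\<Sum>c=1..d. sqrt (real m / real k) * sqrt ((e c / real (n c)) ^ (2 * k - 1)))"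
    unfolding sum_distrib_left[symmetric] using mk by (intro mult_left_mono) auto
  also have "\<dots> \<le> radius * Z" unfolding Z_def sum_distrib_left by (intro sum_mono summand)
  finally have RZ: "sqrt (real m / real k) * sqrt ?E \<le> radius * Z" .
  have "sqrt (atom_const d k) \<le> sqrt (cs\<^sup>2 * (real m / real k))"
    using cs(2) k_ge_1 by (intro real_sqrt_le_mono) (simp add: le_divide_eq)
  also have "\<dots> = cs * sqrt (real m / real k)" using cs(1) by (simp add: real_sqrt_mult real_sqrt_divide)
  finally have A: "sqrt (atom_const d k) \<le> cs * sqrt (real m / real k)" .
  have "p \<in> anchors m" using p(1) by (simp add: anchors_def)
  from v[OF this] have "v \<le> l0 * (sqrt (atom_const d k) * sqrt ?E)"
    by (simp add: real_sqrt_mult e_def)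
  also have "\<dots> \<le> l0 * (cs * sqrt (real m / real k) * sqrt ?E)"
    using A l0 by (intro mult_left_mono mult_right_mono) (auto simp: sum_nonneg e_def)
  also have "\<dots> = l0 * cs * (sqrt (real m / real k) * sqrt ?E)" by simp
  also have "\<dots> \<le> l0 * cs * (radius * Z)"
    using RZ l0 cs(1) by (intro mult_left_mono) auto
  also have "\<dots> = cs * real d * radius * l0 * (Z / real d)" using d_ge_1 by simp
  also have "\<dots> \<le> lam * (Z / real d)"
    using lam by (intro mult_right_mono) (auto simp: Z_def e_def intro!: divide_nonneg_nonneg sum_nonneg)
  also have "\<dots> \<le> lam * (1 - (\<Sum>p'\<in>S. tensor_bump (scale m p') p' j))"
  proof (intro mult_left_mono om)
    have "0 \<le> cs * real d * radius * l0" using cs(1) l0 by (simp add: sum_nonneg)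
    then show "0 \<le> lam" using lam by linarith
  qed
  finally show ?thesis .
qed

end

section \<open>The bound with high probability\<close>

context tessellated_model
begin

abbreviation "vol \<equiv> volume_sum lo hi"
abbreviation "log_sum \<equiv> (\<Sum>c=1..d. ln (exp 1 * real (D c)))"

lemma log_sum_ge_1: "p \<in> S \<Longrightarrow> 1 \<le> log_sum"
proof -
  assume p: "p \<in> S"
  have "1 \<le> ln (exp 1 * real (D c))" if "c \<in> {1..d}" for c
    using cell_geometry(5,6)[OF p that] by (simp add: ln_mult)
  then have "(\<Sum>c=1..d. 1) \<le> log_sum" by (intro sum_mono) auto
  then show "1 \<le> log_sum" using d_ge_1 by simp
qed

text \<open>Forward differences widen the support of a bump by k, from
  \<open>k * (scale - 1)\<close> to \<open>k * scale\<close>, which still lies in the interior of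
  the cell; interiors of different cells do not meet.\<close>

lemma adj_bump_disjoint:
  assumes m: "k < m" and p: "p \<in> S" "p' \<in> S" "p \<noteq> p'" and i: "i \<in> G"
  shows "adj (tensor_bump (scale m p) p) i * adj (tensor_bump (scale m p') p') i = 0"
proof (rule ccontr)
  have near: "i \<in> hyperrect_interior d (lo q) (hi q)"
    if q: "q \<in> S" "adj (tensor_bump (scale m q) q) i \<noteq> 0" for q
  proof (rule scale_interior[OF q(1) m i])
    fix c assume c: "c \<in> {1..d}"
    show "\<bar>int (i c) - int (q c)\<bar> \<le> int (k * scale m q c)"
    proof (rule ccontr)
      assume "\<not> \<bar>int (i c) - int (q c)\<bar> \<le> int (k * scale m q c)"
      then have "adj (tensor_bump (scale m q) q) i = 0"
        using scale_bounds(1)[OF q(1) _ m] d_ge_1 scale_support[OF q(1) m] i c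
        by (intro adj_tensor_bump_eq_0[where c'=c]) (auto simp: not_le)
      then show False using q(2) by blast
    qed
  qed
  assume "adj (tensor_bump (scale m p) p) i * adj (tensor_bump (scale m p') p') i \<noteq> 0"
  then show False using interior_cells[OF p(1,2) near[OF p(1)] near[OF p(2)]] p(3) by auto
qed

text \<open>Passing from the widths to the shorter side distances costs (2 * m)^(2k-1) in each
  coordinate.\<close>

lemma norm_adj_bump_le:
  assumes m: "k < m" and p: "p \<in> S" and Kb: "energy_bound k Kb"
  shows "N * ip (adj (tensor_bump (scale m p) p)) (adj (tensor_bump (scale m p) p))
    \<le> Kb ^ d * (2 * real m) ^ ((2 * k - 1) * d) * (log_sum * vol p)"
proof -
  let ?M = "scale m p"
  note Kb0 = energy_boundD(1)[OF Kb]
  have s1: "1 \<le> ?M c" if "c \<in> {1..d}" for c using scale_bounds(1)[OF p that m] .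
  have "N * ip (adj (tensor_bump ?M p)) (adj (tensor_bump ?M p))
     \<le> Kb ^ d * (\<Prod>c=1..d. (real (n c) / real (?M c)) ^ (2 * k - 1)) * (\<Sum>c=1..d. ln (exp 1 * real (?M c)))"
    by (rule norm_adj_tensor_bump_le[OF s1 d_ge_1 scale_support[OF p m] Kb])
  also have "\<dots> \<le> Kb ^ d * ((2 * real m) ^ ((2 * k - 1) * d) * vol p) * log_sum"
  proof (intro mult_mono mult_left_mono)
    have "(\<Prod>c=1..d. (real (n c) / real (?M c)) ^ (2 * k - 1))
      \<le> (\<Prod>c=1..d. (2 * real m) ^ (2 * k - 1) * (real (n c) / real (\<delta> p c)) ^ (2 * k - 1))"
    proof (intro prod_mono conjI)
      fix c assume c: "c \<in> {1..d}"
      have d0: "0 < real (\<delta> p c)" using cell_geometry(5)[OF p c] by simp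
      have M0: "0 < real (?M c)" using s1[OF c] by simp
      have "real (n c) / real (?M c) \<le> 2 * real m * (real (n c) / real (\<delta> p c))"
        using mult_left_mono[OF scale_bounds(3)[OF p c m], of "real (n c)"] d0 M0
        by (simp add: field_simps)
      then have "(real (n c) / real (?M c)) ^ (2 * k - 1) \<le> (2 * real m * (real (n c) / real (\<delta> p c))) ^ (2 * k - 1)"
        by (intro power_mono) auto
      then show "(real (n c) / real (?M c)) ^ (2 * k - 1) \<le> (2 * real m) ^ (2 * k - 1) * (real (n c) / real (\<delta> p c)) ^ (2 * k - 1)"
        by (simp only: power_mult_distrib)
    qed simp
    also have "\<dots> = (2 * real m) ^ ((2 * k - 1) * d) * (\<Prod>c=1..d. (real (n c) / real (\<delta> p c)) ^ (2 * k - 1))"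
      by (simp only: prod.distrib prod_constant card_atLeastAtMost power_mult) simp
    also have "\<dots> \<le> (2 * real m) ^ ((2 * k - 1) * d) * vol p"
      by (intro mult_left_mono volume_sum_ge[OF p]) auto
    finally show "(\<Prod>c=1..d. (real (n c) / real (?M c)) ^ (2 * k - 1)) \<le> (2 * real m) ^ ((2 * k - 1) * d) * vol p" .
    show "(\<Sum>c=1..d. ln (exp 1 * real (?M c))) \<le> log_sum"
    proof (intro sum_mono ln_mono mult_left_mono)
      fix c assume c: "c \<in> {1..d}"
      have "?M c \<le> k * ?M c" using k_ge_1 by simp
      then have "?M c \<le> D c" using scale_bounds(2)[OF p c m] cell_geometry(6)[OF p c] by linarith
      then show "real (?M c) \<le> real (D c)" by simp
      show "0 < exp 1 * real (?M c)" using s1[OF c] by simp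
    qed auto
    show "0 \<le> Kb ^ d * ((2 * real m) ^ ((2 * k - 1) * d) * vol p)"
      using Kb0 by (intro mult_nonneg_nonneg) (auto simp: volume_sum_def intro!: sum_nonneg)
    have "0 \<le> ln (exp 1 * real (?M c))" if "c \<in> {1..d}" for c
      using s1[OF that] by (simp add: ln_mult)
    then show "0 \<le> (\<Sum>c=1..d. ln (exp 1 * real (?M c)))" by (intro sum_nonneg) auto
  qed (use Kb0 in \<open>auto intro!: prod_nonneg\<close>)
  finally show ?thesis by (simp add: mult_ac)
qed

text \<open>The domination that pays for the active set: the squared radius is at least the ratio D
  1 / n 1 to the power 2k - 1, and \<open>vol p\<close> is at least its inverse.\<close>

lemma lambda0_power2_le:
  assumes p: "p \<in> S" and cs: "0 < cs" and l0: "0 \<le> l0" and lam: "cs * real d * radius * l0 \<le> lam"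
  shows "cs\<^sup>2 * l0\<^sup>2 \<le> lam\<^sup>2 * vol p"
proof -
  have 1: "1 \<in> {1..d}" using d_ge_1 by simp
  define x where "x = (real (D 1) / real (n 1)) ^ (2 * k - 1)"
  have D0: "0 < real (D 1)" using cell_geometry(5,6)[OF p 1] by simp
  have n0: "0 < real (n 1)" using n_ge_1 1 by (auto simp: Suc_le_eq)
  have x: "0 < x" using D0 n0 by (simp add: x_def)
  have r0: "0 \<le> radius" by (simp add: sum_nonneg)
  have "x \<le> (\<Sum>c=1..d. (real (D c) / real (n c)) ^ (2 * k - 1))"
    unfolding x_def by (rule member_le_sum[OF 1]) auto
  then have "x \<le> radius\<^sup>2" by (simp add: sum_nonneg)
  then have "cs\<^sup>2 * l0\<^sup>2 * x \<le> cs\<^sup>2 * l0\<^sup>2 * radius\<^sup>2" by (intro mult_left_mono) auto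
  also have "\<dots> = (cs * 1 * radius * l0)\<^sup>2" by (simp only: power_mult_distrib) simp
  also have "\<dots> \<le> (cs * real d * radius * l0)\<^sup>2"
    using cs r0 l0 d_ge_1 by (intro power_mono mult_right_mono mult_left_mono) auto
  also have "\<dots> \<le> lam\<^sup>2" using lam cs r0 l0 by (intro power_mono) auto
  finally have "cs\<^sup>2 * l0\<^sup>2 \<le> lam\<^sup>2 * (1 / x)" using x by (simp add: field_simps)
  also have "1 / x = (real (n 1) / real (D 1)) ^ (2 * k - 1)" by (simp add: x_def power_divide)
  also have "lam\<^sup>2 * (real (n 1) / real (D 1)) ^ (2 * k - 1) \<le> lam\<^sup>2 * vol p"
    by (intro mult_left_mono volume_sum_ge_1[OF p]) auto
  finally show ?thesis .
qed

text \<open>The triangle inequality and \<open>estimator_Lipschitz\<close> make the loss 1-Lipschitz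
  in the noise for the Euclidean norm, hence for the sum of absolute values.\<close>

lemma measurable_loss:
  assumes "0 < \<sigma>" "0 \<le> lam"
  shows "(\<lambda>\<epsilon>. frob_norm d n (\<lambda>j. est lam (observation d n f0 \<epsilon>) j - z j))
    \<in> borel_measurable (noise_law d n \<sigma>)"
proof -
  interpret gaussian_vector G \<sigma> by standard (use assms in auto)
  have law: "noise_law d n \<sigma> = law" by (simp add: noise_law_def law_def)
  let ?f = "\<lambda>\<epsilon>. est lam (observation d n f0 \<epsilon>)"
  have "frob_norm d n (\<lambda>j. ?f x j - z j) - frob_norm d n (\<lambda>j. ?f y j - z j) \<le> (\<Sum>j\<in>G. \<bar>x j - y j\<bar>)" for x y
  proof -
    have "frob_norm d n (\<lambda>j. ?f x j - z j) \<le> frob_norm d n (\<lambda>j. ?f x j - ?f y j) + frob_norm d n (\<lambda>j. ?f y j - z j)"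
      using L2_set_triangle_ineq[of "\<lambda>j. ?f x j - ?f y j" "\<lambda>j. ?f y j - z j" G] by (simp add: frob_norm_def)
    moreover have "(frob_norm d n (\<lambda>j. ?f x j - ?f y j))\<^sup>2 \<le> (frob_norm d n (\<lambda>j. x j - y j))\<^sup>2"
    proof -
      have "ip (\<lambda>j. observation d n f0 x j - observation d n f0 y j) (\<lambda>j. observation d n f0 x j - observation d n f0 y j)
         = ip (\<lambda>j. x j - y j) (\<lambda>j. x j - y j)"
        by (rule inner_on_cong) (auto simp: observation_def)
      then show ?thesis unfolding frob_norm_power2
        using estimator_Lipschitz[OF assms(2), of "observation d n f0 x" "observation d n f0 y"] by simp
    qed
    then have "frob_norm d n (\<lambda>j. ?f x j - ?f y j) \<le> frob_norm d n (\<lambda>j. x j - y j)"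
      by (rule power2_le_imp_le) (simp add: frob_norm_def)
    moreover have "frob_norm d n (\<lambda>j. x j - y j) \<le> (\<Sum>j\<in>G. \<bar>x j - y j\<bar>)"
      unfolding frob_norm_def by (rule L2_set_le_sum_abs)
    ultimately show ?thesis by linarith
  qed
  then show ?thesis unfolding law by (intro measurable_Lipschitz) blast
qed

text \<open>The first summand of \<open>K\<close> comes from the noise in the active directions, the
  second from the energy of the bumps. The slot \<open>r\<close> receives the term containing
  \<open>x\<close> in the final statement.\<close>

lemma oracle_probability:
  assumes m: "k < m" and cs: "0 < cs" "atom_const d k * real k \<le> cs\<^sup>2 * real m"
    and Kb: "energy_bound k Kb"
    and \<sigma>: "0 < \<sigma>" and t: "0 < t"
    and lam: "cs * real d * radius * lambda0 d n \<sigma> t \<le> lam"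
    and r: "0 \<le> r"
  defines "K \<equiv> 2 * real ((1 + (6 * m + 1) ^ d) * k ^ d) / cs\<^sup>2 + 2 * (Kb ^ d * (2 * real m) ^ ((2 * k - 1) * d))"
  shows "1 - exp (- t) \<le> measure (noise_law d n \<sigma>)
    {\<epsilon> \<in> space (noise_law d n \<sigma>).
      (frob_norm d n (\<lambda>j. est lam (observation d n f0 \<epsilon>) j - proj_perp d n k f0 j))\<^sup>2 / N
      \<le> (frob_norm d n (\<lambda>j. g j - proj_perp d n k f0 j))\<^sup>2 / N
        + 4 * lam * (\<Sum>j\<in>J - S. \<bar>Dk g j\<bar>) + r + K * (lam\<^sup>2 * log_sum * (\<Sum>p\<in>S. vol p))}"
proof -
  interpret gv: gaussian_vector G \<sigma> by standard (use \<sigma> in auto)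
  have law: "noise_law d n \<sigma> = gv.law" by (simp add: noise_law_def gv.law_def)
  have N: "N \<ge> 1" using num_entries_pos by simp
  \<comment> \<open>Chosen so that \<open>2 * N * exp (- u\<^sup>2 / 2) = exp (- t)\<close>; then
    \<open>lambda0\<close> is \<open>\<sigma> * u / sqrt N\<close>.\<close>
  define u where "u = sqrt (2 * ln (2 * N) + 2 * t)"
  have ln0: "0 \<le> ln (2 * N)" using N by simp
  have u: "u > 0" "u\<^sup>2 = 2 * ln (2 * N) + 2 * t" using ln0 t by (simp_all add: u_def)
  define l0 where "l0 = lambda0 d n \<sigma> t"
  have l0_eq: "l0 = \<sigma> * u / sqrt N" by (simp add: l0_def lambda0_def u_def real_sqrt_divide)
  have l0: "0 \<le> l0" using \<sigma> u N by (simp add: l0_eq)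
  have r0: "0 \<le> radius" by (simp add: sum_nonneg)
  have "0 \<le> cs * real d * radius * l0" using cs(1) r0 l0 by simp
  then have lam0: "0 \<le> lam" using lam unfolding l0_def by linarith
  have fin_act: "finite (active m)" by (rule finite_subset[OF active_subset finite_J])
  obtain Q where Q: "orthonormal G Q" "card Q \<le> card (active m)"
    "\<And>i. i \<in> active m \<Longrightarrow> proj_on G Q (perp_atom i) = perp_atom i"
    using gram_schmidt[OF finite_G fin_act, of perp_atom] proj_on_supported[OF orthonormal_perp_basis]
    unfolding perp_atom_def by metis
  have finQ: "finite Q" using Q(1) by (simp add: orthonormal_def)
  \<comment> \<open>Residuals at active indices are 0 and left out. As \<open>Q\<close> has at most
    as many elements as there are active indices, \<open>V\<close> has at most
    \<open>card J\<close>, hence at most \<open>N\<close> elements.\<close>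
  define V where "V = Q \<union> residual Q ` (J - active m)"
  have finV: "finite V" using finQ by (simp add: V_def)
  have "card V \<le> card Q + card (residual Q ` (J - active m))" unfolding V_def by (rule card_Un_le)
  also have "\<dots> \<le> card (active m) + card (J - active m)"
    using Q(2) by (intro add_mono card_image_le) auto
  also have "\<dots> = card J"
    using card_Diff_subset[OF fin_act active_subset] card_mono[OF finite_J active_subset] by simp
  also have "\<dots> \<le> num_entries d n"
    using card_mono[OF finite_G diff_grid_subset] by (simp add: card_grid)
  finally have cV: "real (card V) \<le> N" by simp
  let ?E = "{x \<in> space gv.law. \<forall>v\<in>V. \<bar>ip x v\<bar> \<le> sqrt (ip v v) * \<sigma> * u}"
  let ?R = "(frob_norm d n (\<lambda>j. g j - proj_perp d n k f0 j))\<^sup>2 / N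
        + 4 * lam * (\<Sum>j\<in>J - S. \<bar>Dk g j\<bar>) + r + K * (lam\<^sup>2 * log_sum * (\<Sum>p\<in>S. vol p))"
  let ?T = "{\<epsilon> \<in> space gv.law.
      (frob_norm d n (\<lambda>j. est lam (observation d n f0 \<epsilon>) j - proj_perp d n k f0 j))\<^sup>2 / N
      \<le> ?R}"
  have "?E \<subseteq> ?T"
  proof
    fix x assume x: "x \<in> ?E"
    have res0: "residual Q j = (\<lambda>_. 0)" if "j \<in> active m" for j
      using Q(3)[OF that] by (simp add: residual_def)
    have resE: "\<bar>ip x (residual Q j)\<bar> \<le> sqrt (ip (residual Q j) (residual Q j)) * \<sigma> * u" if j: "j \<in> J" for j
    proof (cases "j \<in> active m")
      case True
      then show ?thesis by (simp add: res0 inner_on_def)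
    next
      case False
      then have "residual Q j \<in> V" using j by (auto simp: V_def)
      then show ?thesis using x by blast
    qed
    let ?w = "\<lambda>p. tensor_bump (scale m p) p"
    have s1: "\<And>c. c \<in> {1..d} \<Longrightarrow> 1 \<le> scale m p c" if "p \<in> S" for p
      using scale_bounds(1)[OF that _ m] .
    have noise: "\<bar>ip x (residual Q j)\<bar> \<le> N * lam * (1 - (\<Sum>p\<in>S. ?w p j))" if j: "j \<in> J" for j
    proof -
      have "\<bar>ip x (residual Q j)\<bar> / N \<le> lam * (1 - (\<Sum>p\<in>S. ?w p j))"
      proof (rule noise_condition[OF m cs l0 lam[folded l0_def] j])
        fix t' assume t': "t' \<in> anchors m"
        let ?B = "atom_const d k * (\<Sum>c=1..d. (\<bar>real (j c) - real (t' c)\<bar> / real (n c)) ^ (2 * k - 1))"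
        have "sqrt (ip (residual Q j) (residual Q j)) \<le> sqrt (N * ?B)"
          using residual_norm_le[OF Q(1,3) j t'] by (intro real_sqrt_le_mono) (simp add: mult.assoc)
        then have "sqrt (ip (residual Q j) (residual Q j)) * (\<sigma> * u) \<le> sqrt (N * ?B) * (\<sigma> * u)"
          using \<sigma> u(1) by (intro mult_right_mono) auto
        then have "\<bar>ip x (residual Q j)\<bar> / N \<le> sqrt (N * ?B) * (\<sigma> * u) / N"
          using resE[OF j] N by (intro divide_right_mono) (auto simp: mult.assoc)
        also have "sqrt (N * ?B) * (\<sigma> * u) / N = \<sigma> * u * sqrt ?B * (sqrt N / N)"
          by (simp add: real_sqrt_mult)
        also have "sqrt N / N = 1 / sqrt N"
          using N by (simp add: real_div_sqrt field_simps)
        finally show "\<bar>ip x (residual Q j)\<bar> / N \<le> l0 * sqrt ?B" by (simp add: l0_eq)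
      qed
      then show ?thesis using N by (simp add: divide_le_eq mult_ac)
    qed
    have main: "ip (\<lambda>i. est lam (observation d n f0 x) i - pr f0 i) (\<lambda>i. est lam (observation d n f0 x) i - pr f0 i) / N
      \<le> ip (\<lambda>i. g i - pr f0 i) (\<lambda>i. g i - pr f0 i) / N + 4 * lam * (\<Sum>j\<in>J - S. \<bar>Dk g j\<bar>)
        + 2 * (\<Sum>q\<in>Q. (ip x q)\<^sup>2) / N
        + 2 * lam\<^sup>2 * N * (\<Sum>p\<in>S. ip (adj (?w p)) (adj (?w p)))"
    proof (rule oracle_inequality[OF lam0 _ S_subset Q(1), where w="?w" and e=x])
      show "observation d n f0 x i = f0 i + x i" if "i \<in> G" for i using that by (simp add: observation_def)
      show "0 \<le> ?w p j" if "p \<in> S" for p j by (rule tensor_bump_nonneg[OF s1[OF that] d_ge_1])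
      show "?w p p' = (if p = p' then 1 else 0)" if "p \<in> S" "p' \<in> S" for p p'
      proof (cases "p = p'")
        case True
        then show ?thesis using tensor_bump_self[OF s1[OF that(1)] d_ge_1] by simp
      next
        case False
        have "?w p p' = 0"
        proof (rule ccontr)
          assume "?w p p' \<noteq> 0"
          then have "p' \<in> hyperrect_interior d (lo p) (hi p)"
            using that S_subset by (intro bump_support(2)[OF _ m]) auto
          then show False using interior_cells[OF that _ p_interior[OF that(2)]] False by blast
        qed
        then show ?thesis using False by simp
      qed
      show "adj (?w p) i * adj (?w p') i = 0" if "p \<in> S" "p' \<in> S" "p \<noteq> p'" "i \<in> G" for p p' i
        using that by (rule adj_bump_disjoint[OF m])
      show "\<bar>ip x (\<lambda>i. perp_atom j i - proj_on G Q (perp_atom j) i)\<bar> \<le> N * lam * (1 - (\<Sum>p\<in>S. ?w p j))" if "j \<in> J" for j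
        using noise[OF that] unfolding residual_def .
    qed
    let ?C1 = "real ((1 + (6 * m + 1) ^ d) * k ^ d)" and ?C2 = "Kb ^ d * (2 * real m) ^ ((2 * k - 1) * d)"
    have "(\<Sum>q\<in>Q. (ip x q)\<^sup>2) \<le> (\<Sum>q\<in>Q. N * l0\<^sup>2)"
    proof (rule sum_mono)
      fix q assume q: "q \<in> Q"
      then have "\<bar>ip x q\<bar> \<le> sqrt (ip q q) * \<sigma> * u" using x by (auto simp: V_def)
      moreover have "ip q q = 1" using Q(1) q by (simp add: orthonormal_def)
      ultimately have "\<bar>ip x q\<bar>\<^sup>2 \<le> (\<sigma> * u)\<^sup>2" by (intro power_mono) auto
      also have "\<dots> = N * l0\<^sup>2" using N by (simp add: l0_eq power_divide power_mult_distrib)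
      finally show "(ip x q)\<^sup>2 \<le> N * l0\<^sup>2" by simp
    qed
    also have "\<dots> \<le> N * (real (card S) * ?C1 * l0\<^sup>2)"
    proof -
      have "card Q \<le> card S * ((1 + (6 * m + 1) ^ d) * k ^ d)" using Q(2) card_active_le order_trans by blast
      then have "real (card Q) \<le> real (card S) * ?C1" by (simp only: of_nat_mult[symmetric] of_nat_le_iff)
      then have "real (card Q) * (N * l0\<^sup>2) \<le> real (card S) * ?C1 * (N * l0\<^sup>2)" by (intro mult_right_mono) auto
      then show ?thesis by (simp add: mult_ac)
    qed
    finally have q1: "2 * (\<Sum>q\<in>Q. (ip x q)\<^sup>2) / N \<le> 2 * (real (card S) * ?C1 * l0\<^sup>2)"
      using N by (simp add: divide_le_eq mult_ac)
    \<comment> \<open>The cost of the active directions is divided among the points of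
      \<open>S\<close>, so that \<open>lambda0_power2_le\<close> and \<open>log_sum_ge_1\<close>
      apply to each share.\<close>
    have "2 * (real (card S) * ?C1 * l0\<^sup>2) = (\<Sum>p\<in>S. 2 * ?C1 / cs\<^sup>2 * (cs\<^sup>2 * l0\<^sup>2))"
      using cs(1) by simp
    also have "\<dots> \<le> (\<Sum>p\<in>S. 2 * ?C1 / cs\<^sup>2 * (lam\<^sup>2 * vol p * log_sum))"
    proof (intro sum_mono mult_left_mono)
      fix p assume p: "p \<in> S"
      have "cs\<^sup>2 * l0\<^sup>2 \<le> lam\<^sup>2 * vol p"
        by (rule lambda0_power2_le[OF p cs(1) l0 lam[folded l0_def]])
      also have "\<dots> = lam\<^sup>2 * vol p * 1" by simp
      also have "\<dots> \<le> lam\<^sup>2 * vol p * log_sum"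
        using log_sum_ge_1[OF p] by (intro mult_left_mono mult_nonneg_nonneg) (auto simp: volume_sum_def intro!: sum_nonneg)
      finally show "cs\<^sup>2 * l0\<^sup>2 \<le> lam\<^sup>2 * vol p * log_sum" .
    qed auto
    finally have q2: "2 * (real (card S) * ?C1 * l0\<^sup>2) \<le> (\<Sum>p\<in>S. 2 * ?C1 / cs\<^sup>2 * (lam\<^sup>2 * vol p * log_sum))" .
    have q3: "2 * lam\<^sup>2 * N * (\<Sum>p\<in>S. ip (adj (?w p)) (adj (?w p))) \<le> (\<Sum>p\<in>S. 2 * ?C2 * (lam\<^sup>2 * vol p * log_sum))"
      unfolding sum_distrib_left[of "2 * lam\<^sup>2 * N"]
    proof (rule sum_mono)
      fix p assume p: "p \<in> S"
      have "2 * lam\<^sup>2 * (N * ip (adj (?w p)) (adj (?w p))) \<le> 2 * lam\<^sup>2 * (?C2 * (log_sum * vol p))"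
        using norm_adj_bump_le[OF m p Kb] by (intro mult_left_mono) auto
      then show "2 * lam\<^sup>2 * N * ip (adj (?w p)) (adj (?w p)) \<le> 2 * ?C2 * (lam\<^sup>2 * vol p * log_sum)"
        by (simp only: mult_ac)
    qed
    have alg: "a * (l * v * s) + b * (l * v * s) = (a + b) * (l * s * v)" for a b l v s :: real
      by (simp add: algebra_simps)
    have "(\<Sum>p\<in>S. 2 * ?C1 / cs\<^sup>2 * (lam\<^sup>2 * vol p * log_sum)) + (\<Sum>p\<in>S. 2 * ?C2 * (lam\<^sup>2 * vol p * log_sum))
       = (\<Sum>p\<in>S. K * (lam\<^sup>2 * log_sum * vol p))"
      unfolding sum.distrib[symmetric] K_def by (intro sum.cong refl alg)
    also have "\<dots> = K * (lam\<^sup>2 * log_sum * (\<Sum>p\<in>S. vol p))"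
      by (simp only: sum_distrib_left mult.assoc)
    finally have q4: "(\<Sum>p\<in>S. 2 * ?C1 / cs\<^sup>2 * (lam\<^sup>2 * vol p * log_sum)) + (\<Sum>p\<in>S. 2 * ?C2 * (lam\<^sup>2 * vol p * log_sum))
       = K * (lam\<^sup>2 * log_sum * (\<Sum>p\<in>S. vol p))" .
    have comb: "a \<le> b + c + r + s" if "a \<le> b + c + e1 + e2" "e1 \<le> e" "e \<le> s1" "e2 \<le> s2" "s1 + s2 = s" "0 \<le> r"
      for a b c e1 e2 e s1 s2 s r :: real
      using that by linarith
    show "x \<in> ?T"
    proof (rule CollectI, rule conjI)
      show "x \<in> space gv.law" using x by blast
      show "(frob_norm d n (\<lambda>j. est lam (observation d n f0 x) j - proj_perp d n k f0 j))\<^sup>2 / N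
        \<le> ?R"
        unfolding frob_norm_power2 proj_perp_eq by (rule comb[OF main q1 q2 q3 q4 r])
    qed
  qed
  \<comment> \<open>Monotonicity of the measure requires the larger event to be measurable.\<close>
  moreover have "?T \<in> sets gv.law"
  proof -
    have sets: "{\<epsilon> \<in> space gv.law. (F \<epsilon>)\<^sup>2 / N \<le> c} \<in> sets gv.law" if [measurable]: "F \<in> borel_measurable gv.law" for F c
      by measurable
    show ?thesis by (rule sets) (rule measurable_loss[OF \<sigma> lam0, unfolded law])
  qed
  ultimately have "measure gv.law ?E \<le> measure gv.law ?T"
    by (intro gv.law.finite_measure_mono)
  moreover have "1 - exp (- t) \<le> measure gv.law ?E"
  proof -
    have "exp (- u\<^sup>2 / 2) = exp (- t) / (2 * N)"
    proof -
      have "- u\<^sup>2 / 2 = - t - ln (2 * N)" unfolding u(2) by simp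
      then show ?thesis using N by (simp only: exp_diff) simp
    qed
    then have "2 * real (card V) * exp (- u\<^sup>2 / 2) = exp (- t) * (real (card V) / N)" using N by simp
    also have "\<dots> \<le> exp (- t) * 1" using cV N by (intro mult_left_mono) auto
    finally show ?thesis using gv.prob_all_abs_inner_on_le[OF u(1) finV] by linarith
  qed
  ultimately show ?thesis unfolding law by linarith
qed

end

lemma a0_pos: "0 < a0 k"
  by (simp add: a0_def)

lemma lambda0_nonneg:
  assumes "0 < \<sigma>" "0 < t" "1 \<le> num_entries d n"
  shows "0 \<le> lambda0 d n \<sigma> t"
proof -
  have "0 \<le> ln (2 * real (num_entries d n))" using assms(3) by (intro ln_ge_zero) auto
  then show ?thesis unfolding lambda0_def using assms by (intro mult_nonneg_nonneg) auto
qed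

theorem theorem5p2:
  fixes k :: nat
  assumes "k \<in> {1, 2, 3, 4}"
  shows "\<exists>(C0 :: real) (Creq :: nat \<Rightarrow> real).
    (\<forall>\<delta>. 0 < Creq \<delta> \<and> Creq \<delta> \<le> C0) \<and>
    Creq \<longlonglongrightarrow> real k powr ((2 * real k - 1) / 2) / a0 k \<and>
    (\<forall>d::nat. d \<ge> 1 \<longrightarrow> (\<exists>K::real. 0 < K \<and>
      (\<forall>(n :: nat \<Rightarrow> nat) (\<sigma> :: real) (f0 :: tensor) (g :: tensor) (S :: mindex set)
         (lo :: mindex \<Rightarrow> mindex) (hi :: mindex \<Rightarrow> mindex)
         (x :: real) (t :: real) (C :: real) (lam :: real).
        (\<forall>i\<in>{1..d}. 1 \<le> n i) \<longrightarrow>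
        0 < \<sigma> \<longrightarrow> 0 < x \<longrightarrow> 0 < t \<longrightarrow>
        f0 \<in> tensors d n \<longrightarrow> g \<in> tensors d n \<longrightarrow>
        S \<subseteq> hyperrect d (\<lambda>i. k + 1 + (k + 2) * k) (\<lambda>i. n i + 1 - k - (k + 2) * k) \<longrightarrow>
        is_tessellation d n k S lo hi \<longrightarrow>
        (\<forall>p\<in>S. \<forall>i\<in>{1..d}.
           (k + 2) * k \<le> min (side_dist k lo hi p i Minus) (side_dist k lo hi p i Plus)) \<longrightarrow>
        Creq (d_min d k S lo hi) \<le> C \<longrightarrow>
        C * real d * sqrt (\<Sum>i=1..d. (real (d_max k S lo hi i) / real (n i)) ^ (2 * k - 1))
          * lambda0 d n \<sigma> t \<le> lam \<longrightarrow>
        1 - exp (- x) - exp (- t) \<le>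
          measure (noise_law d n \<sigma>)
            {\<epsilon> \<in> space (noise_law d n \<sigma>).
               (frob_norm d n (\<lambda>j. estimator d n k lam (observation d n f0 \<epsilon>) j
                                   - proj_perp d n k f0 j))\<^sup>2 / real (num_entries d n)
               \<le> (frob_norm d n (\<lambda>j. g j - proj_perp d n k f0 j))\<^sup>2 / real (num_entries d n)
                 + 4 * lam * (\<Sum>j\<in>diff_grid d n k - S. \<bar>total_diff d n k g j\<bar>)
                 + 2 * \<sigma>\<^sup>2 / real (num_entries d n) * (sqrt x + sqrt (real (k * card S)))\<^sup>2
                 + K * (lam\<^sup>2 * (\<Sum>i=1..d. ln (exp 1 * real (d_max k S lo hi i)))
                        * (\<Sum>p\<in>S. \<Sum>z\<in>PiE {1..d} (\<lambda>_. {Minus, Plus}).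
                             (real (num_entries d n) / real (side_volume d k lo hi p z))
                               ^ (2 * k - 1)))})))"
proof -
  define cs where "cs = real k powr ((2 * real k - 1) / 2) / a0 k"
  have k: "1 \<le> k" using assms by auto
  then have cs: "0 < cs" by (simp add: cs_def a0_pos)
  show ?thesis
  \<comment> \<open>The threshold is constant and equal to its prescribed limit;
    \<open>oracle_probability\<close> accepts every positive \<open>cs\<close> once \<open>m\<close>
    is large enough.\<close>
  proof (rule exI[of _ cs], rule exI[of _ "\<lambda>_. cs"], intro conjI allI impI, goal_cases)
    case 3
    show ?case by (simp add: cs_def)
  next
    case (4 d)
    note d = 4
    obtain Kb where Kb0: "0 < Kb" and Kb: "energy_bound k Kb" using energy_bound_exists[OF k] by blast
    \<comment> \<open>The refinement \<open>m\<close> is fixed by k, d and \<open>cs\<close> alone,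
      so \<open>K\<close> is uniform in the side lengths, the noise level and the
      tessellation.\<close>
    obtain m0 where "atom_const d k * real k / cs\<^sup>2 \<le> real m0" using real_arch_simple by blast
    then have m0: "atom_const d k * real k \<le> cs\<^sup>2 * real m0" using cs by (simp add: divide_le_eq mult.commute)
    define m where "m = m0 + k + 1"
    have m: "k < m" by (simp add: m_def)
    have "cs\<^sup>2 * real m0 \<le> cs\<^sup>2 * real m" by (intro mult_left_mono) (auto simp: m_def)
    then have m_cs: "atom_const d k * real k \<le> cs\<^sup>2 * real m" using m0 by linarith
    define K where "K = 2 * real ((1 + (6 * m + 1) ^ d) * k ^ d) / cs\<^sup>2 + 2 * (Kb ^ d * (2 * real m) ^ ((2 * k - 1) * d))"
    have "0 < Kb ^ d * (2 * real m) ^ ((2 * k - 1) * d)" using Kb0 by (intro mult_pos_pos zero_less_power) (auto simp: m_def)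
    then have K0: "0 < K" unfolding K_def by (intro add_nonneg_pos) auto
    show ?case
    proof (intro exI[of _ K] conjI allI impI, rule K0, goal_cases)
      case (1 n \<sigma> f0 g S lo hi x t C lam)
      note n = 1(1) and \<sigma> = 1(2) and t = 1(4) and S = 1(7) and tess = 1(8) and side = 1(9)
        and C = 1(10) and lam = 1(11)
      let ?rad = "sqrt (\<Sum>i=1..d. (real (d_max k S lo hi i) / real (n i)) ^ (2 * k - 1))"
      let ?r = "2 * \<sigma>\<^sup>2 / real (num_entries d n) * (sqrt x + sqrt (real (k * card S)))\<^sup>2"
      interpret tessellated_model d n k S lo hi
        by unfold_locales (rule n k S tess side d)+
      have "0 \<le> real d * (?rad * lambda0 d n \<sigma> t)"
        using lambda0_nonneg[OF \<sigma> t, of d n] num_entries_pos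
        by (intro mult_nonneg_nonneg) (auto intro: sum_nonneg)
      from mult_right_mono[OF C this] have lam': "cs * real d * ?rad * lambda0 d n \<sigma> t \<le> lam"
        using lam by (simp add: mult.assoc)
      have r: "0 \<le> ?r" by simp
      \<comment> \<open>Subtracting \<open>exp (- x)\<close> only weakens the lower bound on the
        probability.\<close>
      show ?case
        unfolding K_def
        by (rule order_trans[OF _ oracle_probability[unfolded volume_sum_def,
              OF m cs m_cs Kb \<sigma> t lam' r]]) simp
    qed
  qed (simp_all add: cs)
qed

end
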